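(* Let $\ell \ge 4$ be an integer and let $G$ be a $2$-connected bipartite graph with bipartition classes $A$ and $B$, where $|A| = a$, $|B| = b$ and $b \ge a \ge \ell$. Suppose $G$ contains no cycle of length at least $2\ell$. Then \[ |E(G)| \le \frac{\ell}{2}(a+b) + \left(\frac{\ell}{2}-2\right)(b-a-4) - 4 . \] Moreover, equality holds if and only if $G$ is isomorphic to the graph $B_2(a,b,2\ell)$, defined as follows: start from the complete bipartite graph $K_{\ell-2,\,b}$ (with parts $A_0$ of size $\ell-2$ and $B$ of size $b$), fix two distinct vertices $u_1,u_2 \in B$, and add $a-(\ell-2)$ new pairwise non-adjacent vertices, each adjacent to exactly $u_1$ and $u_2$ (so these new vertices together with $A_0$ form the class of size $a$).
   Context: All graphs are finite, simple and undirected. A graph is $2$-connected if it is connected and remains connected after deleting any single vertex. "Contains no cycle of length at least $2\ell$" means $G$ has no subgraph isomorphic to a cycle $C_m$ with $m \ge 2\ell$. *)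

theory Defs
  imports Complex_Main "Graph_Theory.Graph_Theory"
begin

text \<open>
  Finite simple undirected graphs are the symmetric loop-free digraphs of the locale
  \<^locale>\<open>pair_graph\<close>: each undirected edge is a pair of opposite arcs, so edges
  are counted as the two-element sets of their end vertices.
\<close>

definition uedges :: "'a pair_pre_digraph \<Rightarrow> 'a set set" where
  "uedges G = (\<lambda>(u, v). {u, v}) ` parcs G"

definition bipartition :: "'a pair_pre_digraph \<Rightarrow> 'a set \<Rightarrow> 'a set \<Rightarrow> bool" where
  "bipartition G A B \<longleftrightarrow>
     A \<union> B = pverts G \<and> A \<inter> B = {} \<and> parcs G \<subseteq> A \<times> B \<union> B \<times> A"

definition two_connected :: "'a pair_pre_digraph \<Rightarrow> bool" where
  "two_connected G \<longleftrightarrow>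
     Digraph_Component.connected (with_proj G) \<and>
     (\<forall>v \<in> pverts G. Digraph_Component.connected (pre_digraph.del_vert (with_proj G) v))"

text \<open>
  A cycle of the symmetric digraph is a closed walk without repeated vertices; one of length at
  least 3 is the same as a subgraph isomorphic to the cycle graph of that length.  (Length 2 only
  occurs as an edge traversed back and forth, so the notion below is meant for \<open>k \<ge> 3\<close>.)
\<close>

definition has_cycle_of_length_ge :: "'a pair_pre_digraph \<Rightarrow> nat \<Rightarrow> bool" where
  "has_cycle_of_length_ge G k \<longleftrightarrow>
     (\<exists>p. pre_digraph.cycle (with_proj G) p \<and> k \<le> length p)"

text \<open>
  The graph $B_2(a,b,2l)$, for $a \ge l - 2$ and $b \ge 2$; the last argument below is $l$, not $2l$.
  The class of size $a$ consists of the vertices \<open>Inl i\<close>, where those with \<open>i < l - 2\<close> form $A_0$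
  and the others are the added vertices; the class of size $b$ consists of the vertices
  \<open>Inr j\<close>, with \<open>Inr 0\<close> and \<open>Inr 1\<close> in the role of $u_1$ and $u_2$.
\<close>

definition B2_half_arcs :: "nat \<Rightarrow> nat \<Rightarrow> nat \<Rightarrow> ((nat + nat) \<times> (nat + nat)) set" where
  "B2_half_arcs a b l =
     Inl ` {..<l - 2} \<times> Inr ` {..<b} \<union> Inl ` {l - 2..<a} \<times> {Inr 0, Inr 1}"

definition B2_graph :: "nat \<Rightarrow> nat \<Rightarrow> nat \<Rightarrow> (nat + nat) pair_pre_digraph" where
  "B2_graph a b l =
     \<lparr> pverts = Inl ` {..<a} \<union> Inr ` {..<b},
       parcs = B2_half_arcs a b l \<union> (B2_half_arcs a b l)\<inverse> \<rparr>"

end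

theory Submission
  imports Defs
begin

text \<open>
  The bound equals \<open>(l - 2) b + 2 (a - l + 2)\<close>.  From \<open>G\<close> delete vertices of the larger class that have degree
  at most \<open>l - 2\<close> and, once the classes are balanced, pairs \<open>x \<in> A\<close>, \<open>y \<in> B\<close> meeting at most \<open>l\<close> edges;
  the bound drops by at least the number of deleted edges.  If this gets stuck too early, all
  remaining pairs have degree sum at least \<open>l + 1\<close>, or all vertices of the larger class have
  degree at least \<open>l - 1\<close>.  A Hall-type argument then yields either a small component, which has too few
  edges, or a path with at least \<open>2 l\<close> vertices whose ends \<open>x \<in> A\<close> and \<open>y \<in> B\<close> have all
  their neighbours on the path and degree sum at least \<open>l + 1\<close>.  In a 2-connected graph such a path
  gives a cycle of length at least \<open>2 l\<close>.  Hence the descent ends with classes of size \<open>l - 1\<close> and at most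
  \<open>l - 3\<close> missing edges, where Hamiltonian paths through the rest of \<open>G\<close> force the missing edges to
  form a star; this is \<open>B\<^sub>2\<close>, and undoing the deletions preserves the structure.
\<close>

section \<open>Paths and cycles as vertex lists\<close>

text \<open>2-connectivity need not survive the deletions. Subgraphs are therefore only pairs of
  vertex sets \<open>S\<close>, \<open>Y\<close> with degrees counted inside them by
  \<open>nb\<close>, while long cycles are sought in all of \<open>G\<close>. Deleted vertices thus
  remain available for closing a cycle, and at the end of the descent they are indispensable:
  classes of size \<open>l - 1\<close> are too small to hold a cycle of length \<open>2 l\<close>,
  so outside vertices have to be routed through them. The degree sum \<open>l + 1\<close> is one
  more than the \<open>l\<close> vertices of one class that a forbidden cycle needs, because closing
  up a path can lose one successor of a neighbour. A component with classes of size p <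
  \<open>l\<close> has too few edges because p^2 < \<open>l\<close> p, while the bound grows by
  \<open>l\<close> with each further pair. In the descent either class may turn out to contain A_0,
  so the results are proved symmetrically in \<open>A\<close> and \<open>B\<close>. The reversed
  orientation is settled only at the end, by counting edges.\<close>

lemma Int_singletonD: "S \<inter> T = {x} \<Longrightarrow> y \<in> S \<Longrightarrow> y \<in> T \<Longrightarrow> y = x"
  by blast

definition gpath :: "('a \<Rightarrow> 'a \<Rightarrow> bool) \<Rightarrow> 'a list \<Rightarrow> bool" where
  "gpath E xs \<longleftrightarrow> xs \<noteq> [] \<and> distinct xs \<and> successively E xs"

definition gcycle :: "('a \<Rightarrow> 'a \<Rightarrow> bool) \<Rightarrow> 'a list \<Rightarrow> bool" where
  "gcycle E c \<longleftrightarrow> 3 \<le> length c \<and> distinct c \<and> successively E c \<and> E (last c) (hd c)"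

lemma gpath_ne: "gpath E xs \<Longrightarrow> xs \<noteq> []"
  by (simp add: gpath_def)

lemma gpath_single [simp]: "gpath E [x]"
  by (simp add: gpath_def)

lemma gpath_append:
  "gpath E (xs @ ys) \<longleftrightarrow> (if xs = [] then gpath E ys else if ys = [] then gpath E xs
     else gpath E xs \<and> gpath E ys \<and> set xs \<inter> set ys = {} \<and> E (last xs) (hd ys))"
  by (auto simp: gpath_def successively_append_iff)

lemma gpath_Cons:
  "gpath E (x # ys) \<longleftrightarrow> ys = [] \<or> gpath E ys \<and> x \<notin> set ys \<and> E x (hd ys)"
  by (cases ys) (auto simp: gpath_def)

lemma gpath_rev:
  assumes "gpath E xs" and "\<And>x y. E x y \<Longrightarrow> E y x"
  shows "gpath E (rev xs)"
proof -
  have "successively (\<lambda>x y. E y x) xs"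
    using assms(1) unfolding gpath_def
    by (metis assms(2) successively_mono)
  then show ?thesis using assms(1) by (simp add: gpath_def)
qed

lemma gcycle_iff_gpath:
  "gcycle E c \<longleftrightarrow> 3 \<le> length c \<and> gpath E c \<and> E (last c) (hd c)"
  by (auto simp: gcycle_def gpath_def)

lemma gcycle_append:
  assumes "gpath E xs" "gpath E ys" "set xs \<inter> set ys = {}"
    "E (last xs) (hd ys)" "E (last ys) (hd xs)" "3 \<le> length xs + length ys"
  shows "gcycle E (xs @ ys)"
  using assms by (auto simp: gcycle_iff_gpath gpath_append gpath_ne)

locale bip_graph =
  fixes A B :: "'a set" and E :: "'a \<Rightarrow> 'a \<Rightarrow> bool"
  assumes finA: "finite A" and finB: "finite B" and disj: "A \<inter> B = {}"
    and sym: "E x y \<Longrightarrow> E y x"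
    and bip: "E x y \<Longrightarrow> x \<in> A \<and> y \<in> B \<or> x \<in> B \<and> y \<in> A"
begin

lemma swapped_bip: "bip_graph B A E"
proof
  show "E x y \<Longrightarrow> x \<in> B \<and> y \<in> A \<or> x \<in> A \<and> y \<in> B" for x y using bip by blast
qed (use finA finB disj sym in auto)

lemma grev: "gpath E xs \<Longrightarrow> gpath E (rev xs)"
  using gpath_rev sym by blast

lemma adj_A: "E x y \<Longrightarrow> x \<in> A \<Longrightarrow> y \<in> B"
  using bip disj by blast

lemma adj_B: "E x y \<Longrightarrow> x \<in> B \<Longrightarrow> y \<in> A"
  using bip disj by blast

lemma gpath_sub: "gpath E xs \<Longrightarrow> hd xs \<in> A \<union> B \<Longrightarrow> set xs \<subseteq> A \<union> B"
proof (induction xs)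
  case (Cons x xs)
  show ?case
  proof (cases "xs = []")
    case False
    then have "gpath E xs" "E x (hd xs)" using Cons.prems by (auto simp: gpath_Cons)
    then show ?thesis using Cons.IH Cons.prems bip[of x "hd xs"] by auto
  qed (use Cons in auto)
qed simp

text \<open>Along a path the classes alternate, so lengths can be read off from the vertices of one
  class.\<close>

lemma gpath_count:
  "gpath E xs \<Longrightarrow> hd xs \<in> A \<union> B \<Longrightarrow>
     card (set xs \<inter> B) = (length xs + (if hd xs \<in> B then 1 else 0)) div 2
     \<and> (last xs \<in> A \<longleftrightarrow> (even (length xs) \<longleftrightarrow> hd xs \<in> B))"
proof (induction xs)
  case Nil
  then show ?case by (simp add: gpath_def)
next
  case (Cons x xs)
  show ?case
  proof (cases "xs = []")
    case True
    then show ?thesis using Cons.prems disj by auto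
  next
    case False
    then have p: "gpath E xs" "E x (hd xs)" "x \<notin> set xs" using Cons.prems by (auto simp: gpath_Cons)
    have h: "hd xs \<in> A \<union> B" "hd xs \<in> B \<longleftrightarrow> x \<notin> B" using bip[OF p(2)] disj by auto
    have IH: "card (set xs \<inter> B) = (length xs + (if hd xs \<in> B then 1 else 0)) div 2"
      "last xs \<in> A \<longleftrightarrow> (even (length xs) \<longleftrightarrow> hd xs \<in> B)"
      using Cons.IH[OF p(1) h(1)] by auto
    show ?thesis
    proof (cases "x \<in> B")
      case True
      then have "set (x # xs) \<inter> B = insert x (set xs \<inter> B)" by auto
      then have "card (set (x # xs) \<inter> B) = Suc (card (set xs \<inter> B))" using p(3) by simp
      then show ?thesis using IH h True False by auto
    next
      case F: False
      then have "set (x # xs) \<inter> B = set xs \<inter> B" by auto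
      then show ?thesis using IH h F False by auto
    qed
  qed
qed

lemma gcycle_count:
  assumes "gcycle E c" shows "length c = 2 * card (set c \<inter> B)"
proof -
  have p: "gpath E c" "E (last c) (hd c)" using assms by (auto simp: gcycle_iff_gpath)
  have h: "hd c \<in> A \<union> B" using bip[OF p(2)] by auto
  note g = gpath_count[OF p(1) h]
  have "last c \<in> A \<longleftrightarrow> hd c \<in> B" using bip[OF p(2)] disj by auto
  then have "even (length c)" using g by auto
  then show ?thesis using g by (auto elim: evenE)
qed

lemma gpath_AB_count:
  assumes "gpath E c" "hd c \<in> A" "last c \<in> B"
  shows "length c = 2 * card (set c \<inter> B)"
proof -
  have "hd c \<notin> B" "last c \<notin> A" using assms disj by auto
  then show ?thesis using gpath_count[OF assms(1)] assms by (auto elim!: evenE)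
qed

end

section \<open>Disjoint paths in 2-connected graphs\<close>

text \<open>For a vertex \<open>v\<close> of the graph this is connectedness after deleting
  \<open>v\<close>, for any other \<open>v\<close> plain connectedness.\<close>

locale two_conn_bip = bip_graph +
  assumes conn: "x \<in> A \<union> B \<Longrightarrow> y \<in> A \<union> B \<Longrightarrow> x \<noteq> v \<Longrightarrow> y \<noteq> v
    \<Longrightarrow> \<exists>xs. gpath E xs \<and> hd xs = x \<and> last xs = y \<and> v \<notin> set xs"
begin

text \<open>A shortest path from \<open>X\<close> to \<open>Y\<close> avoiding \<open>v\<close>
  meets either set only at its end there, as otherwise a piece could be cut off.\<close>

lemma connect:
  assumes "x \<in> X" "x \<noteq> v" "y \<in> Y" "y \<noteq> v" "x \<in> A \<union> B" "y \<in> A \<union> B"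
  obtains W where "gpath E W" "hd W \<in> X" "last W \<in> Y" "set W \<inter> X = {hd W}" "set W \<inter> Y = {last W}"
    "v \<notin> set W"
proof -
  define P where "P = (\<lambda>W. gpath E W \<and> hd W \<in> X \<and> last W \<in> Y \<and> v \<notin> set W)"
  have "\<exists>W. P W" using conn[of x y v] assms unfolding P_def by metis
  then obtain W where W: "P W" and min: "\<And>W'. P W' \<Longrightarrow> length W \<le> length W'"
    using ex_has_least_nat[of P _ length] by metis
  have ne: "W \<noteq> []" using W gpath_ne P_def by blast
  have "w = hd W" if "w \<in> set W" "w \<in> X" for w
  proof (rule ccontr)
    assume w: "w \<noteq> hd W"
    obtain us vs where d: "W = us @ w # vs" using split_list[OF \<open>w \<in> set W\<close>] by blast
    then have "us \<noteq> []" using w by auto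
    then have "P (w # vs)" using W that d unfolding P_def by (auto simp: gpath_append)
    then show False using min[of "w # vs"] d \<open>us \<noteq> []\<close> by simp
  qed
  moreover have "w = last W" if "w \<in> set W" "w \<in> Y" for w
  proof (rule ccontr)
    assume w: "w \<noteq> last W"
    obtain us vs where d: "W = (us @ [w]) @ vs" using split_list[OF \<open>w \<in> set W\<close>] by fastforce
    then have "vs \<noteq> []" using w by auto
    then have "P (us @ [w])" using W that d unfolding P_def
      by (cases us) (auto simp: gpath_append gpath_Cons split: if_splits)
    then show False using min[of "us @ [w]"] d \<open>vs \<noteq> []\<close> by simp
  qed
  ultimately show ?thesis using that[of W] W ne unfolding P_def by fastforce
qed

text \<open>Whitney's argument is run with the additional control that one of the two paths keeps the
  prescribed start \<open>i\<close>; in \<open>link\<close> one path moreover keeps the prescribed end \<open>j\<close>.  Without this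
  the cycle built in \<open>path_ends_degree\<close> could miss neighbours of the ends of the path.\<close>

definition fan :: "'a set \<Rightarrow> 'a \<Rightarrow> 'a list \<Rightarrow> 'a list \<Rightarrow> 'a \<Rightarrow> bool" where
  "fan L i P Q v \<longleftrightarrow> gpath E P \<and> gpath E Q \<and> last P = v \<and> last Q = v \<and> v \<notin> L
     \<and> set P \<inter> L = {hd P} \<and> set Q \<inter> L = {hd Q} \<and> set P \<inter> set Q = {v} \<and> (hd P = i \<or> hd Q = i)"

lemma fan_sym: "fan L i P Q v \<Longrightarrow> fan L i Q P v"
  unfolding fan_def by auto

text \<open>Augmentation: a path \<open>W\<close> avoiding the apex \<open>v\<close> runs from
  \<open>L\<close> or a fan path to \<open>T\<close>. If it leaves a fan path, that path is rerouted
  along \<open>W\<close> and the other becomes \<open>Pb\<close>; if it starts in \<open>L\<close>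
  off the fan, \<open>Pb\<close> is a fan path starting at \<open>i\<close>. Either way the start
  \<open>i\<close> is kept.\<close>

lemma fan_step:
  assumes f: "fan L i P Q v" and L: "L \<subseteq> A \<union> B" and i: "i \<in> L"
    and T: "t \<in> T" "t \<in> A \<union> B" "v \<notin> T" "T \<inter> L = {}" "T \<inter> (set P \<union> set Q) = {}"
  obtains Pa Pb where "gpath E Pa" "last Pa \<in> T" "set Pa \<inter> T = {last Pa}" "v \<notin> set Pa"
    "Pb = P \<or> Pb = Q" "set Pa \<inter> set Pb = {}" "set Pa \<inter> L = {hd Pa}" "hd Pa = i \<or> hd Pb = i"
proof -
  note result = that
  have hP: "hd P \<in> L" "hd Q \<in> L" using f unfolding fan_def by auto
  define X where "X = L \<union> set P \<union> set Q"
  have hPv: "hd P \<noteq> v" using f hP unfolding fan_def by auto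
  have hPX: "hd P \<in> X" "hd P \<in> A \<union> B" using hP X_def L by auto
  have tv: "t \<noteq> v" using T by auto
  obtain W where W: "gpath E W" "hd W \<in> X" "last W \<in> T" "set W \<inter> X = {hd W}"
      "set W \<inter> T = {last W}" "v \<notin> set W"
    by (rule connect[OF hPX(1) hPv T(1) tv hPX(2) T(2)])
  have ne: "W \<noteq> []" using W gpath_ne by blast
  have case1: thesis if f: "fan L i P' Q' v" and PQ: "{P', Q'} = {P, Q}" and h: "hd W \<in> set P'" for P' Q'
  proof -
    obtain us vs where d: "P' = us @ hd W # vs" using split_list[OF h] by blast
    have lastP: "last P' = v" using f unfolding fan_def by blast
    have hv: "hd W \<noteq> v" using W ne by auto
    then have vs: "vs \<noteq> []" using d lastP by auto
    have PQ': "P' = P \<and> Q' = Q \<or> P' = Q \<and> Q' = P" using PQ by (auto simp: doubleton_eq_iff)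
    have XX: "X = L \<union> set P' \<union> set Q'" using PQ' X_def by auto
    have gP: "gpath E P'" "gpath E Q'" "set P' \<inter> set Q' = {v}" "set P' \<inter> L = {hd P'}" using f unfolding fan_def by auto
    define Pa where "Pa = us @ W"
    have uW: "set us \<inter> set W = {}"
    proof -
      have "set us \<inter> set W \<subseteq> {hd W}" using W(4) XX d by auto
      moreover have "hd W \<notin> set us" using gP d by (auto simp: gpath_def)
      ultimately show ?thesis by blast
    qed
    have "v \<notin> set us" using gP(1) d lastP vs by (auto simp: gpath_def)
    have "gpath E Pa" unfolding Pa_def using gP(1) W(1) uW ne d by (auto simp: gpath_append split: if_splits)
    moreover have "last Pa \<in> T" using ne W by (simp add: Pa_def)
    moreover have "set us \<inter> T = {}" using T(5) d PQ' by auto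
    then have "set Pa \<inter> T = {last Pa}" using W ne by (auto simp: Pa_def)
    moreover have "v \<notin> set Pa" using W \<open>v \<notin> set us\<close> by (simp add: Pa_def)
    moreover have "Q' = P \<or> Q' = Q" using PQ by blast
    moreover have "set Pa \<inter> set Q' = {}"
    proof -
      have "set us \<inter> set Q' = {}" using gP(3) d \<open>v \<notin> set us\<close> by auto
      moreover have "hd W \<notin> set Q'" using h gP(3) hv by auto
      then have "set W \<inter> set Q' = {}" using Int_singletonD[OF W(4)] XX by blast
      ultimately show ?thesis by (auto simp: Pa_def)
    qed
    moreover have "hd Pa = hd P'" using d ne by (cases us) (auto simp: Pa_def)
    moreover have "set Pa \<inter> L = {hd Pa}"
    proof -
      have "set W \<inter> L \<subseteq> {hd W}" using W(4) XX by auto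
      moreover have "set us \<subseteq> set P'" using d by auto
      ultimately have "set Pa \<inter> L \<subseteq> {hd P'}" using gP(4) h by (auto simp: Pa_def)
      moreover have "hd Pa \<in> set Pa" using ne by (cases us) (auto simp: Pa_def)
      moreover have "hd P' \<in> L" using gP(4) by auto
      ultimately show ?thesis using \<open>hd Pa = hd P'\<close> by auto
    qed
    moreover have "hd Pa = i \<or> hd Q' = i" using f \<open>hd Pa = hd P'\<close> unfolding fan_def by auto
    ultimately show thesis using result[of Pa Q'] by blast
  qed
  consider "hd W \<in> set P" | "hd W \<in> set Q" | "hd W \<in> L" "hd W \<notin> set P" "hd W \<notin> set Q"
    using W(2) X_def by blast
  then show ?thesis
  proof cases
    case 1 then show ?thesis using case1[of P Q] f by blast
  next
    case 2 then show ?thesis using case1[of Q P] fan_sym[OF f] by blast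
  next
    case 3
    have "set W \<inter> set P = {}" "set W \<inter> set Q = {}" using Int_singletonD[OF W(4)] 3 X_def by blast+
    moreover have "set W \<inter> L = {hd W}" using W(4) 3 X_def ne by auto
    moreover have "hd P = i \<or> hd Q = i" using f unfolding fan_def by auto
    ultimately show ?thesis using that[of W P] that[of W Q] W by blast
  qed
qed

definition link :: "'a set \<Rightarrow> 'a set \<Rightarrow> 'a \<Rightarrow> 'a \<Rightarrow> 'a list \<Rightarrow> 'a list \<Rightarrow> bool" where
  "link L R i j P Q \<longleftrightarrow> gpath E P \<and> gpath E Q \<and> set P \<inter> set Q = {}
     \<and> set P \<inter> L = {hd P} \<and> set Q \<inter> L = {hd Q} \<and> set P \<inter> R = {last P} \<and> set Q \<inter> R = {last Q}
     \<and> (hd P = i \<or> hd Q = i) \<and> (last P = j \<or> last Q = j)"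

text \<open>The apex moves along \<open>ps\<close> towards \<open>j\<close>. The augmentation aims
  at the rest \<open>ts\<close> of \<open>ps\<close> together with \<open>R\<close>: landing on
  \<open>ts\<close> gives a fan with a later apex, landing off it gives a link, in which the other
  fan path is prolonged by \<open>ts\<close> and so ends in \<open>j\<close>.\<close>

lemma fan_or_link:
  assumes "L \<subseteq> A \<union> B" "i \<in> L" "L \<inter> R = {}" "j \<in> R" "j \<in> A \<union> B"
    and "fan L i P Q v" "gpath E ps" "hd ps = v" "last ps = j"
    and "set ps \<inter> (set P \<union> set Q) = {v}" "set ps \<inter> L = {}"
    and "(set P \<union> set Q \<union> set ps) \<inter> R \<subseteq> {j}"
  shows "(\<exists>P' Q'. fan L i P' Q' j \<and> (set P' \<union> set Q') \<inter> R \<subseteq> {j}) \<or> (\<exists>P' Q'. link L R i j P' Q')"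
  using assms(6-)
proof (induction "length ps" arbitrary: ps P Q v rule: less_induct)
  case less
  note f = less.prems(1) and ps = less.prems(2-4) and dis = less.prems(5-7)
  obtain ts where ts: "ps = v # ts" using ps gpath_ne by (metis list.collapse)
  show ?case
  proof (cases "ts = []")
    case True
    then have "v = j" using ps ts by simp
    then show ?thesis using f dis(3) by blast
  next
    case False
    have gts: "gpath E ts" "E v (hd ts)" "v \<notin> set ts" using ps ts False by (auto simp: gpath_Cons)
    have lts: "last ts = j" using ps ts False by simp
    then have jt: "j \<in> set ts" using False by auto
    have vR: "v \<notin> R" using dis(3) ts jt gts(3) by auto
    have tsPQ: "set ts \<inter> (set P \<union> set Q) = {}" using dis(1) ts gts(3) by auto
    have RPQ: "R \<inter> (set P \<union> set Q) = {}"
      using dis(3) tsPQ jt by blast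
    have T: "j \<in> set ts \<union> R" "v \<notin> set ts \<union> R" "(set ts \<union> R) \<inter> L = {}"
      "(set ts \<union> R) \<inter> (set P \<union> set Q) = {}"
      using jt vR gts(3) dis(2) ts assms(3) tsPQ RPQ by auto
    obtain Pa Pb where w: "gpath E Pa" "last Pa \<in> set ts \<union> R" "set Pa \<inter> (set ts \<union> R) = {last Pa}"
      "v \<notin> set Pa" "Pb = P \<or> Pb = Q" "set Pa \<inter> set Pb = {}" "set Pa \<inter> L = {hd Pa}" "hd Pa = i \<or> hd Pb = i"
      by (rule fan_step[OF f assms(1,2) T(1) assms(5) T(2-4)])
    have Pb: "gpath E Pb" "last Pb = v" "set Pb \<inter> L = {hd Pb}" "v \<notin> L" using f w(5) unfolding fan_def by auto
    have Pbne: "Pb \<noteq> []" "Pa \<noteq> []" using Pb(1) w(1) gpath_ne by auto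
    have Pbts: "set Pb \<inter> (set ts \<union> R) = {}" using T(4) w(5) by blast
    show ?thesis
    proof (cases "last Pa \<in> set ts")
      case True
      then obtain us vs where d: "ts = us @ last Pa # vs" using split_list by metis
      define z where "z = last Pa"
      have d': "ts = (us @ [z]) @ vs" using d z_def by simp
      have guz: "gpath E (us @ [z])" "set (us @ [z]) \<inter> set vs = {}"
        using gts(1) unfolding d' gpath_append[of E "us @ [z]" vs] by (auto split: if_splits)
      have hdz: "hd (us @ [z]) = hd ts" unfolding d' by (cases us) auto
      \<comment> \<open>\<open>Pb\<close> ends in the old apex, from which \<open>ps\<close>
        continues to the landing point \<open>z\<close>, the new apex.\<close>
      define Q' where "Q' = Pb @ us @ [z]"
      have usPa: "set us \<inter> set Pa = {}" 
        using Int_singletonD[OF w(3)] d guz(1) z_def by (fastforce simp: gpath_def)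
      have Pav: "set Pa \<inter> set vs = {}" using Int_singletonD[OF w(3)] d gts(1) z_def by (fastforce simp: gpath_def)
      have gQ: "gpath E Q'" unfolding Q'_def gpath_append[of E Pb]
        using Pb guz hdz gts(2) Pbts d z_def by auto
      have zL: "z \<notin> L" "set us \<inter> L = {}" using dis(2) ts d z_def by auto
      have f': "fan L i Pa Q' z" unfolding fan_def
      proof (intro conjI)
        show "set Q' \<inter> L = {hd Q'}" using Pb zL Pbne by (auto simp: Q'_def)
        show "set Pa \<inter> set Q' = {z}" using w(6) usPa Pbne(2) by (auto simp: Q'_def z_def)
        show "hd Pa = i \<or> hd Q' = i" using w(8) Pbne by (simp add: Q'_def)
      qed (use w(1,7) gQ z_def zL Q'_def in auto)
      have gz: "gpath E (z # vs)" using gts(1) d z_def by (auto simp: gpath_append split: if_splits)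
      show ?thesis
      proof (rule less.hyps[OF _ f' gz])
        show "length (z # vs) < length ps" using ts d by simp
        show "last (z # vs) = j" using lts d z_def by simp
        show "set (z # vs) \<inter> (set Pa \<union> set Q') = {z}"
          using Pav guz(2) Pbts d Pbne(2) by (auto simp: Q'_def z_def)
        show "set (z # vs) \<inter> L = {}" using dis(2) ts d z_def by auto
        have "set Pa \<inter> R \<subseteq> {z}" using w(3) z_def by auto
        moreover have "set us \<inter> R \<subseteq> {j}" "set vs \<inter> R \<subseteq> {j}" "{z} \<inter> R \<subseteq> {j}" using dis(3) ts d z_def by auto
        ultimately show "(set Pa \<union> set Q' \<union> set (z # vs)) \<inter> R \<subseteq> {j}"
          using Pbts by (auto simp: Q'_def)
      qed simp
    next
      case lF: False
      then have zR: "last Pa \<in> R" using w(2) by blast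
      define Q' where "Q' = Pb @ ts"
      have gQ: "gpath E Q'" unfolding Q'_def gpath_append using Pb gts Pbts False by auto
      have "link L R i j Pa Q'" unfolding link_def
      proof (intro conjI)
        show "set Pa \<inter> set Q' = {}" using Int_singletonD[OF w(3)] w(6) lF by (fastforce simp: Q'_def)
        show "set Q' \<inter> L = {hd Q'}" using Pb T(3) Pbne by (auto simp: Q'_def)
        show "set Pa \<inter> R = {last Pa}" using w(3) zR by blast
        have "set ts \<inter> R = {j}" using dis(3) ts jt assms(4) by auto
        then show "set Q' \<inter> R = {last Q'}" using Pbts False lts by (auto simp: Q'_def)
        show "hd Pa = i \<or> hd Q' = i" using w(8) Pbne by (simp add: Q'_def)
        show "last Pa = j \<or> last Q' = j" using lts False by (simp add: Q'_def)
      qed (use w gQ in auto)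
      then show ?thesis by blast
    qed
  qed
qed

text \<open>This creates the first fan: a path from a second vertex of \<open>L\<close>, avoiding
  \<open>i\<close>, reaches the rest of \<open>ps\<close> and there meets the initial piece of
  \<open>ps\<close>; if it reaches \<open>R\<close> instead, it forms a link with
  \<open>ps\<close>.\<close>

lemma fan_or_link_path:
  assumes "L \<subseteq> A \<union> B" "i \<in> L" "L \<inter> R = {}" "j \<in> R" "j \<in> A \<union> B"
    and "q \<in> L" "q \<noteq> i" "gpath E ps" "hd ps = i" "last ps = j" "set ps \<inter> L = {i}" "set ps \<inter> R = {j}"
  shows "(\<exists>P' Q'. fan L i P' Q' j \<and> (set P' \<union> set Q') \<inter> R \<subseteq> {j}) \<or> (\<exists>P' Q'. link L R i j P' Q')"
proof -
  obtain ts where ts: "ps = i # ts" using assms(8,9) gpath_ne by (metis list.collapse)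
  have ij: "i \<noteq> j" using assms by auto
  then have tsne: "ts \<noteq> []" using assms ts by auto
  have gts: "gpath E ts" "E i (hd ts)" "i \<notin> set ts" using assms(8) ts tsne by (auto simp: gpath_Cons)
  have lts: "last ts = j" using assms(10) ts tsne by simp
  have jt: "j \<in> set ts" using tsne lts by auto
  have "q \<in> A \<union> B" using assms by auto
  have jT: "j \<in> set ts \<union> R" "j \<noteq> i" using jt ij by auto
  obtain W where W: "gpath E W" "hd W \<in> L" "last W \<in> set ts \<union> R" "set W \<inter> L = {hd W}"
    "set W \<inter> (set ts \<union> R) = {last W}" "i \<notin> set W"
    by (rule connect[OF assms(6,7) jT \<open>q \<in> A \<union> B\<close> assms(5)])
  have Wne: "W \<noteq> []" using W gpath_ne by auto
  show ?thesis
  proof (cases "last W \<in> set ts")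
    case True
    then obtain us vs where d: "ts = us @ last W # vs" using split_list by metis
    define z where "z = last W"
    have d': "ps = (i # us @ [z]) @ vs" using d z_def ts by simp
    define Q where "Q = i # us @ [z]"
    have dQ: "ps = Q @ vs" using d' Q_def by simp
    have gQ: "gpath E Q" "set Q \<inter> set vs = {}"
      using assms(8) unfolding dQ gpath_append by (auto simp: Q_def split: if_splits)
    have zL: "z \<notin> L" "set us \<inter> L = {}" using assms(11) ts d z_def gts(3) by auto
    have usW: "set us \<inter> set W = {}" using Int_singletonD[OF W(5)] d gQ z_def by (fastforce simp: gpath_def Q_def)
    have vsW: "set vs \<inter> set W = {}" using Int_singletonD[OF W(5)] d gts(1) z_def by (fastforce simp: gpath_def Q_def)
    have f: "fan L i Q W z" unfolding fan_def
    proof (intro conjI)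
      show "set Q \<inter> L = {hd Q}" using zL assms(2) by (auto simp: Q_def)
      show "set Q \<inter> set W = {z}" using usW W(6) Wne by (auto simp: Q_def z_def)
    qed (use gQ W zL in \<open>auto simp: Q_def z_def\<close>)
    have gz: "gpath E (z # vs)" using gts(1) d z_def by (auto simp: gpath_append split: if_splits)
    show ?thesis
    proof (rule fan_or_link[OF assms(1-5) f gz])
      show "last (z # vs) = j" using lts d z_def by simp
      show "set (z # vs) \<inter> (set Q \<union> set W) = {z}" using gQ(2) vsW Wne by (auto simp: Q_def z_def)
      show "set (z # vs) \<inter> L = {}" using assms(11) ts d z_def gts(3) by auto
      have "set W \<inter> R \<subseteq> {z}" using W(5) z_def by auto
      moreover have "set Q \<inter> R \<subseteq> {j}" "set vs \<inter> R \<subseteq> {j}" "{z} \<inter> R \<subseteq> {j}" using assms(12) dQ Q_def by auto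
      ultimately show "(set Q \<union> set W \<union> set (z # vs)) \<inter> R \<subseteq> {j}" by auto
    qed simp
  next
    case False
    then have zR: "last W \<in> R" using W(3) by blast
    have "link L R i j ps W" unfolding link_def
    proof (intro conjI)
      show "set ps \<inter> set W = {}" using Int_singletonD[OF W(5)] W(6) False ts by fastforce
      show "set W \<inter> R = {last W}" using W(5) zR by blast
    qed (use assms W in auto)
    then show ?thesis by blast
  qed
qed

text \<open>If the apex has arrived at \<open>j\<close>, one more augmentation with target
  \<open>R - {j}\<close> separates the two ends; the path that it leaves unchanged keeps the end
  \<open>j\<close>.\<close>

lemma link_exists:
  assumes "L \<subseteq> A \<union> B" "i \<in> L" "L \<inter> R = {}" "j \<in> R" "R \<subseteq> A \<union> B"
    and "q \<in> L" "q \<noteq> i" "gpath E ps" "hd ps = i" "last ps = j" "set ps \<inter> L = {i}" "set ps \<inter> R = {j}"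
    and "r \<in> R" "r \<noteq> j"
  obtains P Q where "link L R i j P Q"
proof -
  have jV: "j \<in> A \<union> B" using assms by auto
  consider P Q where "fan L i P Q j" "(set P \<union> set Q) \<inter> R \<subseteq> {j}" | P Q where "link L R i j P Q"
    using fan_or_link_path[OF assms(1-4) jV assms(6-12)] by blast
  then show ?thesis
  proof cases
    case (1 P Q)
    have T: "r \<in> R - {j}" "r \<in> A \<union> B" "j \<notin> R - {j}" "(R - {j}) \<inter> L = {}" "(R - {j}) \<inter> (set P \<union> set Q) = {}"
      using assms 1 by auto
    obtain Pa Pb where w: "gpath E Pa" "last Pa \<in> R - {j}" "set Pa \<inter> (R - {j}) = {last Pa}"
      "j \<notin> set Pa" "Pb = P \<or> Pb = Q" "set Pa \<inter> set Pb = {}" "set Pa \<inter> L = {hd Pa}" "hd Pa = i \<or> hd Pb = i"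
      by (rule fan_step[OF 1(1) assms(1,2) T])
    have Pb: "gpath E Pb" "last Pb = j" "set Pb \<inter> L = {hd Pb}" "set Pb \<inter> R \<subseteq> {j}" "j \<in> set Pb"
      using 1 w(5) unfolding fan_def by auto
    have "link L R i j Pa Pb" unfolding link_def using w Pb assms(4) by auto
    then show ?thesis using that by blast
  qed (use that in blast)
qed

text \<open>The case \<open>R = {x}\<close>, where a link is impossible because disjoint paths
  cannot both end in \<open>x\<close>. The \<open>i\<close> obtained is found in the proof and may
  differ from the \<open>i\<close> of the assumptions.\<close>

lemma fan_exists:
  assumes "L \<subseteq> A \<union> B" "i \<in> L" "q \<in> L" "q \<noteq> i" "x \<in> A \<union> B" "x \<notin> L"
  obtains i P Q where "fan L i P Q x"
proof -
  obtain W where W: "gpath E W" "hd W \<in> L" "last W \<in> {x}" "set W \<inter> L = {hd W}" "set W \<inter> {x} = {last W}"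
  proof -
    have "q \<noteq> x" "i \<noteq> x" using assms by auto
    then show ?thesis using connect[of i L q x "{x}"] assms that by (metis Un_iff insertI1 subset_eq)
  qed
  obtain q' where "q' \<in> L" "q' \<noteq> hd W" using assms by metis
  then have "(\<exists>P' Q'. fan L (hd W) P' Q' x) \<or> (\<exists>P' Q'. link L {x} (hd W) x P' Q')"
    using fan_or_link_path[of L "hd W" "{x}" x q' W] W assms by auto
  then show ?thesis
  proof
    assume "\<exists>P' Q'. link L {x} (hd W) x P' Q'"
    then show ?thesis unfolding link_def by (metis Int_iff disjoint_iff empty_iff insert_iff)
  qed (use that in blast)
qed

end

section \<open>Joining and closing paths, and segments of a path given by indices\<close>

lemma gpath_join:
  assumes "gpath E xs" "gpath E ys" "last xs = hd ys" "set xs \<inter> set ys = {hd ys}"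
  shows "gpath E (xs @ tl ys) \<and> hd (xs @ tl ys) = hd xs \<and> last (xs @ tl ys) = last ys
    \<and> set (xs @ tl ys) = set xs \<union> set ys"
proof -
  obtain y zs where ys: "ys = y # zs" using assms(2) gpath_ne by (metis list.exhaust)
  have ne: "xs \<noteq> []" using assms(1) gpath_ne by auto
  have yx: "y \<in> set xs" using assms(3) ys ne by auto
  show ?thesis
  proof (cases "zs = []")
    case True
    then show ?thesis using assms ys yx ne by auto
  next
    case False
    then have "gpath E zs" "E y (hd zs)" "y \<notin> set zs" using assms(2) ys by (auto simp: gpath_Cons)
    then show ?thesis using assms ys ne False yx by (auto simp: gpath_append)
  qed
qed

text \<open>The repeated ends are dropped from \<open>ys\<close>. Three vertices are required to
  exclude one edge traversed twice.\<close>

lemma gcycle_close: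
  assumes "gpath E xs" "gpath E ys" "hd xs = last ys" "last xs = hd ys" "hd xs \<noteq> last xs"
    "set xs \<inter> set ys = {hd xs, last xs}" "3 \<le> card (set xs \<union> set ys)"
  shows "\<exists>c. gcycle E c \<and> set c = set xs \<union> set ys"
proof -
  obtain y zs where ys: "ys = y # zs" using assms(2) gpath_ne by (metis list.exhaust)
  have ne: "xs \<noteq> []" using assms(1) gpath_ne by auto
  have zs: "zs \<noteq> []" using assms ys by auto
  then obtain ws z where zs': "zs = ws @ [z]" by (metis append_butlast_last_id)
  have z: "z = hd xs" using assms ys zs' by auto
  have y: "y = last xs" using assms ys by auto
  have dy: "distinct ys" using assms(2) by (simp add: gpath_def)
  have wsx: "set xs \<inter> set ws = {}"
  proof -
    have "w = y \<or> w = z" if "w \<in> set xs" "w \<in> set ws" for w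
      using that assms(6) ys zs' y z by (metis IntI Un_iff insertE list.set_intros(2) set_append singletonD)
    moreover have "y \<notin> set ws" "z \<notin> set ws" using dy ys zs' by auto
    ultimately show ?thesis by blast
  qed
  have un: "set xs \<union> set ys = set (xs @ ws)" using ys zs' y z ne by auto
  have gz: "gpath E (ws @ [z])" "E y (hd (ws @ [z]))" using assms(2) ys zs' by (auto simp: gpath_Cons)
  have gx: "gpath E (xs @ ws)"
    using assms(1) gz wsx y by (auto simp: gpath_append split: if_splits)
  have "E (last (xs @ ws)) (hd (xs @ ws))"
    using gz y z ne by (cases "ws = []") (auto simp: gpath_append)
  moreover have "3 \<le> length (xs @ ws)" using assms(7) un card_length[of "xs @ ws"] by simp
  ultimately have "gcycle E (xs @ ws)" using gx by (simp add: gcycle_iff_gpath)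
  then show ?thesis using un by metis
qed

text \<open>With indices the vertex set is the image of an interval, so disjointness and coverage
  become facts about numbers.\<close>

definition seg :: "'a list \<Rightarrow> nat \<Rightarrow> nat \<Rightarrow> 'a list" where
  "seg p i j = map ((!) p) [i..<j]"

lemma set_seg: "set (seg p i j) = (!) p ` {i..<j}"
  by (simp add: seg_def)

lemma hd_seg: "i < j \<Longrightarrow> hd (seg p i j) = p ! i"
  by (simp add: seg_def hd_map)

lemma last_seg: "i < j \<Longrightarrow> last (seg p i j) = p ! (j - 1)"
  by (simp add: seg_def last_map)

lemma gpath_seg:
  assumes "gpath E p" "i < j" "j \<le> length p"
  shows "gpath E (seg p i j)"
proof -
  have "seg p i j = drop i (take j p)"
    using assms by (intro nth_equalityI) (auto simp: seg_def)
  moreover have g: "gpath E (take j p)"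
    using assms gpath_append[of E "take j p" "drop j p"] by (auto split: if_splits)
  then have "gpath E (drop i (take j p))"
    using assms gpath_append[of E "take i (take j p)" "drop i (take j p)"]
    by (auto simp del: take_take split: if_splits)
  ultimately show ?thesis by simp
qed

lemma seg_disjoint:
  assumes "distinct p" "{i..<j} \<inter> {i'..<j'} = {}" "j \<le> length p" "j' \<le> length p"
  shows "set (seg p i j) \<inter> set (seg p i' j') = {}"
proof -
  have "inj_on ((!) p) {..<length p}" using assms(1) by (simp add: inj_on_nth)
  then show ?thesis unfolding set_seg using assms
    by (subst inj_on_image_Int[of "(!) p" "{..<length p}", symmetric]) auto
qed

lemma (in bip_graph) nth_parity:
  assumes "gpath E p" "hd p \<in> A" "k < length p"
  shows "p ! k \<in> A \<longleftrightarrow> even k" "p ! k \<in> B \<longleftrightarrow> odd k"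
proof -
  have "(p ! k \<in> A \<longleftrightarrow> even k) \<and> (p ! k \<in> B \<longleftrightarrow> odd k)" using assms(3)
  proof (induction k)
    case 0
    then show ?case using assms disj hd_conv_nth[OF gpath_ne[OF assms(1)]] by auto
  next
    case (Suc k)
    have "E (p ! k) (p ! Suc k)" using assms(1) Suc.prems
      by (simp add: gpath_def successively_conv_nth)
    then show ?case using Suc bip disj by (auto dest: bip)
  qed
  then show "p ! k \<in> A \<longleftrightarrow> even k" "p ! k \<in> B \<longleftrightarrow> odd k" by auto
qed

section \<open>Closing a long path whose ends have large degree sum\<close>

text \<open>The assumptions do not compare the two classes, so every result can be reused with
  \<open>A\<close> and \<open>B\<close> exchanged, by \<open>swapped\<close>.\<close>

locale no_long = two_conn_bip +
  fixes l :: nat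
  assumes l4: "4 \<le> l" and cardA: "l \<le> card A" and cardB: "l \<le> card B"
    and nolong: "gcycle E c \<Longrightarrow> length c < 2 * l"
begin

lemma swapped: "no_long B A E l"
proof -
  interpret s: bip_graph B A E by (rule swapped_bip)
  show ?thesis
  proof
    show "\<exists>xs. gpath E xs \<and> hd xs = x \<and> last xs = y \<and> v \<notin> set xs"
      if "x \<in> B \<union> A" "y \<in> B \<union> A" "x \<noteq> v" "y \<noteq> v" for x y v
      using conn that by (simp add: Un_commute)
  qed (use l4 cardA cardB nolong in auto)
qed

text \<open>A cycle has equally many vertices in both classes, so it is too long as soon as
  \<open>l\<close> of them in one class are exhibited.\<close>

lemma no_cycle_B:
  assumes "gcycle E c" "X \<subseteq> set c \<inter> B" "l \<le> card X" shows False
proof -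
  have "card X \<le> card (set c \<inter> B)" using assms by (intro card_mono) auto
  then show False using gcycle_count[OF assms(1)] nolong[OF assms(1)] assms(3) by simp
qed

lemma no_theta_B:
  assumes "gpath E xs" "gpath E ys" "hd xs = last ys" "last xs = hd ys" "hd xs \<noteq> last xs"
    "set xs \<inter> set ys = {hd xs, last xs}" "X \<subseteq> (set xs \<union> set ys) \<inter> B" "l \<le> card X"
  shows False
proof -
  have "card X \<le> card (set xs \<union> set ys)" using assms(7) by (intro card_mono) auto
  then have "3 \<le> card (set xs \<union> set ys)" using assms(8) l4 by simp
  then obtain c where "gcycle E c" "set c = set xs \<union> set ys"
    using gcycle_close[OF assms(1-6)] by blast
  then show False using no_cycle_B assms(7,8) by metis
qed

text \<open>If the last neighbour of \<open>hd p\<close> comes after the first neighbour of \<open>last p\<close>, a closest such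
  crossing pair of chords closes \<open>p\<close> up.  Otherwise two disjoint paths link the initial part of \<open>p\<close> to
  its final part.  In both cases the cycle contains all neighbours of \<open>hd p\<close> and the successors
  of all but one of the neighbours of \<open>last p\<close>.\<close>

lemma path_ends_degree:
  assumes p: "gpath E p" "hd p \<in> A" "last p \<in> B" "2 * l \<le> length p"
    and deg: "l + 1 \<le> card {v \<in> set p. E (hd p) v} + card {v \<in> set p. E (last p) v}"
  shows False
proof -
  define n where "n = length p - 1"
  have len: "length p = Suc n" using p(4) l4 n_def by auto
  have pne: "p \<noteq> []" using len by auto
  have dp: "distinct p" using p by (simp add: gpath_def)
  have hp: "hd p = p ! 0" "last p = p ! n"
    using len pne by (auto simp: hd_conv_nth last_conv_nth)
  note par = nth_parity[OF p(1,2), unfolded len]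
  have inj: "inj_on ((!) p) {..n}" using dp len by (auto simp: inj_on_nth)
  have nodd: "odd n" using par(2)[of n] p(3) hp by auto
  define I where "I = {i. i \<le> n \<and> E (p ! 0) (p ! i)}"
  define J where "J = {j. j \<le> n \<and> E (p ! n) (p ! j)}"
  have fin: "finite I" "finite J" unfolding I_def J_def by auto
  have "{v \<in> set p. E (p ! 0) v} = (!) p ` I" unfolding I_def by (auto simp: set_conv_nth len less_Suc_eq_le)
  then have cI: "card {v \<in> set p. E (hd p) v} = card I" unfolding hp
    by (metis (no_types, lifting) I_def card_image inj inj_on_subset mem_Collect_eq atMost_iff subsetI)
  have "{v \<in> set p. E (p ! n) v} = (!) p ` J" unfolding J_def by (auto simp: set_conv_nth len less_Suc_eq_le)
  then have cJ: "card {v \<in> set p. E (last p) v} = card J" unfolding hp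
    by (metis (no_types, lifting) J_def card_image inj inj_on_subset mem_Collect_eq atMost_iff subsetI)
  have sum: "l + 1 \<le> card I + card J" using deg cI cJ by simp
  have Iodd: "odd i \<and> i \<le> n" if "i \<in> I" for i
    using that adj_A[of "p ! 0" "p ! i"] p(2) hp par(2)[of i] unfolding I_def by auto
  have Jeven: "even j \<and> j < n" if "j \<in> J" for j
  proof -
    have "j \<le> n" "even j" using that adj_B[of "p ! n" "p ! j"] p(3) hp par(1)[of j] unfolding J_def by auto
    then show ?thesis using nodd le_neq_implies_less by metis
  qed
  have n0: "0 < n" using nodd odd_pos by auto
  have step: "E (p ! k) (p ! Suc k)" if "k < n" for k
    using p(1) that len by (simp add: gpath_def successively_conv_nth)
  have "1 \<in> I" unfolding I_def using step[of 0] n0 by auto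
  have "n - 1 \<in> J" unfolding J_def using sym[OF step[of "n - 1"]] n0 by auto
  \<comment> \<open>Crossing chords: follow \<open>p\<close> from its start to position
    \<open>j\<close>, jump to its end, return to position \<open>i\<close>, jump to the
    start.\<close>
  have cyc: "gcycle E (seg p 0 (Suc j) @ rev (seg p i (Suc n)))"
    if "j < i" "j \<in> J" "i \<in> I" for i j
  proof (rule gcycle_append)
    have "j < n" "i \<le> n" using that Iodd Jeven by auto
    show "gpath E (seg p 0 (Suc j))" by (rule gpath_seg[OF p(1)]) (use \<open>j < n\<close> len in auto)
    show "gpath E (rev (seg p i (Suc n)))" by (rule grev, rule gpath_seg[OF p(1)]) (use \<open>i \<le> n\<close> len in auto)
    show "set (seg p 0 (Suc j)) \<inter> set (rev (seg p i (Suc n))) = {}"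
      unfolding set_rev by (rule seg_disjoint[OF dp]) (use that \<open>j < n\<close> len in auto)
    show "E (last (seg p 0 (Suc j))) (hd (rev (seg p i (Suc n))))"
      using that \<open>i \<le> n\<close> sym unfolding J_def by (simp add: hd_rev last_seg)
    show "E (last (rev (seg p i (Suc n)))) (hd (seg p 0 (Suc j)))"
      using that \<open>i \<le> n\<close> sym unfolding I_def by (simp add: last_rev hd_seg)
    \<comment> \<open>Otherwise the list has only two entries, but then the ends of \<open>p\<close>
      are adjacent and \<open>p\<close> itself is a long cycle.\<close>
    have "i \<noteq> n \<or> j \<noteq> 0"
    proof (rule ccontr)
      assume "\<not> (i \<noteq> n \<or> j \<noteq> 0)"
      then have "E (p ! n) (p ! 0)" using \<open>j \<in> J\<close> unfolding J_def by auto
      then have "gcycle E p" using p pne hp l4 by (simp add: gcycle_iff_gpath)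
      then show False using nolong[of p] p(4) by simp
    qed
    then show "3 \<le> length (seg p 0 (Suc j)) + length (rev (seg p i (Suc n)))"
      using \<open>i \<le> n\<close> unfolding seg_def by auto
  qed
  \<comment> \<open>Crossing chords at consecutive vertices would give a cycle through all of
    \<open>p\<close>. Hence neighbours of the start and successors of neighbours of the end are
    distinct.\<close>
  have nocons: "Suc j \<notin> I" if "j \<in> J" for j
  proof
    assume "Suc j \<in> I"
    then have "gcycle E (seg p 0 (Suc j) @ rev (seg p (Suc j) (Suc n)))" using cyc that by auto
    moreover have "length (seg p 0 (Suc j) @ rev (seg p (Suc j) (Suc n))) = Suc n"
      using Jeven[OF that] by (simp add: seg_def)
    ultimately show False using nolong p(4) len by force
  qed
  \<comment> \<open>Giving up one successor leaves \<open>l\<close> of the \<open>l + 1\<close>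
    vertices; their indices are odd, so they lie in \<open>B\<close>.\<close>
  have count: "l \<le> card ((!) p ` (I \<union> Suc ` (J - {j})))" "(!) p ` (I \<union> Suc ` (J - {j})) \<subseteq> B" if "j \<in> J" for j
  proof -
    have "card (I \<union> Suc ` (J - {j})) = card I + card (Suc ` (J - {j}))"
      using fin nocons by (intro card_Un_disjoint) auto
    also have "card (Suc ` (J - {j})) = card J - 1" using that fin by (simp add: card_image)
    finally have 1: "l \<le> card (I \<union> Suc ` (J - {j}))" using sum by simp
    have sub: "I \<union> Suc ` (J - {j}) \<subseteq> {..n}" using Iodd Jeven by (auto simp: Suc_le_eq)
    show "l \<le> card ((!) p ` (I \<union> Suc ` (J - {j})))"
      using 1 card_image[OF inj_on_subset[OF inj sub]] by simp
    show "(!) p ` (I \<union> Suc ` (J - {j})) \<subseteq> B"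
    proof -
      have "odd k \<and> k \<le> n" if "k \<in> I \<union> Suc ` (J - {j})" for k using that Iodd Jeven by (auto simp: Suc_le_eq)
      then show ?thesis using par(2) by (auto simp: less_Suc_eq_le)
    qed
  qed
  show False
  proof (cases "\<exists>j\<in>J. \<exists>i\<in>I. j < i")
    case True
    define P where "P = (\<lambda>(j, i). j \<in> J \<and> i \<in> I \<and> j < i)"
    have "\<exists>x. P x" using True P_def by auto
    \<comment> \<open>With the smallest gap, no index of \<open>I\<close> or \<open>J\<close> lies
      strictly between \<open>j\<close> and \<open>i\<close>, so the cycle can lose only the
      successor of \<open>j\<close>.\<close>
    then obtain x where x: "P x" "\<And>x'. P x' \<Longrightarrow> snd x - fst x \<le> snd x' - fst x'"
      using ex_has_least_nat[of P _ "\<lambda>x. snd x - fst x"] by metis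
    obtain j i where xji: "x = (j, i)" by force
    have ji: "j \<in> J" "i \<in> I" "j < i" using x(1) xji P_def by auto
    have min: "i - j \<le> i' - j'" if "j' \<in> J" "i' \<in> I" "j' < i'" for i' j'
      using x(2)[of "(j', i')"] that xji P_def by auto
    have Iout: "k \<le> j \<or> i \<le> k" if "k \<in> I" for k
      using min[OF ji(1) that] ji that by linarith
    have Jout: "k \<le> j \<or> i \<le> k" if "k \<in> J" for k
      using min[OF that ji(2)] ji that by linarith
    let ?c = "seg p 0 (Suc j) @ rev (seg p i (Suc n))"
    have "(!) p ` (I \<union> Suc ` (J - {j})) \<subseteq> set ?c"
    proof -
      have "k < Suc j \<or> i \<le> k \<and> k < Suc n" if "k \<in> I \<union> Suc ` (J - {j})" for k
        using that Iout Jout Iodd Jeven by (fastforce simp: less_Suc_eq_le)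
      then show ?thesis unfolding set_append set_rev set_seg by fastforce
    qed
    then show False using no_cycle_B[OF cyc[OF ji(3,1,2)], of "(!) p ` (I \<union> Suc ` (J - {j}))"] count[OF ji(1)] by blast
  next
    case False
    \<comment> \<open>Now \<open>I\<close> lies before \<open>J\<close>, equality being excluded by
      parity. The parts of \<open>p\<close> up to \<open>i\<close> and from \<open>j\<close> on are
      to be linked.\<close>
    define i where "i = Max I"
    define j where "j = Min J"
    have ne: "I \<noteq> {}" "J \<noteq> {}" using \<open>1 \<in> I\<close> \<open>n - 1 \<in> J\<close> by auto
    have i: "i \<in> I" "\<And>k. k \<in> I \<Longrightarrow> k \<le> i" using ne fin by (auto simp: i_def)
    have j: "j \<in> J" "\<And>k. k \<in> J \<Longrightarrow> j \<le> k" using ne fin by (auto simp: j_def)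
    have ij: "i < j" using False i(1) j(1) Iodd[of i] Jeven[of j] by (metis linorder_less_linear)
    have jn: "j < n" "0 < i" using Jeven[OF j(1)] Iodd[OF i(1)] odd_pos by auto
    define L where "L = set (seg p 0 (Suc i))"
    define R where "R = set (seg p j (Suc n))"
    have sub: "set p \<subseteq> A \<union> B" using gpath_sub[OF p(1)] p(2) by auto
    have pk: "p ! k \<in> A \<union> B" if "k < Suc n" for k
      using sub len that by (metis nth_mem subsetD)
    have LRsub: "L \<subseteq> A \<union> B" "R \<subseteq> A \<union> B"
      unfolding L_def R_def set_seg by (intro image_subsetI pk; use jn ij in simp)+
    have pinj: "p ! k = p ! k' \<longleftrightarrow> k = k'" if "k \<le> n" "k' \<le> n" for k k'
      using inj that by (auto simp: inj_on_def)
    have LI: "p ! k \<in> L \<longleftrightarrow> k \<le> i" "p ! k \<in> R \<longleftrightarrow> j \<le> k" if "k \<le> n" for k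
      unfolding L_def R_def set_seg using that pinj jn ij by (auto simp: image_iff less_Suc_eq_le)
    obtain P Q where lk: "link L R (p ! i) (p ! j) P Q"
    proof (rule link_exists[OF LRsub(1) _ _ _ LRsub(2), of "p ! i" "p ! j" "p ! 0" "seg p i (Suc j)" "p ! n"])
      show "gpath E (seg p i (Suc j))" by (rule gpath_seg[OF p(1)]) (use ij jn len in auto)
      show "hd (seg p i (Suc j)) = p ! i" "last (seg p i (Suc j)) = p ! j" using ij by (auto simp: hd_seg last_seg)
      show "set (seg p i (Suc j)) \<inter> L = {p ! i}" using LI(1) ij jn unfolding set_seg by (auto simp: less_Suc_eq_le)
      show "set (seg p i (Suc j)) \<inter> R = {p ! j}" using LI(2) ij jn unfolding set_seg by (auto simp: less_Suc_eq_le)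
      show "L \<inter> R = {}" unfolding L_def R_def by (rule seg_disjoint[OF dp]) (use ij jn len in auto)
    qed (use LI ij jn pinj in auto)
    have main: False if lk: "link L R (p ! i) (p ! j) P Q" and hP: "hd P = p ! i" for P Q
    proof -
      have PQ: "gpath E P" "gpath E Q" "set P \<inter> set Q = {}" "set P \<inter> L = {hd P}" "set Q \<inter> L = {hd Q}"
        "set P \<inter> R = {last P}" "set Q \<inter> R = {last Q}" "last P = p ! j \<or> last Q = p ! j"
        using lk unfolding link_def by auto
      have PQne: "P \<noteq> []" "Q \<noteq> []" using PQ gpath_ne by auto
      have "hd Q \<in> L" using PQ by auto
      then obtain s where s: "hd Q = p ! s" "s \<le> i" unfolding L_def set_seg by auto
      have "hd Q \<noteq> hd P" using PQ(3) PQne by (metis disjoint_iff list.set_sel(1))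
      then have si: "s < i" using s hP by (metis le_neq_implies_less)
      \<comment> \<open>Left half: from \<open>s\<close> back to the start of \<open>p\<close>, over
        the chord to the next neighbour \<open>i'\<close> after \<open>s\<close>, then on to
        \<open>i\<close>. No element of \<open>I\<close> is skipped.\<close>
      obtain lft where lft: "gpath E lft" "hd lft = p ! s" "last lft = p ! i" "set lft \<subseteq> L" "(!) p ` I \<subseteq> set lft"
      proof -
        define i' where "i' = Min {k \<in> I. s < k}"
        have "{k \<in> I. s < k} \<noteq> {}" using i(1) si by auto
        then have i': "i' \<in> I" "s < i'" "\<And>k. k \<in> I \<Longrightarrow> s < k \<Longrightarrow> i' \<le> k"
          using Min_in[of "{k \<in> I. s < k}"] fin by (auto simp: i'_def)
        have "i' \<le> i" "i \<le> n" using i i'(1) ij jn by auto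
        let ?x = "rev (seg p 0 (Suc s)) @ seg p i' (Suc i)"
        have "gpath E (rev (seg p 0 (Suc s)))" by (rule grev, rule gpath_seg[OF p(1)]) (use si \<open>i \<le> n\<close> len in auto)
        moreover have "gpath E (seg p i' (Suc i))" by (rule gpath_seg[OF p(1)]) (use \<open>i' \<le> i\<close> \<open>i \<le> n\<close> len in auto)
        moreover have "set (rev (seg p 0 (Suc s))) \<inter> set (seg p i' (Suc i)) = {}"
          unfolding set_rev by (rule seg_disjoint[OF dp]) (use si i' \<open>i \<le> n\<close> len in auto)
        moreover have "E (last (rev (seg p 0 (Suc s)))) (hd (seg p i' (Suc i)))"
          using i'(1) \<open>i' \<le> i\<close> unfolding I_def by (simp add: last_rev hd_seg)
        ultimately have "gpath E ?x" by (auto simp: gpath_append)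
        moreover have "hd ?x = p ! s" "last ?x = p ! i" using \<open>i' \<le> i\<close>
          by (auto simp: hd_append hd_rev last_seg seg_def)
        moreover have "set ?x \<subseteq> L" using si \<open>i' \<le> i\<close> unfolding L_def set_append set_rev set_seg by fastforce
        moreover have "(!) p ` I \<subseteq> set ?x"
        proof -
          have "k < Suc s \<or> i' \<le> k \<and> k < Suc i" if "k \<in> I" for k
            using i(2)[OF that] i'(3)[OF that] by linarith
          then show ?thesis unfolding set_append set_rev set_seg by fastforce
        qed
        ultimately show ?thesis using that by blast
      qed
      have "hd P \<noteq> hd Q" using \<open>hd Q \<noteq> hd P\<close> by simp
      have lne: "last P \<noteq> last Q" using PQ(3) PQne by (metis disjoint_iff last_in_set)
      have lR: "last P \<in> R" "last Q \<in> R" using PQ by auto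
      obtain t where t: "{last P, last Q} = {p ! j, p ! t}" "j < t" "t \<le> n"
      proof -
        obtain w where w: "{last P, last Q} = {p ! j, w}" "w \<in> R" "w \<noteq> p ! j" using PQ(8) lR lne by (metis insert_commute)
        then obtain t where "w = p ! t" "j \<le> t" "t \<le> n" unfolding R_def set_seg by auto
        then show ?thesis using that w by (metis le_neq_implies_less)
      qed
      \<comment> \<open>Right half: from \<open>j\<close> to the last neighbour \<open>j'\<close> of
        the end before \<open>t\<close>, over the chord to the end, then back to \<open>t\<close>.
        Only the successor of \<open>j'\<close> can be skipped.\<close>
      obtain rgt j' where rgt: "gpath E rgt" "hd rgt = p ! j" "last rgt = p ! t" "set rgt \<subseteq> R"
        "(!) p ` Suc ` (J - {j'}) \<subseteq> set rgt" "j' \<in> J"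
      proof -
        define j' where "j' = Max {k \<in> J. k < t}"
        have "{k \<in> J. k < t} \<noteq> {}" using j(1) t by auto
        then have j': "j' \<in> J" "j' < t" "\<And>k. k \<in> J \<Longrightarrow> k < t \<Longrightarrow> k \<le> j'"
          using Max_in[of "{k \<in> J. k < t}"] fin by (auto simp: j'_def)
        have "j \<le> j'" using j j'(1) by auto
        let ?x = "seg p j (Suc j') @ rev (seg p t (Suc n))"
        have "gpath E (seg p j (Suc j'))" by (rule gpath_seg[OF p(1)]) (use j' t \<open>j \<le> j'\<close> len in auto)
        moreover have "gpath E (rev (seg p t (Suc n)))" by (rule grev, rule gpath_seg[OF p(1)]) (use t len in auto)
        moreover have "set (seg p j (Suc j')) \<inter> set (rev (seg p t (Suc n))) = {}"
          unfolding set_rev by (rule seg_disjoint[OF dp]) (use t j' len in auto)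
        moreover have "E (last (seg p j (Suc j'))) (hd (rev (seg p t (Suc n))))"
          using j'(1) \<open>j \<le> j'\<close> t sym unfolding J_def by (simp add: hd_rev last_seg)
        ultimately have "gpath E ?x" by (auto simp: gpath_append)
        moreover have "hd ?x = p ! j" "last ?x = p ! t" using \<open>j \<le> j'\<close> t
          by (auto simp: last_append last_rev hd_map seg_def hd_append)
        moreover have "set ?x \<subseteq> R" using t j' \<open>j \<le> j'\<close> unfolding R_def set_append set_rev set_seg by fastforce
        moreover have "(!) p ` Suc ` (J - {j'}) \<subseteq> set ?x"
        proof -
          have "(j \<le> Suc k \<and> Suc k < Suc j') \<or> (t \<le> Suc k \<and> Suc k < Suc n)" if "k \<in> J - {j'}" for k
            using j(2)[of k] j'(3)[of k] Jeven[of k] that by fastforce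
          then show ?thesis unfolding set_append set_rev set_seg by fastforce
        qed
        ultimately show ?thesis using that j' by blast
      qed
      \<comment> \<open>Either of \<open>P\<close> and \<open>Q\<close> may be the one ending in
        \<open>p ! j\<close>, so the right half may have to be reversed.\<close>
      obtain rgt' where rgt': "gpath E rgt'" "hd rgt' = last P" "last rgt' = last Q" "set rgt' = set rgt"
      proof (cases "last P = p ! j")
        case True
        then have "last Q = p ! t" using t(1) lne by (metis doubleton_eq_iff)
        then show ?thesis using that[of rgt] True rgt by simp
      next
        case False
        then have "last P = p ! t" "last Q = p ! j" using t(1) lne by (metis doubleton_eq_iff)+
        then show ?thesis using that[of "rev rgt"] rgt grev gpath_ne[OF rgt(1)] by (simp add: hd_rev last_rev)
      qed
      have LR: "L \<inter> R = {}" unfolding L_def R_def by (rule seg_disjoint[OF dp]) (use ij jn len in auto)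
      have "set lft \<inter> set P = {hd P}"
        using PQ(4) lft(3,4) hP gpath_ne[OF lft(1)] PQne by auto (metis last_in_set)
      then have j1: "gpath E (lft @ tl P) \<and> hd (lft @ tl P) = hd lft \<and> last (lft @ tl P) = last P
          \<and> set (lft @ tl P) = set lft \<union> set P"
        using gpath_join[OF lft(1) PQ(1)] lft hP by auto
      have "set (lft @ tl P) \<inter> set rgt' = {hd rgt'}"
      proof -
        have "last P \<in> set rgt'" using rgt' gpath_ne[OF rgt'(1)] by (metis list.set_sel(1))
        moreover have "set rgt' \<subseteq> R" using rgt rgt' by auto
        ultimately have "set P \<inter> set rgt' = {last P}" using PQ(6) PQne by auto
        moreover have "set lft \<inter> set rgt' = {}" using lft(4) rgt(4) rgt'(4) LR by auto
        ultimately show ?thesis using j1 rgt'(2) by auto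
      qed
      define xs where "xs = (lft @ tl P) @ tl rgt'"
      have xs: "gpath E xs" "hd xs = hd Q" "last xs = last Q" "set xs = set lft \<union> set P \<union> set rgt'"
        using gpath_join[of E "lft @ tl P" rgt'] j1 \<open>set (lft @ tl P) \<inter> set rgt' = {hd rgt'}\<close> rgt' lft s
        unfolding xs_def by auto
      show False
      proof (rule no_theta_B[OF xs(1) grev[OF PQ(2)]])
        show "hd xs = last (rev Q)" "last xs = hd (rev Q)" using xs PQne by (auto simp: hd_rev last_rev)
        have hQ: "hd Q \<in> set Q" "last Q \<in> set Q" using PQne by auto
        show "hd xs \<noteq> last xs" using xs(2,3) \<open>hd Q \<in> L\<close> lR LR by auto
        have "set xs \<inter> set Q \<subseteq> {hd Q, last Q}"
          using xs(4) PQ(3,5,7) lft(4) rgt(4) rgt'(4) by blast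
        moreover have "hd xs \<in> set xs" "last xs \<in> set xs" using gpath_ne[OF xs(1)] by auto
        ultimately show "set xs \<inter> set (rev Q) = {hd xs, last xs}" using xs(2,3) hQ by auto
        have "(!) p ` (I \<union> Suc ` (J - {j'})) \<subseteq> set xs" using xs(4) lft(5) rgt(5) rgt'(4) unfolding image_Un by blast
        then show "(!) p ` (I \<union> Suc ` (J - {j'})) \<subseteq> (set xs \<union> set (rev Q)) \<inter> B" using count(2)[OF rgt(6)] by auto
        show "l \<le> card ((!) p ` (I \<union> Suc ` (J - {j'})))" by (rule count(1)[OF rgt(6)])
      qed
    qed
    have "link L R (p ! i) (p ! j) Q P" using lk unfolding link_def by auto
    moreover have "hd P = p ! i \<or> hd Q = p ! i" using lk unfolding link_def by auto
    ultimately show False using main lk by blast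
  qed
qed

end

section \<open>Matchings and degree sums\<close>

lemma gcycle_rotate: "gcycle E (us @ vs) \<Longrightarrow> gcycle E (vs @ us)"
  by (cases "us = []"; cases "vs = []") (auto simp: gcycle_iff_gpath gpath_append)

text \<open>Induction of Halmos and Vaughan: a tight nonempty proper subset is matched separately
  from the rest; if none is tight, the surplus allows any edge to be taken away.\<close>

lemma hall:
  fixes E :: "'a \<Rightarrow> 'b \<Rightarrow> bool"
  assumes "finite S" "finite Y" "\<And>X. X \<subseteq> S \<Longrightarrow> card X \<le> card {y \<in> Y. \<exists>x\<in>X. E x y}"
  shows "\<exists>f. inj_on f S \<and> (\<forall>x\<in>S. f x \<in> Y \<and> E x (f x))"
  using assms
proof (induction "card S" arbitrary: S Y rule: less_induct)
  case less
  let ?N = "\<lambda>Y X. {y \<in> Y. \<exists>x\<in>X. E x y}"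
  note fin = less.prems(1,2) and H = less.prems(3)
  show ?case
  proof (cases "S = {}")
    case False
    then obtain x where x: "x \<in> S" by blast
    show ?thesis
    proof (cases "\<exists>X. X \<subset> S \<and> X \<noteq> {} \<and> card (?N Y X) \<le> card X")
      case True
      then obtain X where X: "X \<subset> S" "X \<noteq> {}" "card (?N Y X) \<le> card X" by blast
      have finX: "finite X" using X fin finite_subset by blast
      have c1: "card X < card S" using X fin by (simp add: psubset_card_mono)
      obtain f where f: "inj_on f X" "\<forall>x\<in>X. f x \<in> Y \<and> E x (f x)"
        using less.hyps[OF c1 finX fin(2)] H X by (metis (no_types, lifting) psubsetE subset_trans)
      have c2: "card (S - X) < card S" using X fin by (intro psubset_card_mono) auto
      have "card Z \<le> card (?N (Y - ?N Y X) Z)" if "Z \<subseteq> S - X" for Z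
      proof -
        have finZ: "finite Z" using that fin finite_subset by blast
        have "card X + card Z = card (X \<union> Z)" using that finX finZ by (subst card_Un_disjoint) auto
        also have "\<dots> \<le> card (?N Y (X \<union> Z))" using H X that by (intro H) auto
        also have "?N Y (X \<union> Z) = ?N Y X \<union> ?N (Y - ?N Y X) Z" by auto
        also have "card \<dots> \<le> card (?N Y X) + card (?N (Y - ?N Y X) Z)" by (rule card_Un_le)
        finally show ?thesis using X(3) by simp
      qed
      then obtain g where g: "inj_on g (S - X)" "\<forall>x\<in>S - X. g x \<in> Y - ?N Y X \<and> E x (g x)"
        using less.hyps[OF c2, of "Y - ?N Y X"] fin by auto
      define h where "h = (\<lambda>x. if x \<in> X then f x else g x)"
      have fN: "f x \<in> ?N Y X" if "x \<in> X" for x using that f(2) by auto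
      have "inj_on h S"
      proof (rule inj_onI)
        fix u v assume uv: "u \<in> S" "v \<in> S" "h u = h v"
        show "u = v"
        proof (cases "u \<in> X"; cases "v \<in> X")
          assume "u \<in> X" "v \<in> X" then show ?thesis using uv f(1) by (auto simp: h_def inj_on_def)
        next
          assume "u \<notin> X" "v \<notin> X" then show ?thesis using uv g(1) by (auto simp: h_def inj_on_def)
        next
          assume "u \<in> X" "v \<notin> X"
          then have "h u \<in> ?N Y X" "h v = g v" "g v \<in> Y - ?N Y X" using uv(1,2) g(2) fN[of u] by (auto simp: h_def)
          then show ?thesis using uv(3) by (metis DiffD2)
        next
          assume "u \<notin> X" "v \<in> X"
          then have "h v \<in> ?N Y X" "h u = g u" "g u \<in> Y - ?N Y X" using uv(1,2) g(2) fN[of v] by (auto simp: h_def)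
          then show ?thesis using uv(3) by (metis DiffD2)
        qed
      qed
      moreover have "\<forall>x\<in>S. h x \<in> Y \<and> E x (h x)" using f(2) g(2) by (auto simp: h_def)
      ultimately show ?thesis by blast
    next
      case F: False
      have "card {x} \<le> card (?N Y {x})" using H x by blast
      then have "?N Y {x} \<noteq> {}" by (metis (no_types, lifting) card.empty card_1_singleton_iff not_one_le_zero One_nat_def)
      then obtain y where y: "y \<in> Y" "E x y" by auto
      have c: "card (S - {x}) < card S" using card_Diff1_less[OF fin(1) x] .
      have "card X \<le> card (?N (Y - {y}) X)" if "X \<subseteq> S - {x}" for X
      proof (cases "X = {}")
        case False
        have psub: "X \<subset> S" using that x by auto
        have "card X < card (?N Y X)" using False F psub by (meson linorder_not_less)
        moreover have "?N (Y - {y}) X = ?N Y X - {y}" by auto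
        moreover have "card (?N Y X) - 1 \<le> card (?N Y X - {y})"
          using diff_card_le_card_Diff[of "{y}" "?N Y X"] by simp
        ultimately show ?thesis by simp
      qed simp
      then obtain g where g: "inj_on g (S - {x})" "\<forall>u\<in>S - {x}. g u \<in> Y - {y} \<and> E u (g u)"
        using less.hyps[OF c, of "Y - {y}"] fin by auto
      have "inj_on (g(x := y)) S" using g by (auto simp: inj_on_def)
      moreover have "\<forall>u\<in>S. (g(x := y)) u \<in> Y \<and> E u ((g(x := y)) u)" using g y by auto
      ultimately show ?thesis by blast
    qed
  qed simp
qed

context bip_graph begin

definition nb :: "'a set \<Rightarrow> 'a \<Rightarrow> 'a set" where "nb Y x = {y \<in> Y. E x y}"

definition nbs :: "'a set \<Rightarrow> 'a set \<Rightarrow> 'a set" where "nbs Y X = {y \<in> Y. \<exists>x\<in>X. E x y}"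

definition pm :: "'a set \<Rightarrow> 'a set \<Rightarrow> bool" where
  "pm S Y \<longleftrightarrow> (\<exists>f. bij_betw f S Y \<and> (\<forall>x\<in>S. E x (f x)))"

lemma nbs_mono: "X \<subseteq> X' \<Longrightarrow> nbs Y X \<subseteq> nbs Y X'"
  unfolding nbs_def by auto

lemma pm_sym: assumes "pm S Y" shows "pm Y S"
proof -
  obtain f where f: "bij_betw f S Y" "\<forall>x\<in>S. E x (f x)" using assms pm_def by auto
  let ?g = "inv_into S f"
  have "bij_betw ?g Y S" using f(1) by (rule bij_betw_inv_into)
  moreover have "E y (?g y)" if "y \<in> Y" for y
  proof -
    have "?g y \<in> S" "f (?g y) = y" using that f(1) by (auto simp: bij_betw_def inv_into_into f_inv_into_f)
    then show ?thesis using f(2) sym by metis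
  qed
  ultimately show ?thesis unfolding pm_def by blast
qed

lemma pm_remove:
  assumes "pm S Y" "x \<in> S" shows "\<exists>y\<in>Y. E x y \<and> pm (S - {x}) (Y - {y})"
proof -
  obtain f where f: "bij_betw f S Y" "\<forall>x\<in>S. E x (f x)" using assms pm_def by auto
  have "bij_betw f (S - {x}) (Y - {f x})" using f(1) assms(2)
    by (meson bij_betw_DiffI bij_betw_singletonI empty_subsetI insert_subset bij_betw_apply)
  moreover have "f x \<in> Y" using f(1) assms(2) bij_betwE by blast
  ultimately show ?thesis unfolding pm_def using f assms(2) by blast
qed

lemma pm_hall:
  assumes "finite S" "finite Y" "card S = card Y" "\<And>X. X \<subseteq> S \<Longrightarrow> card X \<le> card (nbs Y X)"
  shows "pm S Y"
proof -
  obtain f where f: "inj_on f S" "\<forall>x\<in>S. f x \<in> Y \<and> E x (f x)"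
    using hall[of S Y E] assms unfolding nbs_def by blast
  have "f ` S = Y" by (rule card_subset_eq) (use f assms card_image[OF f(1)] in auto)
  then show ?thesis unfolding pm_def bij_betw_def using f by blast
qed

end

context no_long begin

text \<open>The path is chosen longest among those whose removal leaves a perfect matching: then a
  neighbour of an end outside the path could be appended together with its partner.\<close>

lemma pm_component:
  assumes S: "S \<subseteq> A" "S \<noteq> {}" and Y: "Y \<subseteq> B" and pm: "pm S Y"
    and deg: "\<And>x y. x \<in> S \<Longrightarrow> y \<in> Y \<Longrightarrow> l + 1 \<le> card (nb Y x) + card (nb S y)"
  obtains S' Y' where "S' \<subseteq> S" "Y' \<subseteq> Y" "S' \<noteq> {}" "card S' = card Y'" "card S' < l"
    "\<And>x. x \<in> S' \<Longrightarrow> nb Y x \<subseteq> Y'" "\<And>y. y \<in> Y' \<Longrightarrow> nb S y \<subseteq> S'"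
proof -
  define good where "good = (\<lambda>p. gpath E p \<and> set p \<subseteq> S \<union> Y \<and> hd p \<in> S \<and> last p \<in> Y
    \<and> pm (S - set p) (Y - set p))"
  have finS: "finite S" "finite Y" using S Y finA finB finite_subset by auto
  have SY: "S \<inter> Y = {}" using S Y disj by auto
  have ext_last: "\<exists>q. good q \<and> length p < length q" if g: "good p" and x: "x \<in> nb S (last p)" "x \<notin> set p" for p x
  proof -
    have xS: "x \<in> S" "E (last p) x" using x by (auto simp: nb_def)
    obtain y where y: "y \<in> Y - set p" "E x y" "pm (S - set p - {x}) (Y - set p - {y})"
      using pm_remove[of "S - set p" "Y - set p" x] g xS x(2) good_def by blast
    have ne: "p \<noteq> []" using g good_def gpath_ne by auto
    have "x \<noteq> y" using xS y SY by auto
    then have "gpath E (p @ [x, y])" using g y xS x ne by (auto simp: good_def gpath_append gpath_Cons)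
    moreover have "S - set (p @ [x, y]) = S - set p - {x}" "Y - set (p @ [x, y]) = Y - set p - {y}"
      using xS y SY by auto
    ultimately have "good (p @ [x, y])" using g y xS ne by (auto simp: good_def)
    then show ?thesis by (intro exI[of _ "p @ [x, y]"]) simp
  qed
  have ext_hd: "\<exists>q. good q \<and> length p < length q" if g: "good p" and y: "y \<in> nb Y (hd p)" "y \<notin> set p" for p y
  proof -
    have yY: "y \<in> Y" "E (hd p) y" using y by (auto simp: nb_def)
    have "pm (Y - set p) (S - set p)" using g pm_sym good_def by blast
    then obtain x where x: "x \<in> S - set p" "E y x" "pm (Y - set p - {y}) (S - set p - {x})"
      using pm_remove[of "Y - set p" "S - set p" y] yY y(2) by blast
    have ne: "p \<noteq> []" using g good_def gpath_ne by auto
    have "x \<noteq> y" using yY x SY by auto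
    then have "gpath E (x # y # p)" using g x y yY sym ne by (auto simp: good_def gpath_Cons)
    moreover have "S - set (x # y # p) = S - set p - {x}" "Y - set (x # y # p) = Y - set p - {y}"
      using yY x SY by auto
    ultimately have "good (x # y # p)" using g x pm_sym[OF x(3)] yY ne by (auto simp: good_def)
    then show ?thesis by (intro exI[of _ "x # y # p"]) simp
  qed
  obtain x0 where x0: "x0 \<in> S" using S by blast
  obtain y0 where y0: "y0 \<in> Y" "E x0 y0" "pm (S - {x0}) (Y - {y0})" using pm_remove[OF pm x0] by blast
  have "x0 \<noteq> y0" using x0 y0 SY by auto
  moreover have "S - {x0, y0} = S - {x0}" "Y - {x0, y0} = Y - {y0}" using x0 y0 SY by auto
  ultimately have g0: "good [x0, y0]" using x0 y0 by (auto simp: good_def gpath_Cons)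
  have bound: "length p < Suc (card (S \<union> Y))" if "good p" for p
  proof -
    have "card (set p) \<le> card (S \<union> Y)" using that finS by (intro card_mono) (auto simp: good_def)
    moreover have "length p = card (set p)" using that by (simp add: good_def gpath_def distinct_card)
    ultimately show ?thesis by simp
  qed
  obtain p where p: "good p" and max: "\<And>q. good q \<Longrightarrow> length q \<le> length p"
    using ex_has_greatest_nat[of good "[x0, y0]" length "Suc (card (S \<union> Y))"] g0 bound by metis
  have gp: "gpath E p" "hd p \<in> S" "last p \<in> Y" "set p \<subseteq> S \<union> Y" using p good_def by auto
  have sat: "nb Y (hd p) \<subseteq> set p" "nb S (last p) \<subseteq> set p"
    using ext_hd[OF p] ext_last[OF p] max linorder_not_less by blast+
  have AB: "hd p \<in> A" "last p \<in> B" using gp S Y by auto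
  have len2: "length p = 2 * card (set p \<inter> B)" using gpath_AB_count[OF gp(1) AB] .
  have lenl: "length p < 2 * l"
  proof (rule ccontr)
    assume "\<not> length p < 2 * l"
    moreover have "card (nb Y (hd p)) \<le> card {v \<in> set p. E (hd p) v}"
      using sat by (intro card_mono) (auto simp: nb_def)
    moreover have "card (nb S (last p)) \<le> card {v \<in> set p. E (last p) v}"
      using sat by (intro card_mono) (auto simp: nb_def)
    ultimately show False using path_ends_degree[OF gp(1) AB] deg[OF gp(2,3)] by linarith
  qed
  have ne: "p \<noteq> []" using gp gpath_ne by auto
  have dp: "distinct p" using gp by (simp add: gpath_def)
  define S' where "S' = set p \<inter> S"
  define Y' where "Y' = set p \<inter> Y"
  have "set p \<inter> B = Y'" using gp S Y disj by (auto simp: Y'_def)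
  then have cY: "length p = 2 * card Y'" using len2 by simp
  have "set p = S' \<union> Y'" "S' \<inter> Y' = {}" using gp SY by (auto simp: S'_def Y'_def)
  then have "length p = card S' + card Y'" using distinct_card[OF dp] card_Un_disjoint[of S' Y'] S'_def Y'_def by auto
  then have cS: "card S' = card Y'" using cY by simp
  \<comment> \<open>\<open>I\<close> and the successors of \<open>J\<close> lie among the odd
    positions, of which there are fewer than \<open>l\<close>. The degree sum forces a common
    element, and the crossing chords there close \<open>p\<close> into a cycle on the same
    vertices.\<close>
  obtain c where c: "gcycle E c" "set c = set p"
  proof -
    define I where "I = {i. i < length p \<and> E (hd p) (p ! i)}"
    define J where "J = {j. j < length p \<and> E (last p) (p ! j)}"
    have fin: "finite I" "finite J" by (auto simp: I_def J_def)
    have "nb Y (hd p) \<subseteq> (!) p ` I" using sat(1) by (auto simp: I_def nb_def in_set_conv_nth subset_iff)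
    then have 1: "card (nb Y (hd p)) \<le> card I" using fin by (metis card_image_le card_mono finite_imageI le_trans)
    have "nb S (last p) \<subseteq> (!) p ` J" using sat(2) by (auto simp: J_def nb_def in_set_conv_nth subset_iff)
    then have 2: "card (nb S (last p)) \<le> card J" using fin by (metis card_image_le card_mono finite_imageI le_trans)
    define D where "D = {k. k < length p \<and> odd k}"
    have "card D = card ((!) p ` D)" using dp by (subst card_image) (auto simp: D_def intro!: inj_on_nth)
    also have "\<dots> \<le> card (set p \<inter> B)"
      using nth_parity(2)[OF gp(1) AB(1)] by (intro card_mono) (auto simp: D_def)
    finally have cD: "card D < l" using len2 lenl by simp
    have ID: "I \<subseteq> D" using nth_parity(2)[OF gp(1) AB(1)] adj_A AB(1) by (auto simp: I_def D_def)
    have JD: "Suc ` J \<subseteq> D"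
    proof
      fix k assume "k \<in> Suc ` J"
      then obtain j where j: "k = Suc j" "j < length p" "E (last p) (p ! j)" by (auto simp: J_def)
      then have "even j" using nth_parity(1)[OF gp(1) AB(1) j(2)] adj_B AB(2) by auto
      moreover have "even (length p)" using len2 by simp
      ultimately show "k \<in> D" using j by (auto simp: D_def) (metis Suc_lessI even_Suc)
    qed
    have "I \<inter> Suc ` J \<noteq> {}"
    proof
      assume "I \<inter> Suc ` J = {}"
      then have "card I + card J = card (I \<union> Suc ` J)" using fin by (simp add: card_Un_disjoint card_image)
      also have "\<dots> \<le> card D" using ID JD by (intro card_mono) (auto simp: D_def)
      finally show False using 1 2 cD deg[OF gp(2,3)] by simp
    qed
    then obtain j where j: "j \<in> J" "Suc j \<in> I" by auto
    define us vs where "us = take (Suc j) p" and "vs = drop (Suc j) p"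
    have jl: "Suc j < length p" using j by (auto simp: I_def)
    have ups: "p = us @ vs" "us \<noteq> []" "vs \<noteq> []" using jl by (auto simp: us_def vs_def)
    have "gpath E us" "gpath E vs" "set us \<inter> set vs = {}" using gp(1) ups by (auto simp: gpath_append)
    moreover have "last us = p ! j" using jl by (simp add: us_def take_Suc_conv_app_nth)
    moreover have "hd vs = p ! Suc j" using jl by (simp add: vs_def hd_drop_conv_nth)
    moreover have "3 \<le> length p"
    proof -
      have "card (nb Y (hd p)) \<le> card Y'" "card (nb S (last p)) \<le> card S'"
        using sat by (auto intro!: card_mono simp: nb_def S'_def Y'_def)
      then show ?thesis using cS cY l4 deg[OF gp(2,3)] by simp
    qed
    moreover have "E (last us) (last p)" "E (hd vs) (hd p)" using j sym calculation by (auto simp: I_def J_def)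
    ultimately have "gcycle E (us @ rev vs)" using ups
      by (intro gcycle_append) (auto simp: grev hd_rev last_rev)
    then show ?thesis using that[of "us @ rev vs"] ups by simp
  qed
  \<comment> \<open>Rotations of the cycle that start in \<open>S\<close> are again longest good
    paths. So each vertex of \<open>S'\<close> can be made first and each of \<open>Y'\<close> last,
    and maximality confines its neighbours.\<close>
  have goodq: "good q" if "gcycle E q" "set q = set p" "hd q \<in> S \<or> last q \<in> Y" for q
  proof -
    have q: "gpath E q" "E (last q) (hd q)" using that(1) by (auto simp: gcycle_iff_gpath)
    have "hd q \<in> S \<union> Y" "last q \<in> S \<union> Y" using gpath_ne[OF q(1)] that(2) gp(4) by (metis hd_in_set last_in_set subsetD)+
    then have "hd q \<in> S \<and> last q \<in> Y" using that(3) bip[OF q(2)] S Y disj by auto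
    then show ?thesis using p q that(2) by (auto simp: good_def)
  qed
  have lq: "length q = length p" if "gcycle E q" "set q = set p" for q
    using that dp by (metis distinct_card gcycle_def)
  show ?thesis
  proof
    show "S' \<subseteq> S" "Y' \<subseteq> Y" "card S' = card Y'" using cS by (auto simp: S'_def Y'_def)
    show "card S' < l" using cS cY lenl by simp
    show "S' \<noteq> {}" using gp(2) hd_in_set[OF ne] by (auto simp: S'_def)
    show "nb Y x \<subseteq> Y'" if "x \<in> S'" for x
    proof -
      have "x \<in> set c" using that c S'_def by auto
      then obtain us vs where "c = us @ x # vs" using split_list by metis
      then have r: "gcycle E ((x # vs) @ us)" "set ((x # vs) @ us) = set p" using c gcycle_rotate[of E us "x # vs"] by auto
      have g: "good ((x # vs) @ us)" by (rule goodq[OF r]) (use that S'_def in auto)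
      have "y \<in> Y'" if "y \<in> nb Y x" for y
      proof (rule ccontr)
        assume "y \<notin> Y'"
        then have "y \<notin> set ((x # vs) @ us)" using that r(2) by (auto simp: Y'_def nb_def)
        moreover have "y \<in> nb Y (hd ((x # vs) @ us))" using that by simp
        ultimately show False using ext_hd[OF g] max lq[OF r] by (metis linorder_not_less)
      qed
      then show ?thesis by blast
    qed
    show "nb S y \<subseteq> S'" if "y \<in> Y'" for y
    proof -
      have "y \<in> set c" using that c Y'_def by auto
      then obtain us vs where "c = (us @ [y]) @ vs" using split_list by fastforce
      then have r: "gcycle E (vs @ us @ [y])" "set (vs @ us @ [y]) = set p" using c gcycle_rotate[of E "us @ [y]" vs] by auto
      have g: "good (vs @ us @ [y])" by (rule goodq[OF r]) (use that Y'_def in auto)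
      have "x \<in> S'" if "x \<in> nb S y" for x
      proof (rule ccontr)
        assume "x \<notin> S'"
        then have "x \<notin> set (vs @ us @ [y])" using that r(2) by (auto simp: S'_def nb_def)
        moreover have "x \<in> nb S (last (vs @ us @ [y]))" using that by simp
        ultimately show False using ext_last[OF g] max lq[OF r] by (metis linorder_not_less)
      qed
      then show ?thesis by blast
    qed
  qed
qed

end

context bip_graph begin

lemma min_violator:
  assumes "finite X" "card (nbs Y X) < card X"
  obtains X1 where "X1 \<subseteq> X" "card (nbs Y X1) < card X1" "\<And>Z. Z \<subset> X1 \<Longrightarrow> card Z \<le> card (nbs Y Z)"
proof -
  define P where "P = (\<lambda>Z. Z \<subseteq> X \<and> card (nbs Y Z) < card Z)"
  have "P X" using assms P_def by auto
  then obtain X1 where X1: "P X1" "\<And>Z. P Z \<Longrightarrow> card X1 \<le> card Z" using ex_has_least_nat[of P X card] by blast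
  show ?thesis
  proof
    show "X1 \<subseteq> X" "card (nbs Y X1) < card X1" using X1 P_def by auto
    show "card Z \<le> card (nbs Y Z)" if "Z \<subset> X1" for Z
    proof (rule ccontr)
      assume "\<not> card Z \<le> card (nbs Y Z)"
      then have "P Z" using that \<open>X1 \<subseteq> X\<close> P_def by auto
      moreover have "card Z < card X1" using that assms(1) \<open>X1 \<subseteq> X\<close> finite_subset psubset_card_mono by metis
      ultimately show False using X1(2) by fastforce
    qed
  qed
qed

text \<open>By minimality, \<open>T = nbs Y X\<close> is matched perfectly with \<open>X\<close>
  minus any one vertex. Take a longest path from \<open>r\<close> into \<open>X\<close> that leaves
  the rest of \<open>T\<close> matched: a neighbour of its end off the path could be appended with
  its partner.\<close>

lemma violator_path:
  assumes X: "X \<subseteq> A" and Y: "Y \<subseteq> B" and viol: "card (nbs Y X) < card X"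
    and min: "\<And>Z. Z \<subset> X \<Longrightarrow> card Z \<le> card (nbs Y Z)" and r: "r \<in> X \<union> nbs Y X"
  obtains q where "gpath E q" "hd q = r" "last q \<in> X" "set q \<subseteq> X \<union> nbs Y X" "nb Y (last q) \<subseteq> set q"
proof -
  define T where "T = nbs Y X"
  have fin: "finite X" "finite T" "finite Y" using finite_subset[OF X finA] finite_subset[OF Y finB] by (auto simp: T_def nbs_def)
  have XT: "X \<inter> T = {}" using X Y disj by (auto simp: T_def nbs_def)
  have pmx: "pm T (X - {x})" if "x \<in> X" for x
  proof (rule pm_sym, rule pm_hall)
    have sub: "X - {x} \<subset> X" using that by blast
    have "nbs Y (X - {x}) \<subseteq> T" unfolding T_def by (rule nbs_mono) auto
    then have "card (nbs Y (X - {x})) \<le> card T" using fin by (intro card_mono)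
    then show "card (X - {x}) = card T" using min[OF sub] viol that fin by (simp add: T_def)
    show "card Z \<le> card (nbs T Z)" if "Z \<subseteq> X - {x}" for Z
    proof -
      have "nbs T Z = nbs Y Z" using that by (auto simp: T_def nbs_def)
      moreover have "Z \<subset> X" using that \<open>x \<in> X\<close> by auto
      ultimately show ?thesis using min by simp
    qed
  qed (use fin in auto)
  define good where "good = (\<lambda>q. gpath E q \<and> hd q = r \<and> last q \<in> X \<and> set q \<subseteq> X \<union> T
    \<and> (\<exists>Z \<subseteq> X - set q. pm (T - set q) Z))"
  have "\<exists>q. good q"
  proof (cases "r \<in> X")
    case True
    have "T - {r} = T" using True XT by auto
    then have "good [r]" using pmx[OF True] True by (auto simp: good_def)
    then show ?thesis by blast
  next
    case False
    then have rT: "r \<in> T" using r T_def by auto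
    then obtain x where x: "x \<in> X" by (auto simp: T_def nbs_def)
    obtain y where y: "y \<in> X - {x}" "E r y" "pm (T - {r}) (X - {x} - {y})"
      using pm_remove[OF pmx[OF x] rT] by blast
    have "r \<noteq> y" using rT y XT by auto
    moreover have "T - {r, y} = T - {r}" using y XT by auto
    moreover have "X - {x} - {y} \<subseteq> X - {r, y}" using rT XT by auto
    ultimately have "good [r, y]" using y rT by (auto simp: good_def gpath_Cons)
    then show ?thesis by blast
  qed
  moreover have bound: "length q < Suc (card (X \<union> T))" if "good q" for q
  proof -
    have "card (set q) \<le> card (X \<union> T)" using that fin by (intro card_mono) (auto simp: good_def)
    moreover have "length q = card (set q)" using that by (simp add: good_def gpath_def distinct_card)
    ultimately show ?thesis by simp
  qed
  ultimately obtain q where q: "good q" and max: "\<And>q'. good q' \<Longrightarrow> length q' \<le> length q"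
    using ex_has_greatest_nat[of good _ length "Suc (card (X \<union> T))"] by metis
  have "s \<in> set q" if s: "s \<in> nb Y (last q)" for s
  proof (rule ccontr)
    assume sq: "s \<notin> set q"
    have sT: "s \<in> T" "E (last q) s" using s q by (auto simp: nb_def T_def nbs_def good_def)
    obtain Z where Z: "Z \<subseteq> X - set q" "pm (T - set q) Z" using q good_def by auto
    obtain y where y: "y \<in> Z" "E s y" "pm (T - set q - {s}) (Z - {y})"
      using pm_remove[OF Z(2), of s] sT sq by blast
    have ne: "q \<noteq> []" using q good_def gpath_ne by auto
    have yX: "y \<in> X" "y \<notin> set q" using y Z by auto
    have "s \<noteq> y" using sT yX XT by auto
    then have "gpath E (q @ [s, y])" using q sT y yX sq ne by (auto simp: good_def gpath_append gpath_Cons)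
    moreover have "T - set (q @ [s, y]) = T - set q - {s}" using yX XT by auto
    moreover have "Z - {y} \<subseteq> X - set (q @ [s, y])" using Z sT XT by auto
    ultimately have "good (q @ [s, y])" using q yX sT y(3) ne by (auto simp: good_def)
    then show False using max by fastforce
  qed
  then show ?thesis using that[of q] q unfolding good_def T_def by blast
qed

end

context no_long begin

text \<open>Without a perfect matching both classes contain a minimal violator of Hall's condition; a path
  joining the two extends inside both to ends that have all their neighbours on it.\<close>

lemma pm_of_degree_sums:
  assumes S: "S \<subseteq> A" and Y: "Y \<subseteq> B" and card: "card S = card Y"
    and deg: "\<And>x y. x \<in> S \<Longrightarrow> y \<in> Y \<Longrightarrow> l + 1 \<le> card (nb Y x) + card (nb S y)"
  shows "pm S Y"
proof (rule ccontr)
  assume npm: "\<not> pm S Y"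
  have fin: "finite S" "finite Y" using S Y finA finB finite_subset by auto
  obtain X where X: "X \<subseteq> S" "card (nbs Y X) < card X"
    using pm_hall[OF fin card] npm linorder_not_less by blast
  \<comment> \<open>The vertices that \<open>X\<close> does not reach violate the condition in the
    other class: their neighbours lie in \<open>S - X\<close>, and the classes have equal
    size.\<close>
  define Y0 where "Y0 = Y - nbs Y X"
  have nsub: "nbs Y X \<subseteq> Y" by (auto simp: nbs_def)
  have nS: "nbs S Y0 \<subseteq> S - X" using sym by (auto simp: Y0_def nbs_def)
  have "card (nbs S Y0) \<le> card (S - X)" using nS fin by (intro card_mono) auto
  also have "\<dots> = card S - card X" using X fin by (meson card_Diff_subset finite_subset)
  also have "\<dots> < card Y - card (nbs Y X)"
    using X card card_mono[OF fin(1) X(1)] by simp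
  also have "\<dots> = card Y0" using nsub fin unfolding Y0_def by (metis card_Diff_subset finite_subset)
  finally have v2: "card (nbs S Y0) < card Y0" .
  have finX: "finite X" "finite Y0" using X fin finite_subset Y0_def by auto
  obtain X1 where X1: "X1 \<subseteq> X" "card (nbs Y X1) < card X1" "\<And>Z. Z \<subset> X1 \<Longrightarrow> card Z \<le> card (nbs Y Z)"
    using min_violator[OF finX(1) X(2)] by blast
  obtain Y2 where Y2: "Y2 \<subseteq> Y0" "card (nbs S Y2) < card Y2" "\<And>Z. Z \<subset> Y2 \<Longrightarrow> card Z \<le> card (nbs S Z)"
    using min_violator[OF finX(2) v2] by blast
  define K1 where "K1 = X1 \<union> nbs Y X1"
  define K2 where "K2 = Y2 \<union> nbs S Y2"
  have sub: "nbs Y X1 \<subseteq> nbs Y X" "nbs S Y2 \<subseteq> nbs S Y0" using nbs_mono X1(1) Y2(1) by auto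
  have XA: "X1 \<subseteq> A" "nbs Y X1 \<subseteq> B" "Y2 \<subseteq> B" "nbs S Y2 \<subseteq> A" "Y2 \<subseteq> Y" "X1 \<subseteq> S"
    using X1 X S Y Y2 Y0_def nsub sub nS by auto
  have K12: "K1 \<inter> K2 = {}"
    using XA disj sub nS X1(1) Y2(1) by (auto simp: K1_def K2_def Y0_def)
  have "X1 \<noteq> {}" "Y2 \<noteq> {}" using X1(2) Y2(2) by auto
  then obtain x y where xy: "x \<in> X1" "y \<in> Y2" by auto
  \<comment> \<open>\<open>connect\<close> always avoids some vertex; here an arbitrary one distinct
    from \<open>x\<close> and \<open>y\<close> is supplied.\<close>
  have "card (A - {x}) \<noteq> 0" using cardA l4 finA by (simp add: card_Diff_singleton_if)
  then obtain v where v: "v \<in> A" "v \<noteq> x" by (metis Diff_eq_empty_iff card.empty insertI1 subsetI singletonD)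
  have vy: "v \<noteq> y" using v xy XA disj by auto
  obtain W where W: "gpath E W" "hd W \<in> K1" "last W \<in> K2" "set W \<inter> K1 = {hd W}" "set W \<inter> K2 = {last W}"
  proof -
    have "x \<in> K1" "y \<in> K2" "x \<in> A \<union> B" "y \<in> A \<union> B" "x \<noteq> v" "y \<noteq> v"
      using xy v vy XA K1_def K2_def by auto
    then show ?thesis using connect[of x K1 v y K2] that by metis
  qed
  obtain q1 where q1: "gpath E q1" "hd q1 = hd W" "last q1 \<in> X1" "set q1 \<subseteq> K1" "nb Y (last q1) \<subseteq> set q1"
    using violator_path[OF XA(1) Y X1(2,3) W(2)[unfolded K1_def]] unfolding K1_def by metis
  obtain q2 where q2: "gpath E q2" "hd q2 = last W" "last q2 \<in> Y2" "set q2 \<subseteq> K2" "nb S (last q2) \<subseteq> set q2"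
    using bip_graph.violator_path[OF swapped_bip XA(3) S Y2(2,3) W(3)[unfolded K2_def]] unfolding K2_def by metis
  have ne: "q1 \<noteq> []" "q2 \<noteq> []" "W \<noteq> []" using gpath_ne[OF q1(1)] gpath_ne[OF q2(1)] gpath_ne[OF W(1)] by auto
  have m1: "set (rev q1) \<inter> set W = {hd W}"
  proof -
    have "hd W \<in> set q1" using q1(2) ne by (metis hd_in_set)
    then show ?thesis using W(4) q1(4) ne by auto
  qed
  define p1 where "p1 = rev q1 @ tl W"
  have p1: "gpath E p1" "hd p1 = last q1" "last p1 = last W" "set p1 = set q1 \<union> set W"
    using gpath_join[OF grev[OF q1(1)] W(1)] m1 q1(2) ne by (auto simp: p1_def last_rev hd_rev)
  have m2: "set p1 \<inter> set q2 = {hd q2}"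
  proof -
    have "hd q2 \<in> set q2" "hd q2 \<in> set W" using hd_in_set[OF ne(2)] last_in_set[OF ne(3)] q2(2) by auto
    moreover have "set q1 \<inter> set q2 = {}" using q1(4) q2(4) K12 by auto
    ultimately show ?thesis using W(5) q2(2,4) p1(4) by auto
  qed
  define p where "p = p1 @ tl q2"
  have p: "gpath E p" "hd p = last q1" "last p = last q2" "set p = set q1 \<union> set W \<union> set q2"
    using gpath_join[OF p1(1) q2(1)] m2 p1 q2(2) by (auto simp: p_def)
  have AB: "hd p \<in> A" "last p \<in> B" using p q1 q2 XA by auto
  have dsum: "l + 1 \<le> card (nb Y (last q1)) + card (nb S (last q2))" using deg q1(3) q2(3) XA by blast
  \<comment> \<open>The path is long enough: \<open>q2\<close> ends in \<open>B\<close>, so it has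
    at least as many vertices in \<open>B\<close> as its end has neighbours. These are disjoint from
    the neighbours of the other end, which lie on \<open>q1\<close>, so at least
    \<open>l + 1\<close> vertices of \<open>B\<close> occur.\<close>
  have "card (set q2 \<inter> A) \<le> card (set q2 \<inter> B)"
  proof -
    have h: "hd q2 \<in> A \<union> B" "hd q2 \<in> B \<union> A" using q2(2) W(3) XA unfolding K2_def by auto
    have "last q2 \<notin> A" using q2(3) XA disj by auto
    then show ?thesis
      using gpath_count[OF q2(1) h(1)] bip_graph.gpath_count[OF swapped_bip q2(1) h(2)] h disj by auto
  qed
  moreover have "card (nb S (last q2)) \<le> card (set q2 \<inter> A)"
    using q2(5) S by (intro card_mono) (auto simp: nb_def)
  moreover have "card (nb Y (last q1)) + card (set q2 \<inter> B) \<le> card (set p \<inter> B)"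
  proof -
    have "nb Y (last q1) \<inter> set q2 = {}" using q1 q2 K12 by blast
    then have "card (nb Y (last q1)) + card (set q2 \<inter> B) = card (nb Y (last q1) \<union> (set q2 \<inter> B))"
      using fin by (subst card_Un_disjoint) (auto simp: nb_def)
    also have "\<dots> \<le> card (set p \<inter> B)" using q1(5) p(4) Y by (intro card_mono) (auto simp: nb_def)
    finally show ?thesis .
  qed
  ultimately have "2 * l \<le> length p" using gpath_AB_count[OF p(1) AB] dsum by linarith
  moreover have "card (nb Y (last q1)) \<le> card {v \<in> set p. E (hd p) v}"
    using q1(5) p by (intro card_mono) (auto simp: nb_def)
  moreover have "card (nb S (last q2)) \<le> card {v \<in> set p. E (last p) v}"
    using q2(5) p by (intro card_mono) (auto simp: nb_def)
  ultimately show False using path_ends_degree[OF p(1) AB] dsum by linarith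
qed

end

section \<open>Nearly complete bipartite graphs\<close>

lemma exists_other: assumes "2 \<le> card X" obtains z where "z \<in> X" "z \<noteq> w"
proof -
  have "\<not> X \<subseteq> {w}" using card_mono[of "{w}" X] assms by auto
  then show ?thesis using that by blast
qed

context bip_graph begin

definition miss :: "'a set \<Rightarrow> 'a set \<Rightarrow> ('a \<times> 'a) set" where
  "miss S Y = {(x, y). x \<in> S \<and> y \<in> Y \<and> \<not> E x y}"

lemma finite_miss: "finite S \<Longrightarrow> finite Y \<Longrightarrow> finite (miss S Y)"
  by (rule finite_subset[of _ "S \<times> Y"]) (auto simp: miss_def)

lemma nb_miss:
  assumes "finite S" "finite Y" "x \<in> S"
  shows "card Y \<le> card (nb Y x) + card (miss S Y)"
proof -
  have "card (Pair x ` (Y - nb Y x)) \<le> card (miss S Y)"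
    using assms by (intro card_mono finite_miss) (auto simp: miss_def nb_def)
  then have "card (Y - nb Y x) \<le> card (miss S Y)" by (simp add: card_image inj_on_def)
  moreover have "card (Y - nb Y x) = card Y - card (nb Y x)"
    using assms by (intro card_Diff_subset) (auto simp: nb_def)
  ultimately show ?thesis by simp
qed

lemma miss_swap: "miss Y S = prod.swap ` miss S Y"
  using sym by (auto simp: miss_def image_iff)

lemma card_miss_swap: "card (miss Y S) = card (miss S Y)"
  by (subst miss_swap) (rule card_image, auto intro!: inj_onI)

lemma nb_miss':
  assumes "finite S" "finite Y" "y \<in> Y"
  shows "card S \<le> card (nb S y) + card (miss S Y)"
  using nb_miss[OF assms(2,1,3)] card_miss_swap by simp

lemma card_miss_less:
  assumes "finite S" "finite Y" "S' \<subseteq> S" "Y' \<subseteq> Y" "e \<in> miss S Y" "e \<notin> miss S' Y'"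
  shows "card (miss S' Y') < card (miss S Y)"
  using assms by (intro psubset_card_mono finite_miss) (auto simp: miss_def)

text \<open>Induction by removing an end and a neighbour of it. If edges are missing, the removed
  pair meets one of them, so that the allowance \<open>n - 2\<close> and the number of missing edges
  shrink together. For \<open>n = 1\<close> there is no allowance, hence the separate
  clause.\<close>

lemma ham_path:
  assumes "finite S" "finite Y" "S \<inter> Y = {}" "card S = n" "card Y = n" "x \<in> S" "y \<in> Y"
    "card (miss S Y) + 2 \<le> n \<or> n = 1 \<and> card (miss S Y) = 0"
  shows "\<exists>p. gpath E p \<and> hd p = x \<and> last p = y \<and> set p = S \<union> Y"
  using assms
proof (induction n arbitrary: S Y x y)
  case 0
  then show ?case by simp
next
  case (Suc n)
  note fin = Suc.prems(1,2) and SY = Suc.prems(3) and cS = Suc.prems(4,5) and xy = Suc.prems(6,7)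
  show ?case
  proof (cases "n = 0")
    case True
    then have "S = {x}" "Y = {y}" using cS xy by (metis One_nat_def card_1_singletonE singletonD)+
    moreover have "E x y" using Suc.prems(8) True xy finite_miss[OF fin] by (auto simp: miss_def)
    ultimately show ?thesis using SY by (intro exI[of _ "[x, y]"]) (auto simp: gpath_Cons)
  next
    case n0: False
    have m2: "card (miss S Y) + 2 \<le> Suc n" using Suc.prems(8) n0 by simp
    have deg: "2 \<le> card (nb Y u)" if "u \<in> S" for u using nb_miss[OF fin that] m2 cS by simp
    have deg': "2 \<le> card (nb S u)" if "u \<in> Y" for u using nb_miss'[OF fin that] m2 cS by simp
    have small: "card (miss (S - {u}) (Y - {v})) + 2 \<le> n \<or> n = 1 \<and> card (miss (S - {u}) (Y - {v})) = 0"
      if t: "miss S Y = {} \<or> (\<exists>e\<in>miss S Y. fst e = u \<or> snd e = v)" for u v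
    proof (cases "miss S Y = {}")
      case True
      then have "miss (S - {u}) (Y - {v}) = {}" by (auto simp: miss_def)
      then show ?thesis using n0 by auto
    next
      case False
      then obtain e where e: "e \<in> miss S Y" "fst e = u \<or> snd e = v" using t by auto
      have "card (miss (S - {u}) (Y - {v})) < card (miss S Y)"
        by (rule card_miss_less[OF fin _ _ e(1)]) (use e(2) in \<open>auto simp: miss_def\<close>)
      then show ?thesis using m2 by linarith
    qed
    have fromx: ?thesis if y': "y' \<in> nb Y x" "y' \<noteq> y" and t: "miss S Y = {} \<or> (\<exists>e\<in>miss S Y. fst e = x \<or> snd e = y')" for y'
    proof -
      have y'Y: "y' \<in> Y" "E x y'" using y' by (auto simp: nb_def)
      obtain x' where x': "x' \<in> nb S y'" "x' \<noteq> x" by (rule exists_other[OF deg'[OF y'Y(1)]])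
      obtain q where q: "gpath E q" "hd q = x'" "last q = y" "set q = (S - {x}) \<union> (Y - {y'})"
        using Suc.IH[of "S - {x}" "Y - {y'}" x' y] small[OF t] fin SY cS xy y' x' y'Y
        by (auto simp: nb_def)
      have "gpath E (x # y' # q)" using q x' y'Y xy SY gpath_ne[OF q(1)]
        by (auto simp: gpath_Cons nb_def)
      then show ?thesis using q xy y'Y gpath_ne[OF q(1)] by (intro exI[of _ "x # y' # q"]) auto
    qed
    have fromy: ?thesis if x': "x' \<in> nb S y" "x' \<noteq> x" and t: "miss S Y = {} \<or> (\<exists>e\<in>miss S Y. fst e = x' \<or> snd e = y)" for x'
    proof -
      have x'S: "x' \<in> S" "E y x'" using x' by (auto simp: nb_def)
      obtain y' where y': "y' \<in> nb Y x'" "y' \<noteq> y" by (rule exists_other[OF deg[OF x'S(1)]])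
      obtain q where q: "gpath E q" "hd q = x" "last q = y'" "set q = (S - {x'}) \<union> (Y - {y})"
        using Suc.IH[of "S - {x'}" "Y - {y}" x y'] small[OF t] fin SY cS xy x' y' x'S
        by (auto simp: nb_def)
      have "gpath E (q @ [x', y])" using q y' x'S xy SY gpath_ne[OF q(1)] sym
        by (auto simp: gpath_Cons gpath_append nb_def)
      then show ?thesis using q xy x'S gpath_ne[OF q(1)] by (intro exI[of _ "q @ [x', y]"]) auto
    qed
    \<comment> \<open>Given a missing pair \<open>(a, b)\<close>, either \<open>x\<close> misses
      \<open>b\<close> too, and removing \<open>x\<close> destroys a missing pair, or
      \<open>x\<close> can step to \<open>b\<close>. The latter is barred only for
      \<open>b = y\<close>, where the path is built from the end \<open>y\<close>.\<close>
    consider "miss S Y = {}" | b where "(x, b) \<in> miss S Y" | a b where "(a, b) \<in> miss S Y" "b \<noteq> y" "E x b"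
      | a where "(a, y) \<in> miss S Y"
      using xy by (fastforce simp: miss_def)
    then show ?thesis
    proof cases
      case 1
      obtain z where "z \<in> nb Y x" "z \<noteq> y" by (rule exists_other[OF deg[OF xy(1)]])
      then show ?thesis using fromx 1 by blast
    next
      case (2 b)
      obtain z where "z \<in> nb Y x" "z \<noteq> y" by (rule exists_other[OF deg[OF xy(1)]])
      then show ?thesis using fromx 2 by fastforce
    next
      case (3 a b)
      then have "b \<in> nb Y x" by (auto simp: nb_def miss_def)
      then show ?thesis using fromx[of b] 3 by fastforce
    next
      case (4 a)
      obtain z where "z \<in> nb S y" "z \<noteq> x" by (rule exists_other[OF deg'[OF xy(2)]])
      then show ?thesis using fromy 4 by fastforce
    qed
  qed
qed

text \<open>One vertex \<open>y0\<close> of \<open>Y\<close> is left out and \<open>g2\<close> is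
  appended to a path from \<open>ham_path\<close>. Taking \<open>y0\<close> on a missing edge, if
  there is one, respects the smaller allowance.\<close>

lemma near_ham_path:
  assumes fin: "finite S" "finite Y" and SY: "S \<inter> Y = {}" and c: "card S = n" "card Y = n" "3 \<le> n"
    and g: "g1 \<in> S" "g2 \<in> S" "g1 \<noteq> g2" and m: "card (miss S Y) + 2 \<le> n"
  shows "\<exists>p. gpath E p \<and> hd p = g1 \<and> last p = g2 \<and> set p \<subseteq> S \<union> Y \<and> S \<subseteq> set p"
proof -
  obtain y0 where y0: "y0 \<in> Y" "card (miss (S - {g2}) (Y - {y0})) + 2 \<le> n - 1"
  proof (cases "miss S Y = {}")
    case True
    obtain y0 where "y0 \<in> Y" using c by (metis card.empty equals0I not_numeral_le_zero)
    moreover have "miss (S - {g2}) (Y - {y0}) = {}" using True by (auto simp: miss_def)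
    ultimately show ?thesis using that c by auto
  next
    case False
    then obtain a b where ab: "(a, b) \<in> miss S Y" by auto
    have "card (miss (S - {g2}) (Y - {b})) < card (miss S Y)"
      by (rule card_miss_less[OF fin _ _ ab]) (auto simp: miss_def)
    moreover have "b \<in> Y" using ab by (auto simp: miss_def)
    ultimately show ?thesis using that[of b] m by linarith
  qed
  have "2 \<le> card (nb Y g2)" using nb_miss[OF fin g(2)] m c by simp
  then obtain y1 where y1: "y1 \<in> nb Y g2" "y1 \<noteq> y0" by (rule exists_other)
  obtain p where p: "gpath E p" "hd p = g1" "last p = y1" "set p = (S - {g2}) \<union> (Y - {y0})"
    using ham_path[of "S - {g2}" "Y - {y0}" "n - 1" g1 y1] fin SY c g y0 y1 by (auto simp: nb_def)
  have "E y1 g2" using y1 sym by (auto simp: nb_def)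
  then have "gpath E (p @ [g2])" using p g SY gpath_ne[OF p(1)] by (auto simp: gpath_append)
  moreover have "hd (p @ [g2]) = g1" using p(2) gpath_ne[OF p(1)] by simp
  moreover have "set (p @ [g2]) \<subseteq> S \<union> Y" "S \<subseteq> set (p @ [g2])" using p(4) g(2) by auto
  ultimately show ?thesis by (intro exI[of _ "p @ [g2]"]) simp
qed

text \<open>\<open>shape (l - 2) S Y C U\<close> says that \<open>S\<close> and \<open>Y\<close> induce \<open>B\<^sub>2\<close> with \<open>A\<^sub>0 = C\<close> and
  \<open>{u\<^sub>1, u\<^sub>2} = U\<close>, where \<open>S\<close> may lie in either class.  \<open>ext\<close> records what is known about
  vertices outside \<open>S\<close>; it has to be carried along because it does not follow from the shape
  when both classes of the subgraph have only \<open>l - 1\<close> vertices.\<close>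

definition shape :: "nat \<Rightarrow> 'a set \<Rightarrow> 'a set \<Rightarrow> 'a set \<Rightarrow> 'a set \<Rightarrow> bool" where
  "shape k S Y C U \<longleftrightarrow> C \<subseteq> S \<and> card C = k \<and> U \<subseteq> Y \<and> card U = 2 \<and> (\<forall>c\<in>C. nb Y c = Y) \<and> (\<forall>x\<in>S - C. nb Y x = U)"

definition ext :: "'a set \<Rightarrow> 'a set \<Rightarrow> 'a set \<Rightarrow> 'a set \<Rightarrow> bool" where
  "ext S Y C U \<longleftrightarrow> (\<exists>x1\<in>A - C. \<exists>x2\<in>A - C. x1 \<noteq> x2 \<and> (\<forall>u\<in>U. E x1 u \<and> E x2 u))
     \<and> (\<forall>x\<in>A - S. nb Y x = U \<or> card (nb Y x) \<le> 1)"

end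

section \<open>Vertices outside a nearly complete core with classes of size l - 1\<close>

context no_long begin

lemma no_cycle_A: "gcycle E c \<Longrightarrow> X \<subseteq> set c \<inter> A \<Longrightarrow> l \<le> card X \<Longrightarrow> False"
  by (rule no_long.no_cycle_B[OF swapped])

lemmas no_theta_A = no_long.no_theta_B[OF swapped]

text \<open>A fan from the core to \<open>x\<close> gives a path \<open>e\<close> through
  \<open>x\<close> with both ends in the core. Unless both ends lie in \<open>Y\<close>, the core
  joins them by a path covering \<open>S\<close>, which with \<open>x\<close> makes \<open>l\<close>
  vertices of \<open>A\<close>. Otherwise a path covering \<open>Y\<close> shows that the vertices
  next to \<open>x\<close> on \<open>e\<close> are in \<open>Y\<close>, hence are the ends of
  \<open>e\<close>.\<close>

lemma outside_adjacent:
  assumes S: "S \<subseteq> A" and Y: "Y \<subseteq> B" and c: "card S = l - 1" "card Y = l - 1"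
    and m: "card (miss S Y) + 3 \<le> l" and x: "x \<in> A - S"
  shows "\<exists>h1 h2. h1 \<in> Y \<and> h2 \<in> Y \<and> h1 \<noteq> h2 \<and> E x h1 \<and> E x h2"
proof -
  have fin: "finite S" "finite Y" using S Y finA finB finite_subset by auto
  have SY: "S \<inter> Y = {}" using S Y disj by auto
  define L where "L = S \<union> Y"
  obtain s y where sy: "s \<in> S" "y \<in> Y" 
  proof -
    have "S \<noteq> {}" "Y \<noteq> {}" using c l4 by auto
    then show ?thesis using that by blast
  qed
  have "s \<noteq> y" using sy SY by auto
  obtain i P Q where "fan L i P Q x"
  proof -
    have "L \<subseteq> A \<union> B" "s \<in> L" "y \<in> L" "y \<noteq> s" "x \<in> A \<union> B" "x \<notin> L"
      using S Y x sy \<open>s \<noteq> y\<close> disj by (auto simp: L_def)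
    then show ?thesis using that by (rule fan_exists)
  qed
  then have PQ: "gpath E P" "gpath E Q" "last P = x" "last Q = x" "x \<notin> L"
    "set P \<inter> L = {hd P}" "set Q \<inter> L = {hd Q}" "set P \<inter> set Q = {x}" unfolding fan_def by auto
  have ne: "P \<noteq> []" "Q \<noteq> []" using PQ gpath_ne by auto
  have hL: "hd P \<in> L" "hd Q \<in> L" using PQ by auto
  have hne: "hd P \<noteq> hd Q"
  proof
    assume "hd P = hd Q"
    then have "hd P \<in> set P \<inter> set Q" using ne by (metis IntI hd_in_set)
    then show False using PQ hL by auto
  qed
  define e where "e = P @ tl (rev Q)"
  have "set P \<inter> set (rev Q) = {hd (rev Q)}" using PQ ne by (simp add: hd_rev)
  then have e: "gpath E e" "hd e = hd P" "last e = hd Q" "set e = set P \<union> set Q"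
    using gpath_join[OF PQ(1) grev[OF PQ(2)]] PQ ne by (auto simp: e_def hd_rev last_rev)
  have eL: "set e \<inter> L = {hd P, hd Q}" using e(4) PQ(6,7) by auto
  have xe: "x \<in> set e" using e(4) PQ(3) last_in_set[OF ne(1)] by simp
  have close: False if p: "gpath E p" "hd p = hd P" "last p = hd Q" "set p \<subseteq> L"
    and X: "l \<le> card ((set p \<union> set e) \<inter> A) \<or> l \<le> card ((set p \<union> set e) \<inter> B)" for p
  proof -
    have pe: "hd p = last (rev e)" "last p = hd (rev e)" "hd p \<noteq> last p"
      using p e hne gpath_ne[OF e(1)] by (auto simp: hd_rev last_rev)
    have "hd p \<in> set p" "last p \<in> set p" using gpath_ne[OF p(1)] by auto
    then have "set p \<inter> set (rev e) = {hd p, last p}" using eL p by auto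
    then show False 
      using X no_theta_A[OF p(1) grev[OF e(1)] pe, of "(set p \<union> set e) \<inter> A"]
        no_theta_B[OF p(1) grev[OF e(1)] pe, of "(set p \<union> set e) \<inter> B"] by auto
  qed
  have n3: "3 \<le> l - 1" "card (miss S Y) + 2 \<le> l - 1" using l4 m by auto
  have coverA: False if "gpath E p" "hd p = hd P" "last p = hd Q" "set p \<subseteq> L" "S \<subseteq> set p" for p
  proof (rule close[OF that(1-4)])
    have "card (insert x S) = l" using x fin c l4 by (simp add: card_insert_if)
    moreover have "card (insert x S) \<le> card ((set p \<union> set e) \<inter> A)"
      using x xe S that(5) by (intro card_mono) auto
    ultimately show "l \<le> card ((set p \<union> set e) \<inter> A) \<or> l \<le> card ((set p \<union> set e) \<inter> B)" by simp
  qed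
  have "\<not> (hd P \<in> S \<and> hd Q \<in> Y)"
  proof
    assume "hd P \<in> S \<and> hd Q \<in> Y"
    then obtain p where "gpath E p" "hd p = hd P" "last p = hd Q" "set p = S \<union> Y"
      using ham_path[OF fin SY c] n3 by blast
    then show False using coverA L_def by blast
  qed
  moreover have "\<not> (hd P \<in> Y \<and> hd Q \<in> S)"
  proof
    assume "hd P \<in> Y \<and> hd Q \<in> S"
    then obtain p where "gpath E p" "hd p = hd P" "last p = hd Q" "set p = Y \<union> S"
      using ham_path[OF fin(2,1) _ c(2,1)] n3 SY card_miss_swap by (metis Int_commute)
    then show False using coverA L_def by blast
  qed
  moreover have "\<not> (hd P \<in> S \<and> hd Q \<in> S)"
  proof
    assume "hd P \<in> S \<and> hd Q \<in> S"
    then obtain p where "gpath E p" "hd p = hd P" "last p = hd Q" "set p \<subseteq> S \<union> Y" "S \<subseteq> set p"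
      using near_ham_path[OF fin SY c n3(1) _ _ hne n3(2)] by blast
    then show False using coverA L_def by blast
  qed
  ultimately have hY: "hd P \<in> Y" "hd Q \<in> Y" using hL L_def by auto
  obtain p where p: "gpath E p" "hd p = hd P" "last p = hd Q" "set p \<subseteq> L" "Y \<subseteq> set p"
    using near_ham_path[OF fin(2,1) _ c(2,1) n3(1) hY hne] n3(2) SY card_miss_swap L_def by (metis Int_commute Un_commute)
  have adj: "E x (hd R)" if R: "R = P \<or> R = Q" for R
  proof -
    have gR: "gpath E R" "last R = x" "set R \<inter> L = {hd R}" "R \<noteq> []" "set R \<subseteq> set e" "hd R \<in> Y" using R PQ ne e(4) hY by auto
    have "hd R \<noteq> x" using gR PQ(5) by auto
    obtain us where us: "R = us @ [x]" using gR by (metis append_butlast_last_id)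
    have usne: "us \<noteq> []" using us \<open>hd R \<noteq> x\<close> by auto
    have Ew: "E (last us) x" using gR(1) us usne by (auto simp: gpath_append)
    have wB: "last us \<in> B" using adj_A[OF sym[OF Ew]] x by blast
    have wR: "last us \<in> set R" using us usne by auto
    have "last us \<in> Y"
    proof (rule ccontr)
      assume w: "last us \<notin> Y"
      have "card (insert (last us) Y) = l" using w fin c l4 by (simp add: card_insert_if)
      moreover have "card (insert (last us) Y) \<le> card ((set p \<union> set e) \<inter> B)"
        using wB wR gR(5) Y p(5) by (intro card_mono) auto
      ultimately show False using close[OF p(1-4)] by simp
    qed
    then have "last us = hd R" using gR(3) wR L_def by auto
    then show ?thesis using sym[OF Ew] by simp
  qed
  then show ?thesis using hY hne by blast
qed

context
  fixes S Y x z
  assumes S: "S \<subseteq> A" and Y: "Y \<subseteq> B" and cS: "card S = l - 1" and cY: "card Y = l - 1"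
    and m: "card (miss S Y) + 3 \<le> l" and x: "x \<in> A - S" and z: "z \<in> B - Y"
begin

lemma finite_SY: "finite S" "finite Y"
  using S Y finA finB finite_subset by auto

lemma S_Y_disjoint: "S \<inter> Y = {}"
  using S Y disj by auto

text \<open>The cycle \<open>x\<close>, \<open>p\<close>, \<open>z\<close>, \<open>q\<close>
  contains \<open>x\<close> and all of \<open>S\<close>, which are \<open>l\<close> vertices of
  \<open>A\<close>.\<close>

lemma two_paths_False:
  assumes p: "gpath E p" "E x (hd p)" "E (last p) z" and q: "gpath E q" "E z (hd q)" "E (last q) x"
    and pq: "set p \<inter> set q = {}" "set p \<subseteq> S \<union> Y" "set q \<subseteq> S \<union> Y" "S \<subseteq> set p \<union> set q"
  shows False
proof -
  have ne: "p \<noteq> []" "q \<noteq> []" using p q gpath_ne by auto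
  have xz: "x \<notin> S \<union> Y" "z \<notin> S \<union> Y" "x \<noteq> z" using x z S Y disj by auto
  have g1: "gpath E (x # p)" using p xz pq by (auto simp: gpath_Cons)
  have g2: "gpath E (z # q)" using q xz pq by (auto simp: gpath_Cons)
  have "gcycle E ((x # p) @ (z # q))"
    using xz pq p q ne by (intro gcycle_append[OF g1 g2]) (auto simp: Suc_le_eq)
  moreover have "card (insert x S) = l" using x finite_SY cS l4 by (simp add: card_insert_if)
  moreover have "insert x S \<subseteq> set ((x # p) @ (z # q)) \<inter> A" using pq x S by auto
  ultimately show False using no_cycle_A by (metis order_refl)
qed

lemma rest_path:
  assumes "S' \<subseteq> S" "Y' \<subseteq> Y" "card S' = n" "card Y' = n" "2 \<le> n" "card (miss S' Y') + 2 \<le> n" "g \<in> S'" "h \<in> Y'"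
  obtains q where "gpath E q" "hd q = g" "last q = h" "set q = S' \<union> Y'"
proof -
  have "finite S'" "finite Y'" "S' \<inter> Y' = {}" using assms finite_SY S_Y_disjoint finite_subset by auto
  then show ?thesis using ham_path[of S' Y' n g h] assms that by auto
qed

context
  fixes h h' g g'
  assumes h: "h \<in> Y" "h' \<in> Y" "h \<noteq> h'" "E x h" "E x h'" and g: "g \<in> S" "g' \<in> S" "g \<noteq> g'" "E z g" "E z g'"
begin

text \<open>With the edge between \<open>h\<close> and \<open>g\<close>, a Hamiltonian path from
  \<open>g'\<close> to \<open>h'\<close> in the remaining core would complete a forbidden cycle. The
  remaining classes have size \<open>l - 2\<close>, so more than \<open>l - 4\<close> edges must be
  missing there.\<close>

lemma short_link:
  assumes "E h g" shows "l \<le> card (miss (S - {g}) (Y - {h})) + 3"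
proof (rule ccontr)
  assume a: "\<not> ?thesis"
  obtain q where q: "gpath E q" "hd q = g'" "last q = h'" "set q = (S - {g}) \<union> (Y - {h})"
    by (rule rest_path[of "S - {g}" "Y - {h}" "l - 2" g' h']) (use a l4 h g cS cY finite_SY in auto)
  have "h \<noteq> g" using h g S_Y_disjoint by auto
  then have "gpath E [h, g]" using assms by (simp add: gpath_Cons)
  then show False by (rule two_paths_False[OF _ _ _ q(1)]) (use q h g sym \<open>h \<noteq> g\<close> S_Y_disjoint in auto)
qed

text \<open>The same with the detour \<open>h\<close>, \<open>a\<close>, \<open>b\<close>,
  \<open>g\<close>: the remaining classes have size \<open>l - 3\<close>, which is at least 2 by
  \<open>5 \<le> l\<close>, so more than \<open>l - 5\<close> edges must be missing there.\<close>

lemma long_link: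
  assumes "E h a" "E a b" "E b g" "a \<in> S - {g, g'}" "b \<in> Y - {h, h'}" "5 \<le> l"
  shows "l \<le> card (miss (S - {a, g}) (Y - {b, h})) + 4"
proof (rule ccontr)
  assume n: "\<not> ?thesis"
  have c: "card (S - {a, g}) = l - 3" "card (Y - {b, h}) = l - 3"
    using assms g h cS cY finite_SY by (auto simp: card_Diff_subset)
  obtain q where q: "gpath E q" "hd q = g'" "last q = h'" "set q = (S - {a, g}) \<union> (Y - {b, h})"
    by (rule rest_path[of "S - {a, g}" "Y - {b, h}" "l - 3" g' h']) (use n c assms h g in auto)
  have d: "h \<noteq> g" "h \<noteq> a" "b \<noteq> g" "a \<noteq> b" using h g S_Y_disjoint assms by auto
  then have "gpath E [h, a, b, g]" using assms by (auto simp add: gpath_Cons)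
  then show False by (rule two_paths_False[OF _ _ _ q(1)]) (use q h g sym d assms S_Y_disjoint in auto)
qed

end

text \<open>The outside vertices \<open>x\<close> and \<open>z\<close> can be put on a common cycle covering \<open>S\<close> unless the missing
  edges form a star avoiding their neighbours.\<close>

lemma star_structure:
  assumes h: "h1 \<in> Y" "h2 \<in> Y" "h1 \<noteq> h2" "E x h1" "E x h2" and g: "g1 \<in> S" "g2 \<in> S" "g1 \<noteq> g2" "E z g1" "E z g2"
  shows "miss S Y \<subseteq> (S - {g1, g2}) \<times> (Y - {h1, h2}) \<and>
    ((\<exists>a\<in>S. miss S Y = {a} \<times> (Y - {h1, h2})) \<or> (\<exists>b\<in>Y. miss S Y = (S - {g1, g2}) \<times> {b}))"
proof -
  define M where "M = miss S Y"
  have finM: "finite M" using finite_miss finite_SY M_def by auto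
  \<comment> \<open>At most \<open>l - 3\<close> edges are missing and at least \<open>l - 3\<close>
    of them survive the removal of an adjacent pair \<open>h\<close>, \<open>g\<close>. So none of
    them meets that pair.\<close>
  have sl: "e \<notin> M" if "h \<in> {h1, h2}" "g \<in> {g1, g2}" "E h g" "fst e = g \<or> snd e = h" for e h g
  proof
    assume e: "e \<in> M"
    have "card (miss (S - {g}) (Y - {h})) < card (miss S Y)"
      by (rule card_miss_less[OF finite_SY, of _ _ e]) (use e that in \<open>auto simp: miss_def M_def\<close>)
    moreover have "l \<le> card (miss (S - {g}) (Y - {h})) + 3"
      using that assms short_link[of h1 h2 g1 g2] short_link[of h1 h2 g2 g1]
        short_link[of h2 h1 g1 g2] short_link[of h2 h1 g2 g1] by auto
    ultimately show False using m by linarith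
  qed
  \<comment> \<open>Otherwise four missing edges join the two pairs and at most \<open>l - 7\<close>
    are left, so each class has a vertex outside the pairs without missing edges. The detour through
    these two destroys two missing edges, one more than \<open>long_link\<close> permits.\<close>
  have "\<exists>h\<in>{h1, h2}. \<exists>g\<in>{g1, g2}. E h g"
  proof (rule ccontr)
    assume no: "\<not> ?thesis"
    define F where "F = {(g1, h1), (g1, h2), (g2, h1), (g2, h2)}"
    have F: "F \<subseteq> M" using no h g sym by (auto simp: M_def miss_def F_def)
    have cF: "card F = 4" using h(3) g(3) by (simp add: F_def)
    then have cM: "4 \<le> card M" using card_mono[OF finM F] by simp
    have cMF: "card (M - F) = card M - 4" using F cF finM by (metis card_Diff_subset finite_subset)
    have c2: "card (S - {g1, g2}) = l - 3" "card (Y - {h1, h2}) = l - 3"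
      using g h cS cY finite_SY by (auto simp: card_Diff_subset)
    obtain a where a: "a \<in> S - {g1, g2}" "a \<notin> fst ` (M - F)"
    proof -
      have "card (fst ` (M - F)) < card (S - {g1, g2})"
        using card_image_le[of "M - F" fst] finM cMF c2 cM m unfolding M_def by simp
      then have "\<not> S - {g1, g2} \<subseteq> fst ` (M - F)" using finM card_mono by (meson finite_Diff finite_imageI linorder_not_less)
      then show ?thesis using that by blast
    qed
    obtain b where b: "b \<in> Y - {h1, h2}" "b \<notin> snd ` (M - F)"
    proof -
      have "card (snd ` (M - F)) < card (Y - {h1, h2})"
        using card_image_le[of "M - F" snd] finM cMF c2 cM m unfolding M_def by simp
      then have "\<not> Y - {h1, h2} \<subseteq> snd ` (M - F)" using finM card_mono by (meson finite_Diff finite_imageI linorder_not_less)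
      then show ?thesis using that by blast
    qed
    have fullA: "E a y" if "y \<in> Y" for y
    proof (rule ccontr)
      assume "\<not> E a y"
      then have "(a, y) \<in> M - F" using a that by (auto simp: M_def miss_def F_def)
      then show False using a(2) by force
    qed
    have fullB: "E b s" if "s \<in> S" for s
    proof (rule ccontr)
      assume "\<not> E b s"
      then have "(s, b) \<in> M - F" using b that sym by (auto simp: M_def miss_def F_def)
      then show False using b(2) by force
    qed
    have "l \<le> card (miss (S - {a, g1}) (Y - {b, h1})) + 4"
      by (rule long_link[of h1 h2 g1 g2]) (use assms a b fullA fullB sym cM m M_def in auto)
    moreover have "miss (S - {a, g1}) (Y - {b, h1}) \<subseteq> M - {(g1, h1), (g1, h2)}"
      by (auto simp: M_def miss_def)
    then have "card (miss (S - {a, g1}) (Y - {b, h1})) \<le> card (M - {(g1, h1), (g1, h2)})"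
      using finM by (intro card_mono) auto
    moreover have "card (M - {(g1, h1), (g1, h2)}) = card M - 2"
      using F h(3) finM by (subst card_Diff_subset) (auto simp: F_def)
    ultimately show False using m cM M_def by simp
  qed
  then obtain h g where hg: "h \<in> {h1, h2}" "g \<in> {g1, g2}" "E h g" by blast
  have notM: "E t s" if "(s, t) \<notin> M" "s \<in> S" "t \<in> Y" for s t
    using that sym by (auto simp: M_def miss_def)
  \<comment> \<open>Since \<open>h\<close> and \<open>g\<close> miss nothing, each of the other two
    vertices belongs to an adjacent pair as well.\<close>
  have hS: "E h s" if "s \<in> S" for s using notM[of s h] sl[OF hg, of "(s, h)"] that hg h by auto
  have gY: "E t g" if "t \<in> Y" for t using notM[of g t] sl[OF hg, of "(g, t)"] that hg g by auto
  have full: "e \<notin> M" if "fst e \<in> {g1, g2} \<or> snd e \<in> {h1, h2}" for e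
    using sl[OF hg(1) _ hS, of "fst e" e] sl[OF _ hg(2) gY, of "snd e" e] that assms by auto
  then have sub: "M \<subseteq> (S - {g1, g2}) \<times> (Y - {h1, h2})" by (fastforce simp: M_def miss_def)
  have edge: "E u v" "E v u" if "u \<in> S" "v \<in> Y" "u \<in> {g1, g2} \<or> v \<in> {h1, h2}" for u v
    using notM[of u v] full[of "(u, v)"] that sym by auto
  have cM: "card M + 3 = l"
  proof -
    have "l \<le> card (miss (S - {g1}) (Y - {h1})) + 3"
      by (rule short_link[of h1 h2 g1 g2]) (use assms edge in auto)
    moreover have "card (miss (S - {g1}) (Y - {h1})) \<le> card M"
      using finM by (intro card_mono) (auto simp: M_def miss_def)
    ultimately show ?thesis using m M_def by simp
  qed
  \<comment> \<open>A detour over an edge touching two missing edges would leave only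
    \<open>l - 5\<close> of them.\<close>
  have ll: False if "E a b" "a \<in> S - {g1, g2}" "b \<in> Y - {h1, h2}" and e: "e1 \<in> M" "e2 \<in> M" "e1 \<noteq> e2"
    "fst e1 = a \<or> snd e1 = b" "fst e2 = a \<or> snd e2 = b" for a b e1 e2
  proof -
    have "card {e1, e2} \<le> card M" using e finM by (intro card_mono) auto
    then have "5 \<le> l" using e(3) cM by simp
    then have "l \<le> card (miss (S - {a, g1}) (Y - {b, h1})) + 4"
      by (intro long_link[of h1 h2 g1 g2]) (use assms that edge in auto)
    moreover have "miss (S - {a, g1}) (Y - {b, h1}) \<subseteq> M - {e1, e2}"
      using e by (auto simp: M_def miss_def)
    then have "card (miss (S - {a, g1}) (Y - {b, h1})) \<le> card (M - {e1, e2})"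
      using finM by (intro card_mono) auto
    moreover have "card (M - {e1, e2}) = card M - 2"
      using e finM by (subst card_Diff_subset) auto
    ultimately show False using cM \<open>card {e1, e2} \<le> card M\<close> e(3) by simp
  qed
  \<comment> \<open>If two missing edges are disjoint, both cross pairs are missing by
    \<open>ll\<close>. Then \<open>a\<close> has a neighbour \<open>d\<close> other than
    \<open>h1\<close>, \<open>h2\<close>, as otherwise its \<open>l - 3\<close> missing edges would
    be all of them; but that edge touches two missing edges.\<close>
  have meet: "a = a' \<or> b = b'" if e: "(a, b) \<in> M" "(a', b') \<in> M" for a b a' b'
  proof (rule ccontr)
    assume n: "\<not> ?thesis"
    have 1: "(a, b') \<in> M"
      using ll[of a b' "(a, b)" "(a', b')"] e n sub by (auto simp: M_def miss_def)
    have 2: "(a', b) \<in> M"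
      using ll[of a' b "(a, b)" "(a', b')"] e n sub by (auto simp: M_def miss_def)
    have "\<exists>d \<in> Y - {h1, h2}. E a d"
    proof (rule ccontr)
      assume no: "\<not> ?thesis"
      have "Pair a ` (Y - {h1, h2}) \<subseteq> M - {(a', b)}" using no e n by (auto simp: M_def miss_def)
      then have "card (Pair a ` (Y - {h1, h2})) \<le> card (M - {(a', b)})" using finM by (intro card_mono) auto
      moreover have "card (M - {(a', b)}) < card M" using 2 finM by (intro card_Diff1_less)
      moreover have "card (Pair a ` (Y - {h1, h2})) = l - 3"
        using h cY finite_SY by (simp add: card_image inj_on_def card_Diff_subset)
      ultimately show False using cM by simp
    qed
    then obtain d where "d \<in> Y - {h1, h2}" "E a d" by blast
    then show False using ll[of a d "(a, b)" "(a, b')"] e 1 n sub by auto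
  qed
  have "(\<exists>a\<in>S. M \<subseteq> {a} \<times> (Y - {h1, h2})) \<or> (\<exists>b\<in>Y. M \<subseteq> (S - {g1, g2}) \<times> {b})"
  proof -
    have "M \<noteq> {}" using cM l4 by auto
    then obtain a b where ab: "(a, b) \<in> M" by auto
    have abS: "a \<in> S" "b \<in> Y" using ab by (auto simp: M_def miss_def)
    show ?thesis
    proof (cases "\<exists>b'. (a, b') \<in> M \<and> b' \<noteq> b")
      case True
      then obtain b' where b': "(a, b') \<in> M" "b' \<noteq> b" by blast
      have "c = a" if "(c, d) \<in> M" for c d using meet[OF that ab] meet[OF that b'(1)] b'(2) by auto
      then show ?thesis using sub abS by blast
    next
      case False
      have "d = b" if "(c, d) \<in> M" for c d using meet[OF that ab] False that by auto
      then show ?thesis using sub abS by blast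
    qed
  qed
  moreover have "M = {a} \<times> (Y - {h1, h2})" if "M \<subseteq> {a} \<times> (Y - {h1, h2})" for a
    using that h cY finite_SY cM by (intro card_subset_eq) (auto simp: card_cartesian_product card_Diff_subset)
  moreover have "M = (S - {g1, g2}) \<times> {b}" if "M \<subseteq> (S - {g1, g2}) \<times> {b}" for b
    using that g cS finite_SY cM by (intro card_subset_eq) (auto simp: card_cartesian_product card_Diff_subset)
  ultimately have "(\<exists>a\<in>S. M = {a} \<times> (Y - {h1, h2})) \<or> (\<exists>b\<in>Y. M = (S - {g1, g2}) \<times> {b})" by meson
  then show ?thesis using sub M_def by simp
qed

end

text \<open>The centre \<open>a\<close> of the star becomes an added vertex of the extremal graph,
  attached to \<open>U\<close>, and with \<open>x\<close> it supplies the two witnesses for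
  \<open>ext\<close>. The premise \<open>only\<close> comes from \<open>star_structure\<close>,
  applied to all outside vertices with two neighbours in \<open>Y\<close>.\<close>

lemma star_shape:
  assumes S: "S \<subseteq> A" and Y: "Y \<subseteq> B" and c: "card S = l - 1" and a: "a \<in> S"
    and U: "U = {h1, h2}" "h1 \<noteq> h2" "U \<subseteq> Y" and M: "miss S Y = {a} \<times> (Y - U)"
    and x: "x \<in> A - S" "E x h1" "E x h2"
    and only: "\<And>x' h h'. x' \<in> A - S \<Longrightarrow> h \<in> Y \<Longrightarrow> h' \<in> Y \<Longrightarrow> h \<noteq> h' \<Longrightarrow> E x' h \<Longrightarrow> E x' h'
      \<Longrightarrow> miss S Y \<subseteq> S \<times> (Y - {h, h'})"
  shows "shape (l - 2) S Y (S - {a}) U \<and> ext S Y (S - {a}) U"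
proof -
  have finS: "finite S" using S finA finite_subset by auto
  have full: "E u v" if "u \<in> S" "v \<in> Y" "u \<noteq> a \<or> v \<in> U" for u v
  proof (rule ccontr)
    assume "\<not> E u v"
    then have "(u, v) \<in> miss S Y" using that by (auto simp: miss_def)
    then show False using M that by auto
  qed
  have nE: "\<not> E a v" if "v \<in> Y" "v \<notin> U" for v
  proof -
    have "(a, v) \<in> miss S Y" using that M by auto
    then show ?thesis by (simp add: miss_def)
  qed
  have "shape (l - 2) S Y (S - {a}) U"
    unfolding shape_def nb_def using full nE U a c finS by auto
  moreover have "nb Y x' = U \<or> card (nb Y x') \<le> 1" if x': "x' \<in> A - S" for x'
  proof (cases "card (nb Y x') \<le> 1")
    case False
    have in_U: "{h, h'} = U" if "h \<in> nb Y x'" "h' \<in> nb Y x'" "h \<noteq> h'" for h h'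
    proof -
      have hh: "h \<in> Y" "h' \<in> Y" "E x' h" "E x' h'" using that by (auto simp: nb_def)
      have "{a} \<times> (Y - U) \<subseteq> S \<times> (Y - {h, h'})" using only[OF x' hh(1,2) that(3) hh(3,4)] M by simp
      then have "{h, h'} \<subseteq> U" using hh by blast
      then show ?thesis using U that(3) by auto
    qed
    obtain h where "h \<in> nb Y x'" using False by (metis card.empty equals0I zero_le_one)
    moreover obtain h' where "h' \<in> nb Y x'" "h' \<noteq> h" by (rule exists_other[of "nb Y x'" h]) (use False in auto)
    ultimately have "U \<subseteq> nb Y x'" using in_U[of h h'] by auto
    moreover have "nb Y x' \<subseteq> U"
    proof
      fix k assume k: "k \<in> nb Y x'"
      obtain k' where "k' \<in> nb Y x'" "k' \<noteq> k" by (rule exists_other[of "nb Y x'" k]) (use False in auto)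
      then show "k \<in> U" using in_U[of k k'] k by auto
    qed
    ultimately show ?thesis by blast
  qed simp
  moreover have "\<exists>x1\<in>A - (S - {a}). \<exists>x2\<in>A - (S - {a}). x1 \<noteq> x2 \<and> (\<forall>u\<in>U. E x1 u \<and> E x2 u)"
  proof (intro bexI conjI ballI)
    show "E a u" if "u \<in> U" for u using full[OF a] that U by auto
    show "E x u" if "u \<in> U" for u using x that U by auto
    show "a \<noteq> x" using a x by auto
  qed (use a S x in auto)
  ultimately show ?thesis unfolding ext_def by blast
qed

lemma near_complete_shape:
  assumes S: "S \<subseteq> A" and Y: "Y \<subseteq> B" and cS: "card S = l - 1" and cY: "card Y = l - 1"
    and m: "card (miss S Y) + 3 \<le> l"
  shows "(\<exists>C U. shape (l - 2) S Y C U \<and> ext S Y C U) \<or> (\<exists>C U. shape (l - 2) Y S C U \<and> bip_graph.ext B E Y S C U)"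
proof -
  interpret sw: no_long B A E l by (rule swapped)
  have fin: "finite S" "finite Y" using S Y finA finB finite_subset by auto
  have m': "card (miss Y S) + 3 \<le> l" using m card_miss_swap by simp
  have "A - S \<noteq> {}" using cardA cS l4 fin card_mono[of S A] by auto
  then obtain x where x: "x \<in> A - S" by blast
  have "B - Y \<noteq> {}" using cardB cY l4 fin card_mono[of Y B] by auto
  then obtain z where z: "z \<in> B - Y" by blast
  obtain h1 h2 where h: "h1 \<in> Y" "h2 \<in> Y" "h1 \<noteq> h2" "E x h1" "E x h2"
    using outside_adjacent[OF S Y cS cY m x] by blast
  obtain g1 g2 where g: "g1 \<in> S" "g2 \<in> S" "g1 \<noteq> g2" "E z g1" "E z g2"
    using sw.outside_adjacent[OF Y S cY cS m' z] by blast
  note star = star_structure[OF S Y cS cY m]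
  consider a where "a \<in> S" "miss S Y = {a} \<times> (Y - {h1, h2})" | b where "b \<in> Y" "miss S Y = (S - {g1, g2}) \<times> {b}"
    using star[OF x z h g] by blast
  then show ?thesis
  proof cases
    case (1 a)
    have "shape (l - 2) S Y (S - {a}) {h1, h2} \<and> ext S Y (S - {a}) {h1, h2}"
    proof (rule star_shape[OF S Y cS 1(1) refl h(3) _ 1(2) x h(4,5)])
      show "miss S Y \<subseteq> S \<times> (Y - {h, h'})"
        if "x' \<in> A - S" "h \<in> Y" "h' \<in> Y" "h \<noteq> h'" "E x' h" "E x' h'" for x' h h'
        using star[OF that(1) z that(2-) g] by blast
    qed (use h in auto)
    then show ?thesis by blast
  next
    case (2 b)
    have M: "miss Y S = {b} \<times> (S - {g1, g2})" using 2(2) miss_swap[of Y S] by auto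
    have "shape (l - 2) Y S (Y - {b}) {g1, g2} \<and> sw.ext Y S (Y - {b}) {g1, g2}"
    proof (rule sw.star_shape[OF Y S cY 2(1) refl g(3) _ M z g(4,5)])
      show "miss Y S \<subseteq> Y \<times> (S - {h, h'})"
        if "x' \<in> B - Y" "h \<in> S" "h' \<in> S" "h \<noteq> h'" "E x' h" "E x' h'" for x' h h'
        using star[OF x that(1) h that(2-)] miss_swap[of Y S] by auto
    qed (use g in auto)
    then show ?thesis by blast
  qed
qed

end

section \<open>Paths in complete bipartite graphs, and edge counts\<close>

context bip_graph begin

lemma complete_path:
  assumes fin: "finite C" "finite D" and CD: "C \<inter> D = {}" and full: "\<And>c d. c \<in> C \<Longrightarrow> d \<in> D \<Longrightarrow> E c d"
    and card: "card C \<le> card D" and d: "d \<in> D" and c: "c \<in> C"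
  shows "\<exists>p. gpath E p \<and> hd p = d \<and> last p = c \<and> set p \<subseteq> C \<union> D \<and> C \<subseteq> set p"
proof -
  have "0 < card C" using c fin by (auto simp: card_gt_0_iff)
  then have "card C - 1 \<le> card (D - {d})" using card d fin by simp
  then obtain D0 where D0: "D0 \<subseteq> D - {d}" "card D0 = card C - 1" "finite D0"
    by (meson obtain_subset_with_card_n)
  define D' where "D' = insert d D0"
  have D': "D' \<subseteq> D" "card D' = card C" "finite D'" "d \<in> D'"
    using D0 d \<open>0 < card C\<close> by (auto simp: D'_def card_insert_if)
  have "miss D' C = {}" using full D' sym by (auto simp: miss_def)
  then have "\<exists>p. gpath E p \<and> hd p = d \<and> last p = c \<and> set p = D' \<union> C"
    using D' fin CD c \<open>0 < card C\<close> by (intro ham_path[of D' C "card C"]) auto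
  then show ?thesis using D'(1) by blast
qed

lemma complete_path_same_side:
  assumes fin: "finite C" "finite D" and CD: "C \<inter> D = {}" and full: "\<And>c d. c \<in> C \<Longrightarrow> d \<in> D \<Longrightarrow> E c d"
    and card: "card C < card D" "C \<noteq> {}" and d: "d1 \<in> D" "d2 \<in> D" "d1 \<noteq> d2"
  shows "\<exists>p. gpath E p \<and> hd p = d1 \<and> last p = d2 \<and> set p \<subseteq> C \<union> D \<and> C \<subseteq> set p"
proof -
  obtain c where c: "c \<in> C" using card by blast
  have "\<exists>p. gpath E p \<and> hd p = d1 \<and> last p = c \<and> set p \<subseteq> C \<union> (D - {d2}) \<and> C \<subseteq> set p"
    by (rule complete_path) (use assms c in auto)
  then obtain p where p: "gpath E p" "hd p = d1" "last p = c" "set p \<subseteq> C \<union> (D - {d2})" "C \<subseteq> set p" by blast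
  have "d2 \<notin> set p" using p(4) d CD by auto
  then have "gpath E (p @ [d2])" using p full[OF c d(2)] gpath_ne[OF p(1)] by (auto simp: gpath_append)
  moreover have "hd (p @ [d2]) = d1" using p(2) gpath_ne[OF p(1)] by simp
  moreover have "set (p @ [d2]) \<subseteq> C \<union> D" "C \<subseteq> set (p @ [d2])" using p(4,5) d(2) by auto
  ultimately show ?thesis by (intro exI[of _ "p @ [d2]"]) simp
qed

definition ed :: "'a set \<Rightarrow> 'a set \<Rightarrow> nat" where
  "ed S Y = card {(x, y). x \<in> S \<and> y \<in> Y \<and> E x y}"

lemma ed_sum: "finite S \<Longrightarrow> finite Y \<Longrightarrow> ed S Y = (\<Sum>x\<in>S. card (nb Y x))"
proof -
  assume fin: "finite S" "finite Y"
  have "{(x, y). x \<in> S \<and> y \<in> Y \<and> E x y} = Sigma S (nb Y)" by (auto simp: nb_def)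
  moreover have "finite (nb Y x)" for x using fin by (simp add: nb_def)
  ultimately show ?thesis unfolding ed_def using fin by simp
qed

lemma ed_swap: "ed Y S = ed S Y"
proof -
  have "{(x, y). x \<in> Y \<and> y \<in> S \<and> E x y} = prod.swap ` {(x, y). x \<in> S \<and> y \<in> Y \<and> E x y}"
    using sym by (auto simp: image_iff)
  moreover have "card (prod.swap ` {(x, y). x \<in> S \<and> y \<in> Y \<and> E x y}) = card {(x, y). x \<in> S \<and> y \<in> Y \<and> E x y}"
    by (rule card_image) (auto intro!: inj_onI)
  ultimately show ?thesis unfolding ed_def by simp
qed

lemma ed_insert: "finite S \<Longrightarrow> finite Y \<Longrightarrow> x \<notin> S \<Longrightarrow> ed (insert x S) Y = ed S Y + card (nb Y x)"
  by (simp add: ed_sum)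

lemma ed_insert': "finite S \<Longrightarrow> finite Y \<Longrightarrow> y \<notin> Y \<Longrightarrow> ed S (insert y Y) = ed S Y + card (nb S y)"
  using ed_insert[of Y S y] ed_swap[of S] by simp

lemma ed_miss: "finite S \<Longrightarrow> finite Y \<Longrightarrow> ed S Y + card (miss S Y) = card S * card Y"
proof -
  assume fin: "finite S" "finite Y"
  have "S \<times> Y = {(x, y). x \<in> S \<and> y \<in> Y \<and> E x y} \<union> miss S Y" by (auto simp: miss_def)
  moreover have "finite {(x, y). x \<in> S \<and> y \<in> Y \<and> E x y}"
    by (rule finite_subset[of _ "S \<times> Y"]) (use fin in auto)
  ultimately have "card (S \<times> Y) = ed S Y + card (miss S Y)"
    unfolding ed_def using finite_miss[OF fin] by (simp add: card_Un_disjoint miss_def disjoint_iff)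
  then show ?thesis by (simp add: card_cartesian_product)
qed

lemma shape_ed:
  assumes "shape k S Y C U" "finite S" "finite Y"
  shows "ed S Y = k * card Y + 2 * (card S - k)"
proof -
  have C: "C \<subseteq> S" "card C = k" "card U = 2" "\<forall>c\<in>C. nb Y c = Y" "\<forall>x\<in>S - C. nb Y x = U"
    using assms(1) by (auto simp: shape_def)
  have "ed S Y = (\<Sum>x\<in>C. card (nb Y x)) + (\<Sum>x\<in>S - C. card (nb Y x))"
    unfolding ed_sum[OF assms(2,3)] using C(1) assms(2) by (metis add.commute sum.subset_diff)
  also have "\<dots> = k * card Y + 2 * card (S - C)" using C by simp
  also have "card (S - C) = card S - k" using C assms(2) by (metis card_Diff_subset finite_subset)
  finally show ?thesis .
qed

end

context no_long begin

text \<open>A minimal set \<open>Z\<close> with at most \<open>card Z\<close> neighbours has a perfect matching and is connected,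
  so that it must be the whole of a complete bipartite graph with classes of size \<open>l - 1\<close>.\<close>

lemma no_heavy_side:
  assumes S: "S \<subseteq> A" and Y: "Y \<subseteq> B" "Y \<noteq> {}" and c: "card S \<le> card Y"
    and deg: "\<And>y. y \<in> Y \<Longrightarrow> l - 1 \<le> card (nb S y)"
  shows False
proof -
  have fin: "finite S" "finite Y" using S Y finA finB finite_subset by auto
  define P where "P = (\<lambda>Z. Z \<subseteq> Y \<and> Z \<noteq> {} \<and> card (nbs S Z) \<le> card Z)"
  have "card (nbs S Y) \<le> card S" using fin by (intro card_mono) (auto simp: nbs_def)
  then have "P Y" using c Y P_def by auto
  then obtain Z where Z: "P Z" and minc: "\<And>Z'. P Z' \<Longrightarrow> card Z \<le> card Z'" using ex_has_least_nat[of P Y card] by blast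
  have ZY: "Z \<subseteq> Y" "Z \<noteq> {}" "card (nbs S Z) \<le> card Z" "finite Z" using Z P_def fin finite_subset by auto
  have min: "card Z' < card (nbs S Z')" if "Z' \<subset> Z" "Z' \<noteq> {}" for Z'
  proof (rule ccontr)
    assume "\<not> ?thesis"
    then have "P Z'" using that ZY P_def by auto
    then show False using minc[of Z'] psubset_card_mono[OF ZY(4) that(1)] by simp
  qed
  define T where "T = nbs S Z"
  have finT: "finite T" "T \<subseteq> S" using fin by (auto simp: T_def nbs_def)
  have nbT: "nb T y = nb S y" if "y \<in> Z" for y using that by (auto simp: nb_def T_def nbs_def)
  have cT3: "l - 1 \<le> card T"
  proof -
    obtain y where "y \<in> Z" using ZY by blast
    then have "l - 1 \<le> card (nb T y)" using nbT deg ZY by auto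
    also have "\<dots> \<le> card T" using finT by (intro card_mono) (auto simp: nb_def)
    finally show ?thesis .
  qed
  \<comment> \<open>By minimality, removing one vertex of \<open>Z\<close> loses no neighbour. Hence
    every vertex of \<open>T\<close> has two neighbours in \<open>Z\<close>, which lifts the degree
    sum from \<open>l - 1\<close> to \<open>l + 1\<close>.\<close>
  have rem: "nbs S (Z - {y}) = T" "card T = card Z" if y: "y \<in> Z" for y
  proof -
    have "Z - {y} \<noteq> {}"
    proof
      assume "Z - {y} = {}"
      then have "card Z \<le> 1" using card_mono[of "{y}" Z] by auto
      then show False using ZY(3) cT3 l4 T_def by simp
    qed
    moreover have "Z - {y} \<subset> Z" using y by auto
    ultimately have "card (Z - {y}) < card (nbs S (Z - {y}))" using min by blast
    then have "card Z \<le> card (nbs S (Z - {y}))" using y ZY(4) by simp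
    moreover have s: "nbs S (Z - {y}) \<subseteq> T" unfolding T_def by (rule nbs_mono) auto
    moreover have "card (nbs S (Z - {y})) \<le> card T" using s finT by (intro card_mono)
    ultimately show "nbs S (Z - {y}) = T" "card T = card Z" using ZY(3) finT card_subset_eq[of T "nbs S (Z - {y})"] T_def by auto
  qed
  have cTZ: "card T = card Z" using rem ZY by blast
  have "pm Z T"
  proof (rule pm_hall)
    show "card X \<le> card (nbs T X)" if "X \<subseteq> Z" for X
    proof -
      have "nbs T X = nbs S X" using that by (auto simp: T_def nbs_def)
      moreover have "card X \<le> card (nbs S X)"
      proof (cases "X = {} \<or> X = Z")
        case True
        then show ?thesis using cTZ T_def by auto
      next
        case False
        then have "X \<subset> Z" "X \<noteq> {}" using that by auto
        then show ?thesis using min[of X] by simp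
      qed
      ultimately show ?thesis by simp
    qed
  qed (use ZY finT cTZ in auto)
  then have pm: "pm T Z" by (rule pm_sym)
  have degT: "2 \<le> card (nb Z x)" if x: "x \<in> T" for x
  proof -
    obtain y where y: "y \<in> Z" "E y x" using x by (auto simp: T_def nbs_def)
    have "x \<in> nbs S (Z - {y})" using rem(1)[OF y(1)] x by simp
    then obtain y' where y': "y' \<in> Z" "y' \<noteq> y" "E y' x" by (auto simp: nbs_def)
    have "card {y, y'} \<le> card (nb Z x)" using y y' sym ZY by (intro card_mono) (auto simp: nb_def)
    then show ?thesis using y' by simp
  qed
  have TA: "T \<subseteq> A" "T \<noteq> {}" "Z \<subseteq> B" using finT S ZY Y cT3 l4 by auto
  obtain S' Y' where SY': "S' \<subseteq> T" "Y' \<subseteq> Z" "S' \<noteq> {}" "card S' = card Y'" "card S' < l"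
    "\<And>y. y \<in> Y' \<Longrightarrow> nb T y \<subseteq> S'"
  proof (rule pm_component[OF TA(1,2,3) pm])
    show "l + 1 \<le> card (nb Z x) + card (nb T y)" if "x \<in> T" "y \<in> Z" for x y
      using degT[OF that(1)] deg[of y] nbT[OF that(2)] ZY that(2) by auto
  qed (use that in blast)
  have finS': "finite S'" by (rule finite_subset[OF SY'(1) finT(1)])
  have "nbs S Y' \<subseteq> S'"
  proof
    fix s assume "s \<in> nbs S Y'"
    then obtain y where y: "y \<in> Y'" "s \<in> S" "E y s" by (auto simp: nbs_def)
    then have "s \<in> nb S y" by (simp add: nb_def)
    then show "s \<in> S'" using SY'(6)[OF y(1)] nbT[of y] y SY'(2) by auto
  qed
  then have le: "card (nbs S Y') \<le> card Y'" using SY'(4) card_mono[OF finS'] by metis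
  have "Y' \<noteq> {}" using SY'(3,4) finS' by auto
  have "Y' = Z"
  proof (rule ccontr)
    assume "Y' \<noteq> Z"
    then have "card Y' < card (nbs S Y')" using min SY'(2) \<open>Y' \<noteq> {}\<close> by blast
    then show False using le by simp
  qed
  then have cZ: "card Z = l - 1" "card T = l - 1" using SY'(4,5) cT3 cTZ by auto
  have "nb T y = T" if "y \<in> Z" for y
  proof (rule card_subset_eq[OF finT(1)])
    show "nb T y \<subseteq> T" by (auto simp: nb_def)
    then have "card (nb T y) \<le> card T" using finT(1) by (rule card_mono[rotated])
    moreover have "l - 1 \<le> card (nb T y)" using deg[of y] nbT[OF that] that ZY by auto
    ultimately show "card (nb T y) = card T" using cZ by simp
  qed
  then have "E t y" if "t \<in> T" "y \<in> Z" for t y using that sym by (auto simp: nb_def)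
  then have m0: "miss T Z = {}" "miss Z T = {}" using sym by (auto simp: miss_def)
  \<comment> \<open>No edge is missing here, whereas either shape would leave out
    \<open>l - 3\<close> of them.\<close>
  consider C U where "shape (l - 2) T Z C U" | C U where "shape (l - 2) Z T C U"
    using near_complete_shape[OF TA(1,3) cZ(2,1)] m0 l4 by auto
  then show False
  proof cases
    case 1
    have "ed T Z = (l - 2) * (l - 1) + 2 * (l - 1 - (l - 2))" using shape_ed[OF 1 finT(1) ZY(4)] cZ by simp
    moreover have "ed T Z = (l - 1) * (l - 1)" using ed_miss[OF finT(1) ZY(4)] m0 cZ by simp
    moreover have "l - 1 = Suc (l - 2)" "2 \<le> l - 2" using l4 by auto
    ultimately show False by simp
  next
    case 2
    have "ed Z T = (l - 2) * (l - 1) + 2 * (l - 1 - (l - 2))" using shape_ed[OF 2 ZY(4) finT(1)] cZ by simp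
    moreover have "ed Z T = (l - 1) * (l - 1)" using ed_miss[OF ZY(4) finT(1)] m0 cZ by simp
    moreover have "l - 1 = Suc (l - 2)" "2 \<le> l - 2" using l4 by auto
    ultimately show False by simp
  qed
qed

section \<open>Cycles through a complete bipartite frame\<close>

context
  fixes C D u1 u2
  assumes C: "C \<subseteq> A" "card C = l - 2" and D: "D \<subseteq> B" "l - 1 \<le> card D"
    and u: "u1 \<in> D" "u2 \<in> D" "u1 \<noteq> u2" and full: "\<And>c d. c \<in> C \<Longrightarrow> d \<in> D \<Longrightarrow> E c d"
begin

lemma frame_finite: "finite C" "finite D" "C \<inter> D = {}" "C \<noteq> {}"
  using C D finA finB disj finite_subset l4 by auto

text \<open>Each lemma below supplies a path \<open>r\<close> through two vertices outside
  \<open>C\<close>, closed up by a path \<open>p\<close> in the frame; with \<open>C\<close> this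
  makes \<open>l\<close> vertices of \<open>A\<close>.\<close>

lemma frame_cycle_False:
  assumes "gpath E p" "gpath E r" "set p \<inter> set r = {}" "E (last p) (hd r)" "E (last r) (hd p)"
    "C \<subseteq> set p \<union> set r" "x \<in> set r \<inter> A - C" "w \<in> set r \<inter> A - C" "x \<noteq> w" "3 \<le> length r"
  shows False
proof -
  have "gcycle E (p @ r)" by (rule gcycle_append) (use assms in auto)
  moreover have "insert x (insert w C) \<subseteq> set (p @ r) \<inter> A" using assms C by auto
  moreover have "card (insert x (insert w C)) = l" using assms frame_finite C l4 by (auto simp: card_insert_if)
  ultimately show False using no_cycle_A by (metis order_refl)
qed

text \<open>From \<open>u2\<close> the cycle returns to \<open>u1\<close> over \<open>x'\<close>,
  \<open>y\<close>, \<open>x\<close>.\<close>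

lemma frame_right_two_outside:
  assumes "y \<in> B - D" "x \<in> A - C" "x' \<in> A - C" "x \<noteq> x'" "E x u1" "E x' u2" "E y x" "E y x'"
  shows False
proof -
  have "\<exists>p. gpath E p \<and> hd p = u1 \<and> last p = u2 \<and> set p \<subseteq> C \<union> D \<and> C \<subseteq> set p"
    by (rule complete_path_same_side) (use frame_finite C D u full l4 in auto)
  then obtain p where p: "gpath E p" "hd p = u1" "last p = u2" "set p \<subseteq> C \<union> D" "C \<subseteq> set p" by blast
  have n: "x \<notin> D" "x' \<notin> D" "y \<notin> C" "y \<noteq> x" "y \<noteq> x'" using assms C D disj by auto
  show False
    by (rule frame_cycle_False[OF p(1), of "[x', y, x]" x x'])
      (use assms n sym p in \<open>auto simp: gpath_Cons\<close>)
qed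

text \<open>From \<open>a\<close> the cycle returns to \<open>u2\<close> over \<open>y\<close>,
  \<open>x\<close>, \<open>u1\<close>, \<open>w\<close>; the frame path spares \<open>u1\<close> for
  this.\<close>

lemma frame_right_mixed:
  assumes "y \<in> B - D" "x \<in> A - C" "w \<in> A - C" "x \<noteq> w" "a \<in> C" "E y a" "E y x" "E x u1" "E w u1" "E w u2"
  shows False
proof -
  have "\<exists>p. gpath E p \<and> hd p = u2 \<and> last p = a \<and> set p \<subseteq> C \<union> (D - {u1}) \<and> C \<subseteq> set p"
    by (rule complete_path) (use frame_finite C D u full assms in auto)
  then obtain p where p: "gpath E p" "hd p = u2" "last p = a" "set p \<subseteq> C \<union> (D - {u1})" "C \<subseteq> set p" by blast
  have n: "x \<notin> D" "w \<notin> D" "y \<notin> C" "y \<noteq> x" "y \<noteq> w" "u1 \<notin> C" "u1 \<noteq> x" "u1 \<noteq> w" "y \<noteq> u1" using assms C D u frame_finite disj by auto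
  show False
    by (rule frame_cycle_False[OF p(1), of "[y, x, u1, w]" x w])
      (use assms n sym p in \<open>auto simp: gpath_Cons\<close>)
qed

text \<open>From \<open>b\<close> the cycle returns to \<open>u2\<close> over \<open>x\<close>,
  \<open>u1\<close>, \<open>w\<close>. The frame path has both ends in \<open>D - {u1}\<close>,
  which must be larger than \<open>C\<close>, hence \<open>l \<le> card D\<close>.\<close>

lemma frame_left_one_hub:
  assumes "x \<in> A - C" "w \<in> A - C" "x \<noteq> w" "b \<in> D - {u1, u2}" "E x u1" "E x b" "E w u1" "E w u2" "l \<le> card D"
  shows False
proof -
  have "\<exists>p. gpath E p \<and> hd p = u2 \<and> last p = b \<and> set p \<subseteq> C \<union> (D - {u1}) \<and> C \<subseteq> set p"
    by (rule complete_path_same_side) (use frame_finite C D u full assms l4 in auto)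
  then obtain p where p: "gpath E p" "hd p = u2" "last p = b" "set p \<subseteq> C \<union> (D - {u1})" "C \<subseteq> set p" by blast
  have n: "x \<notin> D" "w \<notin> D" "u1 \<notin> C" "u1 \<noteq> x" "u1 \<noteq> w" using assms C D u frame_finite disj by auto
  show False
    by (rule frame_cycle_False[OF p(1), of "[x, u1, w]" x w])
      (use assms n sym p in \<open>auto simp: gpath_Cons\<close>)
qed

text \<open>From \<open>b\<close> the cycle returns to \<open>u2\<close> over \<open>x\<close>,
  \<open>b'\<close>, \<open>c\<close>, \<open>u1\<close>, \<open>w\<close>, where \<open>c\<close>
  is withheld from the frame path to lead from \<open>b'\<close> to a hub.\<close>

lemma frame_left_no_hub:
  assumes "x \<in> A - C" "w \<in> A - C" "x \<noteq> w" "b \<in> D - {u1, u2}" "b' \<in> D - {u1, u2}" "b \<noteq> b'" "E x b" "E x b'"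
    "E w u1" "E w u2" "l \<le> card D"
  shows False
proof -
  obtain c where c: "c \<in> C" using frame_finite by auto
  have cc: "card (C - {c}) = l - 3" using c frame_finite C by simp
  have cd: "card (D - {b', u1}) = card D - 2" using assms u frame_finite by (subst card_Diff_subset) auto
  have "\<exists>p. gpath E p \<and> hd p = u2 \<and> last p = b \<and> set p \<subseteq> (C - {c}) \<union> (D - {b', u1}) \<and> C - {c} \<subseteq> set p"
  proof (rule complete_path_same_side)
    show "C - {c} \<noteq> {}" 
    proof -
      have "0 < card (C - {c})" using cc l4 by simp
      then show ?thesis by (metis card.empty less_numeral_extra(3))
    qed
  qed (use frame_finite D u full assms l4 cc cd in auto)
  then obtain p where p: "gpath E p" "hd p = u2" "last p = b" "set p \<subseteq> (C - {c}) \<union> (D - {b', u1})" "C - {c} \<subseteq> set p" by blast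
  have n: "x \<notin> D" "w \<notin> D" "u1 \<notin> C" "u1 \<noteq> x" "u1 \<noteq> w" "c \<notin> D" "b' \<notin> C" "x \<noteq> b'" "w \<noteq> b'" "x \<noteq> c" "w \<noteq> c" "c \<noteq> u1" "c \<noteq> b'"
    using assms C D u c frame_finite disj by auto
  have "E b' c" "E c u1" using full c u assms sym by auto
  then show False
    by (intro frame_cycle_False[OF p(1), of "[x, b', c, u1, w]" x w])
      (use assms n sym p c in \<open>auto simp: gpath_Cons\<close>)
qed

text \<open>From \<open>a\<close> the cycle returns to \<open>u2\<close> over \<open>y\<close>,
  \<open>x\<close>, \<open>b\<close>, \<open>c\<close>, \<open>u1\<close>, \<open>w\<close>, again
  with \<open>c\<close> withheld.\<close>

lemma frame_new_edge:
  assumes "y \<in> B - D" "x \<in> A - C" "w \<in> A - C" "x \<noteq> w" "b \<in> D - {u1, u2}" "a \<in> C" "E y a" "E y x" "E x b"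
    "E w u1" "E w u2"
  shows False
proof -
  have "2 \<le> card C" using C l4 by simp
  then obtain c where c: "c \<in> C" "c \<noteq> a" by (rule exists_other)
  have cc: "card (C - {c}) = l - 3" using c frame_finite C by simp
  have cd: "card (D - {b, u1}) = card D - 2" using assms u frame_finite by (subst card_Diff_subset) auto
  have "\<exists>p. gpath E p \<and> hd p = u2 \<and> last p = a \<and> set p \<subseteq> (C - {c}) \<union> (D - {b, u1}) \<and> C - {c} \<subseteq> set p"
    by (rule complete_path) (use frame_finite D u c full assms l4 cc cd in auto)
  then obtain p where p: "gpath E p" "hd p = u2" "last p = a" "set p \<subseteq> (C - {c}) \<union> (D - {b, u1})" "C - {c} \<subseteq> set p" by blast
  have n: "x \<notin> D" "w \<notin> D" "y \<notin> C" "y \<noteq> x" "y \<noteq> w" "y \<noteq> u1" "y \<noteq> b" "y \<noteq> c" "u1 \<notin> C" "u1 \<noteq> x" "u1 \<noteq> w" "c \<notin> D" "b \<notin> C" "x \<noteq> b" "w \<noteq> b" "x \<noteq> c" "w \<noteq> c" "c \<noteq> u1" "c \<noteq> b"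
    using assms C D u c frame_finite disj by auto
  have "E b c" "E c u1" using full c u assms sym by auto
  then show False
    by (intro frame_cycle_False[OF p(1), of "[y, x, b, c, u1, w]" x w])
      (use assms n sym p c in \<open>auto simp: gpath_Cons\<close>)
qed

end

section \<open>Adding vertices to the extremal shape\<close>

lemma shape_frame:
  assumes "S \<subseteq> A" "Y \<subseteq> B" "shape (l - 2) S Y C U"
  obtains u1 u2 where "U = {u1, u2}" "u1 \<noteq> u2" "u1 \<in> Y" "u2 \<in> Y" "C \<subseteq> A" "card C = l - 2"
    "\<forall>c\<in>C. \<forall>d\<in>Y. E c d" "\<forall>x\<in>S. \<forall>u\<in>U. E x u"
proof -
  note sh = assms(3)[unfolded shape_def]
  obtain u1 u2 where "U = {u1, u2}" "u1 \<noteq> u2" using sh by (meson card_2_iff)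
  moreover have full: "E c d" if "c \<in> C" "d \<in> Y" for c d
  proof -
    have "d \<in> nb Y c" using that sh by simp
    then show ?thesis by (simp add: nb_def)
  qed
  moreover have "E x u" if "x \<in> S" "u \<in> U" for x u
  proof (cases "x \<in> C")
    case True
    then show ?thesis using full that sh by auto
  next
    case False
    then have "u \<in> nb Y x" using that sh by simp
    then show ?thesis by (simp add: nb_def)
  qed
  moreover have "u1 \<in> Y" "u2 \<in> Y" "C \<subseteq> A" "card C = l - 2" using calculation sh assms(1) by auto
  ultimately show ?thesis using that[of u1 u2] by metis
qed

text \<open>From class size \<open>l\<close> on, \<open>ext\<close> follows from the shape:
  \<open>S - C\<close> contains two witnesses, and an outside vertex with two neighbours that do not
  form \<open>U\<close> closes a long cycle.\<close>

lemma shape_ext: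
  assumes S: "S \<subseteq> A" and Y: "Y \<subseteq> B" and sh: "shape (l - 2) S Y C U" and c: "l \<le> card S" "l \<le> card Y"
  shows "ext S Y C U"
proof -
  obtain u1 u2 where u: "U = {u1, u2}" "u1 \<noteq> u2" "u1 \<in> Y" "u2 \<in> Y" and C: "C \<subseteq> A" "card C = l - 2"
    and full': "\<forall>c\<in>C. \<forall>d\<in>Y. E c d" and SU': "\<forall>x\<in>S. \<forall>u\<in>U. E x u"
    by (rule shape_frame[OF S Y sh])
  note full = full'[rule_format] and SU = SU'[rule_format]
  have cY: "l - 1 \<le> card Y" using c by simp
  have CS: "C \<subseteq> S" "finite S" using sh S finA finite_subset by (auto simp: shape_def)
  have "card (S - C) = card S - card C" using CS by (meson card_Diff_subset finite_subset)
  then have "2 \<le> card (S - C)" using C c l4 by simp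
  then obtain x1 where x1: "x1 \<in> S - C" by (rule exists_other)
  obtain x2 where x2: "x2 \<in> S - C" "x2 \<noteq> x1" by (rule exists_other[OF \<open>2 \<le> card (S - C)\<close>])
  have "nb Y x = U \<or> card (nb Y x) \<le> 1" if x: "x \<in> A - S" for x
  proof -
    have xw: "x \<in> A - C" "x1 \<in> A - C" "x \<noteq> x1" using x x1 CS S by auto
    have w: "E x1 u1" "E x1 u2" using SU x1 u by auto
    have two: "{b, b'} = U" if b: "b \<in> nb Y x" "b' \<in> nb Y x" "b \<noteq> b'" for b b'
    proof (rule ccontr)
      assume n: "{b, b'} \<noteq> U"
      have bY: "b \<in> Y" "b' \<in> Y" "E x b" "E x b'" using b by (auto simp: nb_def)
      note c1 = frame_left_one_hub[OF C Y cY u(3,4,2) full xw _ _ _ w c(2)]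
      note c1' = frame_left_one_hub[OF C Y cY u(4,3) u(2)[symmetric] full xw _ _ _ w(2,1) c(2)]
      note c2 = frame_left_no_hub[OF C Y cY u(3,4,2) full xw _ _ b(3) _ _ w c(2)]
      show False using c1[of b] c1[of b'] c1'[of b] c1'[of b'] c2 bY b(3) n u(1) by auto
    qed
    show ?thesis
    proof (cases "card (nb Y x) \<le> 1")
      case False
      then have c2: "2 \<le> card (nb Y x)" by simp
      obtain h where h: "h \<in> nb Y x" by (rule exists_other[OF c2])
      obtain h' where h': "h' \<in> nb Y x" "h' \<noteq> h" by (rule exists_other[OF c2])
      have "U \<subseteq> nb Y x" using two[OF h h'(1)] h h' by auto
      moreover have "nb Y x \<subseteq> U"
      proof
        fix k assume k: "k \<in> nb Y x"
        obtain k' where k': "k' \<in> nb Y x" "k' \<noteq> k" by (rule exists_other[OF c2])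
        show "k \<in> U" using two[OF k k'(1)] k' by auto
      qed
      ultimately show ?thesis by blast
    qed simp
  qed
  moreover have "x1 \<in> A - C" "x2 \<in> A - C" using x1 x2 S by auto
  moreover have "\<forall>u\<in>U. E x1 u \<and> E x2 u" using SU x1 x2 by auto
  ultimately show ?thesis unfolding ext_def using x2(2) by blast
qed

text \<open>A neighbour \<open>x\<close> outside \<open>C\<close> and any second neighbour give a
  long cycle. The auxiliary \<open>w\<close> comes from \<open>ext\<close>, whose two witnesses
  ensure that one differs from \<open>x\<close>.\<close>

lemma new_right_vertex:
  assumes S: "S \<subseteq> A" and Y: "Y \<subseteq> B" and sh: "shape (l - 2) S Y C U" and ex: "ext S Y C U" and c: "l - 1 \<le> card Y"
    and y: "y \<in> B - Y"
  shows "nb S y \<subseteq> C \<or> card (nb S y) \<le> 1"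
proof (rule ccontr)
  assume n: "\<not> ?thesis"
  obtain u1 u2 where u: "U = {u1, u2}" "u1 \<noteq> u2" "u1 \<in> Y" "u2 \<in> Y" and C: "C \<subseteq> A" "card C = l - 2"
    and full': "\<forall>c\<in>C. \<forall>d\<in>Y. E c d" and SU': "\<forall>x\<in>S. \<forall>u\<in>U. E x u"
    by (rule shape_frame[OF S Y sh])
  note full = full'[rule_format] and SU = SU'[rule_format]
  obtain x where x: "x \<in> nb S y" "x \<notin> C" using n by blast
  have "2 \<le> card (nb S y)" using n by simp
  then obtain x' where x': "x' \<in> nb S y" "x' \<noteq> x" by (rule exists_other)
  obtain w where w: "w \<in> A - C" "w \<noteq> x" "E w u1" "E w u2" using ex u unfolding ext_def by (metis insertCI)
  have xx: "x \<in> A - C" "E y x" "E y x'" "x \<in> S" "x' \<in> S" using x x' S by (auto simp: nb_def)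
  show False
  proof (cases "x' \<in> C")
    case True
    show False by (rule frame_right_mixed[OF C Y c u(3,4,2) full y xx(1) w(1) w(2)[symmetric] True xx(3,2) _ w(3,4)])
        (use SU xx u in auto)
  next
    case False
    then have x'A: "x' \<in> A - C" using xx S by auto
    show False by (rule frame_right_two_outside[OF C Y c u(3,4,2) full y xx(1) x'A x'(2)[symmetric] _ _ xx(2,3)])
        (use SU xx u in auto)
  qed
qed

lemma shape_extend_right:
  assumes S: "S \<subseteq> A" and Y: "Y \<subseteq> B" and sh: "shape (l - 2) S Y C U" and ex: "ext S Y C U" and c: "l - 1 \<le> card Y"
    and y: "y \<in> B - Y" and d: "l - 2 \<le> card (nb S y)"
  shows "nb S y = C" "shape (l - 2) S (insert y Y) C U"
proof -
  note shd = sh[unfolded shape_def]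
  have finC: "finite C" using shd S finA by (meson finite_subset)
  have sub: "nb S y \<subseteq> C" using new_right_vertex[OF S Y sh ex c y] d l4 by auto
  then show eq: "nb S y = C" using card_seteq[OF finC sub] d shd by simp
  have Ey: "E x y \<longleftrightarrow> x \<in> C" if "x \<in> S" for x
  proof -
    have "x \<in> nb S y \<longleftrightarrow> x \<in> C" using eq by simp
    then show ?thesis using that sym[of x y] sym[of y x] by (auto simp: nb_def)
  qed
  have "nb (insert y Y) x = (if E x y then insert y (nb Y x) else nb Y x)" for x by (auto simp: nb_def)
  then show "shape (l - 2) S (insert y Y) C U" using shd Ey unfolding shape_def by (auto simp: subset_iff)
qed

lemma shape_extend_left:
  assumes S: "S \<subseteq> A" and sh: "shape (l - 2) S Y C U" and ex: "ext S Y C U"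
    and x: "x \<in> A - S" and d: "2 \<le> card (nb Y x)"
  shows "nb Y x = U" "shape (l - 2) (insert x S) Y C U"
proof -
  show eq: "nb Y x = U" using ex x d unfolding ext_def by fastforce
  then show "shape (l - 2) (insert x S) Y C U" using sh x unfolding shape_def by auto
qed

text \<open>Into the old part, \<open>x\<close> has at most 2 and \<open>y\<close> at most
  \<open>l - 2\<close> neighbours. An edge between them would close a frame cycle, so both maxima
  are attained.\<close>

lemma shape_extend_pair:
  assumes S: "S \<subseteq> A" and Y: "Y \<subseteq> B" and sh: "shape (l - 2) S Y C U" and ex: "ext S Y C U" and c: "l - 1 \<le> card Y"
    and x: "x \<in> A - S" and y: "y \<in> B - Y"
    and d: "l \<le> card (nb Y x) + card (nb S y) + (if E x y then 1 else 0)"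
  shows "shape (l - 2) (insert x S) (insert y Y) C U"
proof -
  note shd = sh[unfolded shape_def]
  have finC: "finite C" using shd S finA by (meson finite_subset)
  have cU: "card U = 2" "card C = l - 2" using shd by auto
  have dx: "nb Y x = U \<or> card (nb Y x) \<le> 1" using ex x unfolding ext_def by blast
  have dy: "nb S y \<subseteq> C \<or> card (nb S y) \<le> 1" by (rule new_right_vertex[OF S Y sh ex c y])
  have dx2: "card (nb Y x) \<le> 2" using dx cU by auto
  have dy2: "card (nb S y) \<le> l - 2" using dy cU finC l4 card_mono[of C "nb S y"] by auto
  obtain u1 u2 where u: "U = {u1, u2}" "u1 \<noteq> u2" "u1 \<in> Y" "u2 \<in> Y" and C: "C \<subseteq> A" "card C = l - 2"
    and full': "\<forall>c\<in>C. \<forall>d\<in>Y. E c d" and SU': "\<forall>x\<in>S. \<forall>u\<in>U. E x u"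
    by (rule shape_frame[OF S Y sh])
  note full = full'[rule_format] and SU = SU'[rule_format]
  have CS: "C \<subseteq> S" using shd by auto
  obtain w where w: "w \<in> A - C" "w \<noteq> x" "E w u1" "E w u2" using ex u unfolding ext_def by (metis insertCI)
  have xA: "x \<in> A - C" using x CS by auto
  have nadj: "\<not> E x y"
  proof
    assume xy: "E x y"
    then have sum: "l - 1 \<le> card (nb Y x) + card (nb S y)" using d by simp
    have noC: "a \<notin> C" if a: "a \<in> nb S y" "nb Y x \<noteq> {}" for a
    proof
      assume aC: "a \<in> C"
      obtain b where b: "b \<in> Y" "E x b" using a(2) by (auto simp: nb_def)
      have ya: "E y a" using a by (simp add: nb_def)
      note b1 = frame_right_mixed[OF C Y c u(3,4,2) full y xA w(1) w(2)[symmetric] aC ya sym[OF xy] _ w(3,4)]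
      note b2 = frame_right_mixed[OF C Y c u(4,3) u(2)[symmetric] full y xA w(1) w(2)[symmetric] aC ya sym[OF xy] _ w(4,3)]
      note b3 = frame_new_edge[OF C Y c u(3,4,2) full y xA w(1) w(2)[symmetric] _ aC ya sym[OF xy] b(2) w(3,4)]
      show False using b1 b2 b3 b by blast
    qed
    show False
    proof (cases "2 \<le> card (nb S y)")
      case True
      then obtain a where a: "a \<in> nb S y" by (rule exists_other)
      have "nb S y \<subseteq> C" using dy True by auto
      moreover have "nb Y x \<noteq> {}" using sum dy2 l4 by auto
      ultimately show False using noC[OF a] a by auto
    next
      case False
      then have xU: "nb Y x = U" "card (nb Y x) = 2" using dx cU sum l4 by auto
      then have "nb S y \<noteq> {}" using sum l4 by auto
      then obtain a where a: "a \<in> nb S y" by blast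
      have "nb Y x \<noteq> {}" using xU by auto
      then have aC: "a \<notin> C" using noC[OF a] by blast
      have aA: "a \<in> A - C" "a \<in> S" "E y a" "x \<noteq> a" using a aC S x by (auto simp: nb_def)
      have "u1 \<in> nb Y x" using xU u by auto
      then have xu: "E x u1" by (simp add: nb_def)
      show False by (rule frame_right_two_outside[OF C Y c u(3,4,2) full y xA aA(1,4) xu _ sym[OF xy] aA(3)]) (use SU aA u in auto)
    qed
  qed
  then have sum: "l \<le> card (nb Y x) + card (nb S y)" using d by simp
  have d1: "2 \<le> card (nb Y x)" "l - 2 \<le> card (nb S y)" using sum dx2 dy2 l4 by auto
  have xU: "nb Y x = U" by (rule shape_extend_left[OF S sh ex x d1(1)])
  have sh1: "shape (l - 2) S (insert y Y) C U" by (rule shape_extend_right[OF S Y sh ex c y d1(2)])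
  have "nb (insert y Y) x = U" using xU nadj by (auto simp: nb_def)
  then show ?thesis using sh1 unfolding shape_def by auto
qed

definition shaped :: "'a set \<Rightarrow> 'a set \<Rightarrow> bool" where
  "shaped S Y \<longleftrightarrow> (\<exists>C U. shape (l - 2) S Y C U \<and> ext S Y C U)
     \<or> (\<exists>C U. shape (l - 2) Y S C U \<and> bip_graph.ext B E Y S C U)"

text \<open>In the reversed orientation the edge count falls short of the bound by
  \<open>(l - 4) * (card Y - card S)\<close>.\<close>

lemma shaped_ed_le:
  assumes "shaped S Y" "S \<subseteq> A" "Y \<subseteq> B" "card S \<le> card Y" "l - 1 \<le> card S"
  shows "ed S Y \<le> (l - 2) * card Y + 2 * (card S - (l - 2))"
proof -
  have fin: "finite S" "finite Y" using assms finA finB finite_subset by auto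
  consider C U where "shape (l - 2) S Y C U" | C U where "shape (l - 2) Y S C U"
    using assms(1) unfolding shaped_def by blast
  then show ?thesis
  proof cases
    case 1
    then show ?thesis using shape_ed[OF 1 fin] by simp
  next
    case 2
    have e: "ed S Y = (l - 2) * card S + 2 * (card Y - (l - 2))" using shape_ed[OF 2 fin(2,1)] ed_swap[of S Y] by simp
    obtain k where k: "card Y = card S + k" using assms(4) le_Suc_ex by blast
    obtain q where q: "l - 2 = q" by simp
    have "2 * k \<le> q * k" using l4 q by (intro mult_right_mono) auto
    moreover have "card Y - q = card S - q + k" using k assms(5) l4 q by simp
    ultimately show ?thesis using e k unfolding q by (simp add: algebra_simps)
  qed
qed

end

section \<open>Descent to a balanced subgraph of order \<open>2 (l - 1)\<close>\<close>

text \<open>The right side exceeds the left one by \<open>(m - 2) * (k - m)\<close>.\<close>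

lemma small_square: "2 \<le> m \<Longrightarrow> m \<le> k \<Longrightarrow> m * m + 2 * k \<le> (k + 2) * m" for m k :: nat
proof -
  assume "2 \<le> m" "m \<le> k"
  then obtain i j where "m = 2 + i" "k = m + j" by (metis le_Suc_ex)
  then show ?thesis by (simp add: algebra_simps)
qed

context no_long begin

text \<open>Reaching the bound suffices as a premise, so that together with
  \<open>shaped_ed_le\<close> one induction serves both the inequality and its equality
  case.\<close>

lemma shaped_of_many_edges:
  assumes "S \<subseteq> A" "Y \<subseteq> B" "card S \<le> card Y \<and> l \<le> card S \<or> card S = l - 1 \<and> card Y = l - 1"
    "(l - 2) * card Y + 2 * (card S - (l - 2)) \<le> ed S Y"
  shows "shaped S Y"
  using assms
proof (induction "card S + card Y" arbitrary: S Y rule: less_induct)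
  case less
  note S = less.prems(1) and Y = less.prems(2) and c = less.prems(3) and e = less.prems(4)
  interpret sw: no_long B A E l by (rule swapped)
  have fin: "finite S" "finite Y" using S Y finA finB finite_subset by auto
  obtain k where k: "l = k + 2" "2 \<le> k" using that[of "l - 2"] l4 by simp
  have lk: "l - 2 = k" "l - 1 = Suc k" using k by auto
  consider (base) "card S = l - 1" "card Y = l - 1" | (bal) "card S = card Y" "l \<le> card S" | (big) "card S < card Y" "l \<le> card S"
    using c by linarith
  then show ?case
  proof cases
    case base
    have "card (miss S Y) + 3 \<le> l" using ed_miss[OF fin] e base k by (simp add: algebra_simps)
    then show ?thesis unfolding shaped_def by (rule near_complete_shape[OF S Y base])
  next
    case big
    show ?thesis
    proof (cases "\<exists>y\<in>Y. card (nb S y) \<le> l - 2")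
      case True
      then obtain y where y: "y \<in> Y" "card (nb S y) \<le> l - 2" by blast
      define Y' where "Y' = Y - {y}"
      have Y': "insert y Y' = Y" "y \<notin> Y'" "finite Y'" "Y' \<subseteq> B" "card Y = Suc (card Y')"
        using y fin Y card_Suc_Diff1[OF fin(2) y(1)] by (auto simp: Y'_def)
      have ey: "ed S Y = ed S Y' + card (nb S y)" using ed_insert'[OF fin(1) Y'(3,2)] Y'(1) by simp
      have "(l - 2) * card Y' + 2 * (card S - (l - 2)) \<le> ed S Y'" using e ey y(2) Y'(5) by simp
      moreover have "card S + card Y' < card S + card Y" using Y' by simp
      moreover have cc: "card S \<le> card Y'" using big Y' by simp
      ultimately have sh: "shaped S Y'" using less.hyps[OF _ S Y'(4)] big by blast
      \<comment> \<open>The smaller subgraph does not exceed its own bound, so \<open>y\<close> has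
        exactly the degree by which the bound drops.\<close>
      have "ed S Y' \<le> (l - 2) * card Y' + 2 * (card S - (l - 2))"
        by (rule shaped_ed_le[OF sh S Y'(4) cc]) (use big in simp)
      then have d: "l - 2 \<le> card (nb S y)" using e ey Y'(5) by simp
      have yB: "y \<in> B - Y'" using y Y Y' by auto
      have cY: "l - 1 \<le> card Y'" "l \<le> card Y" using cc big by auto
      from sh consider C U where "shape (l - 2) S Y' C U" "ext S Y' C U" | C U where "shape (l - 2) Y' S C U" "sw.ext Y' S C U"
        unfolding shaped_def by blast
      then show ?thesis
      proof cases
        case 1
        have "shape (l - 2) S Y C U" using shape_extend_right(2)[OF S Y'(4) 1 cY(1) yB d] Y'(1) by simp
        then show ?thesis using shape_ext[OF S Y _ big(2) cY(2)] unfolding shaped_def by blast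
      next
        case 2
        \<comment> \<open>In the reversed orientation \<open>y\<close> enters the class containing
          \<open>C\<close>, where two neighbours already force its neighbourhood to be
          \<open>U\<close>.\<close>
        have "2 \<le> card (nb S y)" using d l4 by simp
        then have "shape (l - 2) Y S C U" using sw.shape_extend_left(2)[OF Y'(4) 2 yB] Y'(1) by simp
        then show ?thesis using sw.shape_ext[OF Y S _ cY(2) big(2)] unfolding shaped_def by blast
      qed
    next
      case False
      then have "l - 1 \<le> card (nb S y)" if "y \<in> Y" for y using that by force
      moreover have "Y \<noteq> {}" "card S \<le> card Y" using big by auto
      ultimately show ?thesis using no_heavy_side[OF S Y] by blast
    qed
  next
    case bal
    show ?thesis
    proof (cases "\<exists>x\<in>S. \<exists>y\<in>Y. card (nb Y x) + card (nb S y) \<le> l + (if E x y then 1 else 0)")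
      case True
      then obtain x y where xy: "x \<in> S" "y \<in> Y" and dl: "card (nb Y x) + card (nb S y) \<le> l + (if E x y then 1 else 0)" by blast
      define Y' where "Y' = Y - {y}"
      define S' where "S' = S - {x}"
      have Y': "insert y Y' = Y" "y \<notin> Y'" "finite Y'" "Y' \<subseteq> B" "card Y = Suc (card Y')"
        using xy fin Y card_Suc_Diff1[OF fin(2) xy(2)] by (auto simp: Y'_def)
      have S': "insert x S' = S" "x \<notin> S'" "finite S'" "S' \<subseteq> A" "card S = Suc (card S')"
        using xy fin S card_Suc_Diff1[OF fin(1) xy(1)] by (auto simp: S'_def)
      have "ed S Y = ed S' Y + card (nb Y x)" using ed_insert[OF S'(3) fin(2) S'(2)] S'(1) by simp
      also have "ed S' Y = ed S' Y' + card (nb S' y)" using ed_insert'[OF S'(3) Y'(3,2)] Y'(1) by simp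
      finally have e1: "ed S Y = ed S' Y' + card (nb S' y) + card (nb Y x)" .
      have nx: "card (nb Y x) = card (nb Y' x) + (if E x y then 1 else 0)"
      proof -
        have "nb Y x = (if E x y then insert y (nb Y' x) else nb Y' x)" using xy by (auto simp: nb_def Y'_def)
        moreover have "y \<notin> nb Y' x" "finite (nb Y' x)" using Y' by (auto simp: nb_def)
        ultimately show ?thesis by simp
      qed
      have ny: "card (nb S y) = card (nb S' y) + (if E x y then 1 else 0)"
      proof -
        have "nb S y = (if E x y then insert x (nb S' y) else nb S' y)" using xy sym by (auto simp: nb_def S'_def)
        moreover have "x \<notin> nb S' y" "finite (nb S' y)" using S' by (auto simp: nb_def)
        ultimately show ?thesis by simp
      qed
      \<comment> \<open>The number of edges lost with the pair: the degree sum, but with an edge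
        between \<open>x\<close> and \<open>y\<close> counted once.\<close>
      define t where "t = card (nb Y' x) + card (nb S' y) + (if E x y then 1 else 0)"
      have e2: "ed S Y = ed S' Y' + t" using e1 nx by (simp add: t_def)
      have tl: "t \<le> l" using dl nx ny by (simp add: t_def split: if_splits)
      have cS': "card S' = card Y'" "l - 1 \<le> card S'" using bal S'(5) Y'(5) by auto
      have bnd: "(l - 2) * card Y + 2 * (card S - (l - 2)) = (l - 2) * card Y' + 2 * (card S' - (l - 2)) + l"
      proof -
        have "k \<le> card S'" using cS' k by simp
        then show ?thesis using S'(5) Y'(5) k by (simp add: algebra_simps Suc_diff_le)
      qed
      have "(l - 2) * card Y' + 2 * (card S' - (l - 2)) \<le> ed S' Y'" using e e2 tl bnd by simp
      moreover have "card S' + card Y' < card S + card Y" using Y' S' by simp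
      moreover have "card S' \<le> card Y' \<and> l \<le> card S' \<or> card S' = l - 1 \<and> card Y' = l - 1" using cS' by linarith
      ultimately have sh: "shaped S' Y'" using less.hyps[OF _ S'(4) Y'(4)] by blast
      have "ed S' Y' \<le> (l - 2) * card Y' + 2 * (card S' - (l - 2))"
        by (rule shaped_ed_le[OF sh S'(4) Y'(4)]) (use cS' in auto)
      then have lt: "l \<le> t" using e e2 bnd by simp
      have yB: "y \<in> B - Y'" "x \<in> A - S'" using xy S Y Y' S' by auto
      have cY: "l - 1 \<le> card Y'" "l \<le> card Y" using cS' bal by auto
      from sh consider C U where "shape (l - 2) S' Y' C U" "ext S' Y' C U" | C U where "shape (l - 2) Y' S' C U" "sw.ext Y' S' C U"
        unfolding shaped_def by blast
      then show ?thesis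
      proof cases
        case 1
        have "shape (l - 2) S Y C U"
          using shape_extend_pair[OF S'(4) Y'(4) 1 cY(1) yB(2,1)] lt S'(1) Y'(1) unfolding t_def by simp
        then show ?thesis using shape_ext[OF S Y _ bal(2) cY(2)] unfolding shaped_def by blast
      next
        case 2
        have "E y x \<longleftrightarrow> E x y" using sym by blast
        then have "l \<le> card (nb S' y) + card (nb Y' x) + (if E y x then 1 else 0)" using lt unfolding t_def by simp
        then have "shape (l - 2) Y S C U"
          using sw.shape_extend_pair[OF Y'(4) S'(4) 2 cS'(2) yB(1,2)] S'(1) Y'(1) by simp
        then show ?thesis using sw.shape_ext[OF Y S _ cY(2) bal(2)] unfolding shaped_def by blast
      qed
    next
      case False
      then have deg: "l + 1 \<le> card (nb Y x) + card (nb S y)" if "x \<in> S" "y \<in> Y" for x y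
        using that by (fastforce split: if_splits)
      have "pm S Y" by (rule pm_of_degree_sums[OF S Y bal(1) deg])
      moreover have "S \<noteq> {}" using bal l4 by auto
      ultimately obtain S1 Y1 where 1: "S1 \<subseteq> S" "Y1 \<subseteq> Y" "S1 \<noteq> {}" "card S1 = card Y1" "card S1 < l"
        "\<And>x. x \<in> S1 \<Longrightarrow> nb Y x \<subseteq> Y1" "\<And>y. y \<in> Y1 \<Longrightarrow> nb S y \<subseteq> S1"
        using pm_component[OF S _ Y _ deg] by metis
      define S2 Y2 where "S2 = S - S1" and "Y2 = Y - Y1"
      have fin1: "finite S1" "finite Y1" "finite S2" "finite Y2" 
        using finite_subset[OF 1(1) fin(1)] finite_subset[OF 1(2) fin(2)] fin S2_def Y2_def by auto
      define p where "p = card S1"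
      define m where "m = card S2"
      have cards: "card S = p + m" "card Y2 = m" "card Y1 = p" "0 < p" "p < l"
        using 1 fin fin1 bal by (auto simp: p_def m_def S2_def Y2_def card_Diff_subset card_mono card_gt_0_iff)
      have no1: "\<not> E x y" if "x \<in> S1" "y \<in> Y2" for x y
        using 1(6)[OF that(1)] that by (auto simp: nb_def Y2_def)
      have no2: "\<not> E x y" if "x \<in> S2" "y \<in> Y1" for x y
        using 1(7)[OF that(2)] that sym by (auto simp: nb_def S2_def)
      have split: "ed S Y \<le> ed S1 Y1 + ed S2 Y2"
      proof -
        have "{(x, y). x \<in> S \<and> y \<in> Y \<and> E x y} \<subseteq> {(x, y). x \<in> S1 \<and> y \<in> Y1 \<and> E x y} \<union> {(x, y). x \<in> S2 \<and> y \<in> Y2 \<and> E x y}"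
          using no1 no2 by (auto simp: S2_def Y2_def)
        moreover have "finite {(x, y). x \<in> S1 \<and> y \<in> Y1 \<and> E x y}" "finite {(x, y). x \<in> S2 \<and> y \<in> Y2 \<and> E x y}"
          using fin1 by (auto intro: finite_subset[of _ "S1 \<times> Y1"] finite_subset[of _ "S2 \<times> Y2"])
        ultimately have "ed S Y \<le> card ({(x, y). x \<in> S1 \<and> y \<in> Y1 \<and> E x y} \<union> {(x, y). x \<in> S2 \<and> y \<in> Y2 \<and> E x y})"
          unfolding ed_def by (intro card_mono) auto
        also have "\<dots> \<le> ed S1 Y1 + ed S2 Y2" unfolding ed_def by (rule card_Un_le)
        finally show ?thesis .
      qed
      have "0 < m" using cards bal by linarith
      then have "S2 \<noteq> {}" "Y2 \<noteq> {}" using cards m_def by auto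
      then obtain x y where xy: "x \<in> S2" "y \<in> Y2" by blast
      have "nb Y x \<subseteq> Y2" "nb S y \<subseteq> S2" using no2[OF xy(1)] no1[OF _ xy(2)] sym by (auto simp: nb_def S2_def Y2_def)
      then have "card (nb Y x) \<le> m" "card (nb S y) \<le> m" using card_mono fin1 cards m_def by metis+
      \<comment> \<open>The degree sum of \<open>x\<close> and \<open>y\<close> is at least
        \<open>l + 1\<close>, and all their neighbours lie in the rest, so
        \<open>l + 1 \<le> 2 * m\<close>.\<close>
      then have m2: "2 \<le> m" using deg[of x y] xy l4 by (auto simp: S2_def Y2_def)
      have sub2: "S2 \<subseteq> A" "Y2 \<subseteq> B" using S Y by (auto simp: S2_def Y2_def)
      \<comment> \<open>For classes of size \<open>m \<ge> k\<close> the bound is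
        \<open>l * m - 2 * k\<close>. Up to \<open>m = k\<close> the trivial count
        \<open>m * m\<close> stays below this expression; beyond that the induction hypothesis
        applies.\<close>
      have e2: "ed S2 Y2 + 2 * k \<le> l * m"
      proof (cases "m \<le> k")
        case True
        have "ed S2 Y2 \<le> m * m" using ed_miss[OF fin1(3,4)] cards m_def by (metis le_add1)
        then show ?thesis using small_square[OF m2 True] k by simp
      next
        case False
        show ?thesis
        proof (rule ccontr)
          assume n: "\<not> ?thesis"
          have bd: "k * m + 2 * (m - k) + 2 * k = l * m" using False k by (simp add: algebra_simps)
          have "(l - 2) * card Y2 + 2 * (card S2 - (l - 2)) \<le> ed S2 Y2" using n bd cards lk m_def by simp
          moreover have "card S2 + card Y2 < card S + card Y" using cards bal m_def by simp
          moreover have "card S2 \<le> card Y2 \<and> l \<le> card S2 \<or> card S2 = l - 1 \<and> card Y2 = l - 1"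
            using False cards k m_def by linarith
          ultimately have "shaped S2 Y2" using less.hyps[OF _ sub2] by blast
          then have "ed S2 Y2 \<le> (l - 2) * card Y2 + 2 * (card S2 - (l - 2))"
            by (rule shaped_ed_le[OF _ sub2]) (use False cards lk m_def in auto)
          then show False using n bd cards lk m_def by simp
        qed
      qed
      \<comment> \<open>The component would have to contribute \<open>l * p\<close> edges but has at
        most \<open>p * p\<close>, with \<open>p < l\<close>.\<close>
      have e1: "ed S1 Y1 \<le> p * p" using ed_miss[OF fin1(1,2)] cards p_def by (metis le_add1)
      have "k \<le> p + m" using bal cards k by linarith
      then have "k * (p + m) + 2 * (p + m - k) + 2 * k = l * (p + m)" using k by (simp add: algebra_simps)
      then have "l * (p + m) \<le> ed S Y + 2 * k" using e cards bal lk by simp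
      also have "\<dots> \<le> p * p + l * m" using split e1 e2 by simp
      finally have "l * p \<le> p * p" by (simp add: algebra_simps)
      then show ?thesis using cards by simp
    qed
  qed
qed

end

section \<open>Translation to pair digraphs\<close>

lemma rtrancl_gpath:
  assumes "(x, y) \<in> R\<^sup>*"
  shows "\<exists>xs. gpath (\<lambda>u v. (u, v) \<in> R) xs \<and> hd xs = x \<and> last xs = y"
  using assms
proof (induction rule: converse_rtrancl_induct)
  case base
  then show ?case by (intro exI[of _ "[y]"]) simp
next
  case (step x z)
  then obtain xs where xs: "gpath (\<lambda>u v. (u, v) \<in> R) xs" "hd xs = z" "last xs = y" by blast
  show ?case
  proof (cases "x \<in> set xs")
    case True
    then obtain us vs where d: "xs = us @ x # vs" using split_list by metis
    then have "gpath (\<lambda>u v. (u, v) \<in> R) (x # vs)" using xs(1) by (auto simp: gpath_append split: if_splits)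
    then show ?thesis using xs(3) d by (intro exI[of _ "x # vs"]) simp
  next
    case False
    then show ?thesis using xs step(1) gpath_ne[OF xs(1)]
      by (intro exI[of _ "x # xs"]) (auto simp: gpath_Cons)
  qed
qed

text \<open>Library walks are arc lists; a closed vertex list becomes one by pairing each vertex
  with its successor.\<close>

lemma pcas_zip: "pcas u (zip (u # xs) (xs @ [w])) w"
  by (induction xs arbitrary: u) auto

lemma pawalk_verts_zip: "pawalk_verts u (zip (u # xs) (xs @ [w])) = u # xs @ [w]"
  by (induction xs arbitrary: u) auto

lemma set_zip_successively:
  "successively (\<lambda>u v. (u, v) \<in> R) (u # xs) \<Longrightarrow> (last (u # xs), w) \<in> R
    \<Longrightarrow> set (zip (u # xs) (xs @ [w])) \<subseteq> R"
  by (induction xs arbitrary: u) auto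

lemma has_cycle_of_gcycle:
  assumes "pair_wf_digraph G" "gcycle (\<lambda>u v. (u, v) \<in> parcs G) c" "k \<le> length c"
  shows "has_cycle_of_length_ge G k"
proof -
  obtain u xs where c: "c = u # xs" using assms(2) by (cases c) (auto simp: gcycle_def)
  define p where "p = zip (u # xs) (xs @ [u])"
  have g: "successively (\<lambda>u v. (u, v) \<in> parcs G) (u # xs)" "(last (u # xs), u) \<in> parcs G" "distinct (u # xs)"
    using assms(2) c by (auto simp: gcycle_def)
  have "set p \<subseteq> parcs G" unfolding p_def by (rule set_zip_successively[OF g(1,2)])
  moreover have "u \<in> pverts G" using assms(1) g(2) by (metis pair_wf_digraph.in_arcsD2)
  ultimately have "pre_digraph.awalk (with_proj G) u p u"
    using pcas_zip[of u xs u] by (simp add: pre_digraph.awalk_def cas_with_proj_eq p_def)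
  moreover have "distinct (tl (pre_digraph.awalk_verts (with_proj G) u p))"
    using g(3) by (simp add: awalk_verts_with_proj_eq pawalk_verts_zip p_def)
  ultimately have "pre_digraph.cycle (with_proj G) p"
    unfolding pre_digraph.cycle_def using c p_def by auto
  moreover have "length p = length c" using c p_def by simp
  ultimately show ?thesis using assms(3) unfolding has_cycle_of_length_ge_def by metis
qed

text \<open>Library connectedness speaks of the symmetric closure, whose arcs are all
  \<open>E\<close>-edges here. A general \<open>H\<close> covers both the graph and its
  vertex-deleted subgraphs.\<close>

lemma connected_gpath:
  assumes con: "Digraph_Component.connected H" and sym: "\<And>e. e \<in> arcs H \<Longrightarrow> E (tail H e) (head H e) \<and> E (head H e) (tail H e)"
    and xy: "x \<in> verts H" "y \<in> verts H"
    and wf: "\<And>e. e \<in> arcs H \<Longrightarrow> tail H e \<in> verts H \<and> head H e \<in> verts H"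
  shows "\<exists>xs. gpath E xs \<and> hd xs = x \<and> last xs = y \<and> set xs \<subseteq> verts H"
proof -
  define R where "R = parcs (mk_symmetric H)"
  have "strongly_connected (with_proj (mk_symmetric H))" using con unfolding Digraph_Component.connected_def .
  then have "x \<rightarrow>\<^sup>*\<^bsub>with_proj (mk_symmetric H)\<^esub> y" using xy by (auto simp: strongly_connected_def)
  then have "(x, y) \<in> R\<^sup>*" unfolding reachable_def R_def by (simp add: rtrancl_on_rtranclI)
  then obtain xs where xs: "gpath (\<lambda>u v. (u, v) \<in> R) xs" "hd xs = x" "last xs = y" using rtrancl_gpath by metis
  have RE: "E u v \<and> v \<in> verts H" if "(u, v) \<in> R" for u v
    using that sym wf unfolding R_def parcs_mk_symmetric by auto
  have "successively E xs" using xs(1) RE unfolding gpath_def by (metis (mono_tags, lifting) successively_mono)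
  moreover have "set ys \<subseteq> verts H" if "successively (\<lambda>u v. (u, v) \<in> R) ys" "ys \<noteq> []" "hd ys \<in> verts H" for ys
    using that by (induction ys rule: induct_list012) (auto dest: RE)
  ultimately show ?thesis using xs xy(1) unfolding gpath_def by blast
qed

lemma no_long_of_graph:
  fixes G :: "'a pair_pre_digraph"
  assumes "4 \<le> l" "pair_graph G" "two_connected G" "bipartition G A B" "l \<le> card A" "l \<le> card B"
    "\<not> has_cycle_of_length_ge G (2 * l)"
  shows "no_long A B (\<lambda>u v. (u, v) \<in> parcs G) l"
proof -
  interpret pair_graph G by fact
  have bp: "A \<union> B = pverts G" "A \<inter> B = {}" "parcs G \<subseteq> A \<times> B \<union> B \<times> A"
    using assms(4) by (auto simp: bipartition_def)
  have sm: "(v, u) \<in> parcs G" if "(u, v) \<in> parcs G" for u v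
    using pair_sym_arcs that by (simp add: symmetric_def symD)
  show ?thesis
  proof
    show "finite A" "finite B" using bp(1) pair_finite_verts by (metis finite_Un)+
    show "A \<inter> B = {}" by (rule bp)
    show "(y, x) \<in> parcs G" if "(x, y) \<in> parcs G" for x y by (rule sm[OF that])
    show "x \<in> A \<and> y \<in> B \<or> x \<in> B \<and> y \<in> A" if "(x, y) \<in> parcs G" for x y using that bp(3) by blast
    show "\<exists>xs. gpath (\<lambda>u v. (u, v) \<in> parcs G) xs \<and> hd xs = x \<and> last xs = y \<and> v \<notin> set xs"
      if "x \<in> A \<union> B" "y \<in> A \<union> B" "x \<noteq> v" "y \<noteq> v" for x y v
    proof (cases "v \<in> pverts G")
      case True
      let ?H = "pre_digraph.del_vert (with_proj G) v"
      have "Digraph_Component.connected ?H" using assms(3) True unfolding two_connected_def by blast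
      then have "\<exists>xs. gpath (\<lambda>u v. (u, v) \<in> parcs G) xs \<and> hd xs = x \<and> last xs = y \<and> set xs \<subseteq> verts ?H"
        by (rule connected_gpath) (use that bp(1) sm in \<open>auto simp: pre_digraph.del_vert_simps in_arcsD1 in_arcsD2\<close>)
      then show ?thesis by (auto simp: pre_digraph.del_vert_simps)
    next
      case False
      have "Digraph_Component.connected (with_proj G)" using assms(3) unfolding two_connected_def by blast
      then have "\<exists>xs. gpath (\<lambda>u v. (u, v) \<in> parcs G) xs \<and> hd xs = x \<and> last xs = y \<and> set xs \<subseteq> verts (with_proj G)"
        by (rule connected_gpath) (use that bp(1) sm in \<open>auto simp: in_arcsD1 in_arcsD2\<close>)
      then show ?thesis using False by auto
    qed
    show "length c < 2 * l" if "gcycle (\<lambda>u v. (u, v) \<in> parcs G) c" for c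
      using has_cycle_of_gcycle[OF pair_wf_digraph_axioms that] assms(7) by (meson linorder_not_less)
  qed (use assms in auto)
qed

lemma shape_iso:
  fixes G :: "'a pair_pre_digraph"
  assumes bg: "bip_graph P Q (\<lambda>u v. (u, v) \<in> parcs G)" and wf: "wf_digraph (with_proj G)"
    and V: "pverts G = P \<union> Q" and sh: "bip_graph.shape (\<lambda>u v. (u, v) \<in> parcs G) (l - 2) P Q C U"
  shows "digraph_iso (with_proj G) (with_proj (B2_graph (card P) (card Q) l))"
proof -
  interpret bip_graph P Q "\<lambda>u v. (u, v) \<in> parcs G" by fact
  define a b k where "a = card P" and "b = card Q" and "k = l - 2"
  have C: "C \<subseteq> P" "card C = k" "U \<subseteq> Q" "card U = 2" "\<And>c. c \<in> C \<Longrightarrow> nb Q c = Q" "\<And>x. x \<in> P - C \<Longrightarrow> nb Q x = U"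
    using sh by (auto simp: shape_def k_def)
  have fin: "finite C" "finite (P - C)" "finite U" "finite (Q - U)" using C finA finB finite_subset by auto
  have b2: "2 \<le> b" "k \<le> a" using card_mono[OF finB C(3)] C(4) card_mono[OF finA C(1)] C(2) by (auto simp: a_def b_def)
  obtain f1 where f1: "bij_betw f1 C {..<k}" using finite_same_card_bij[OF fin(1), of "{..<k}"] C(2) by auto
  have "card (P - C) = a - k" using C finA by (simp add: card_Diff_subset fin a_def)
  then obtain f2 where f2: "bij_betw f2 (P - C) {k..<a}" using finite_same_card_bij[OF fin(2), of "{k..<a}"] by auto
  obtain g1 where g1: "bij_betw g1 U {0, 1::nat}" using finite_same_card_bij[OF fin(3), of "{0, 1::nat}"] C(4) by auto
  have "card (Q - U) = b - 2" using C finB by (simp add: card_Diff_subset fin b_def)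
  then obtain g2 where g2: "bij_betw g2 (Q - U) {2..<b}" using finite_same_card_bij[OF fin(4), of "{2..<b}"] by auto
  define f :: "'a \<Rightarrow> nat + nat" where
    "f = (\<lambda>x. if x \<in> P then Inl (if x \<in> C then f1 x else f2 x) else Inr (if x \<in> U then g1 x else g2 x))"
  have QP: "x \<notin> P" if "x \<in> Q" for x using that disj by auto
  have im: "f ` C = Inl ` {..<k}" "f ` (P - C) = Inl ` {k..<a}" "f ` U = {Inr 0, Inr 1}" "f ` (Q - U) = Inr ` {2..<b}"
  proof -
    have "f ` C = Inl ` f1 ` C" using C(1) by (force simp: f_def image_image)
    then show "f ` C = Inl ` {..<k}" using f1 by (simp add: bij_betw_def)
    have "f ` (P - C) = Inl ` f2 ` (P - C)" by (force simp: f_def image_image)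
    then show "f ` (P - C) = Inl ` {k..<a}" using f2 by (simp add: bij_betw_def)
    have "f ` U = Inr ` g1 ` U" using C(3) QP by (force simp: f_def image_image)
    then show "f ` U = {Inr 0, Inr 1}" using g1 by (simp add: bij_betw_def)
    have "f ` (Q - U) = Inr ` g2 ` (Q - U)" using QP by (force simp: f_def image_image)
    then show "f ` (Q - U) = Inr ` {2..<b}" using g2 by (simp add: bij_betw_def)
  qed
  have imQ: "f ` Q = Inr ` {..<b}"
  proof -
    have "f ` Q = f ` U \<union> f ` (Q - U)" using C(3) by auto
    also have "\<dots> = Inr ` ({0, 1} \<union> {2..<b})" using im by auto
    also have "{0, 1} \<union> {2..<b} = {..<b}" using b2 by auto
    finally show ?thesis .
  qed
  have imP: "f ` P = Inl ` {..<a}"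
  proof -
    have "f ` P = f ` C \<union> f ` (P - C)" using C(1) by auto
    also have "\<dots> = Inl ` ({..<k} \<union> {k..<a})" using im by auto
    also have "{..<k} \<union> {k..<a} = {..<a}" using b2 by auto
    finally show ?thesis .
  qed
  \<comment> \<open>By counting: the image has as many elements as the domain.\<close>
  have inj: "inj_on f (P \<union> Q)"
  proof -
    have "card (f ` (P \<union> Q)) = card (P \<union> Q)"
    proof -
      have "card (f ` (P \<union> Q)) = card (Inl ` {..<a} \<union> Inr ` {..<b} :: (nat + nat) set)"
        by (simp add: image_Un imP imQ)
      also have "\<dots> = a + b" by (subst card_Un_disjoint) (auto simp: card_image)
      also have "\<dots> = card (P \<union> Q)" using finA finB disj by (simp add: card_Un_disjoint a_def b_def)
      finally show ?thesis .
    qed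
    then show ?thesis using finA finB by (intro eq_card_imp_inj_on) auto
  qed
  define H where "H = C \<times> Q \<union> (P - C) \<times> U"
  have H1: "(x, y) \<in> parcs G \<longleftrightarrow> (x, y) \<in> H" if "x \<in> P" for x y
  proof -
    have "(x, y) \<in> parcs G \<longleftrightarrow> y \<in> nb Q x" using adj_A that by (auto simp: nb_def)
    then show ?thesis using C(5)[of x] C(6)[of x] that by (auto simp: H_def)
  qed
  have arcs: "parcs G = H \<union> H\<inverse>"
  proof (intro set_eqI iffI)
    fix e assume "e \<in> parcs G"
    then obtain x y where e: "e = (x, y)" "(x, y) \<in> parcs G" by (cases e) auto
    show "e \<in> H \<union> H\<inverse>"
    proof (cases "x \<in> P")
      case True
      then show ?thesis using H1 e by auto
    next
      case False
      then have "y \<in> P" using bip[OF e(2)] by auto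
      then show ?thesis using H1[of y x] sym[OF e(2)] e by auto
    qed
  next
    fix e assume "e \<in> H \<union> H\<inverse>"
    then obtain x y where e: "(x, y) \<in> H" "e = (x, y) \<or> e = (y, x)" by (cases e) auto
    have "x \<in> P" using e(1) C(1) by (auto simp: H_def)
    then show "e \<in> parcs G" using H1 e sym by blast
  qed
  have imH: "map_prod f f ` H = B2_half_arcs a b l"
    unfolding H_def B2_half_arcs_def image_Un map_prod_surj_on[OF refl refl] im imQ k_def[symmetric] by simp
  have imH': "map_prod f f ` (H\<inverse>) = (map_prod f f ` H)\<inverse>"
    by force
  define hom :: "('a, 'a \<times> 'a, nat + nat, (nat + nat) \<times> (nat + nat)) digraph_isomorphism" where
    "hom = \<lparr> iso_verts = f, iso_arcs = map_prod f f, iso_head = snd, iso_tail = fst \<rparr>"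
  have "parcs G \<subseteq> (P \<union> Q) \<times> (P \<union> Q)" using bip by auto
  then have "inj_on (map_prod f f) (parcs G)"
    using map_prod_inj_on[OF inj inj] inj_on_subset by blast
  then have "pre_digraph.digraph_isomorphism (with_proj G) hom"
    unfolding pre_digraph.digraph_isomorphism_def using wf inj V by (auto simp: hom_def)
  moreover have "with_proj (B2_graph a b l) = app_iso hom (with_proj G)"
    unfolding app_iso_def with_proj_def B2_graph_def hom_def
    by (simp add: V arcs image_Un imP imQ imH imH')
  ultimately show ?thesis unfolding digraph_iso_def a_def b_def by blast
qed

text \<open>For \<open>k = 2\<close>, adjacency of \<open>x\<close> in \<open>A\<close> and
  \<open>y\<close> in \<open>B\<close> means \<open>y \<in> C \<or> x \<in> U\<close>, which treats
  the two 2-sets alike. So for \<open>l = 4\<close> both orientations describe the same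
  graph.\<close>

lemma (in bip_graph) shape_two_swap:
  assumes "shape 2 B A C U"
  shows "shape 2 A B U C"
proof -
  have C: "C \<subseteq> B" "card C = 2" "U \<subseteq> A" "card U = 2" "\<And>c. c \<in> C \<Longrightarrow> nb A c = A" "\<And>x. x \<in> B - C \<Longrightarrow> nb A x = U"
    using assms by (auto simp: shape_def)
  have adj: "E x y \<longleftrightarrow> y \<in> C \<or> x \<in> U" if "x \<in> A" "y \<in> B" for x y
  proof -
    have "E x y \<longleftrightarrow> x \<in> nb A y" using sym that by (auto simp: nb_def)
    then show ?thesis using C(5)[of y] C(6)[of y] C(3) that by (cases "y \<in> C") auto
  qed
  show ?thesis unfolding shape_def
    using C(1-4) adj by (auto simp: nb_def)
qed

lemma card_half:
  assumes "finite H" "H \<subseteq> P \<times> Q" "P \<inter> Q = {}"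
  shows "card (H \<union> H\<inverse>) = 2 * card H"
proof -
  have "H \<inter> H\<inverse> = {}" using assms by auto
  moreover have "card (H\<inverse>) = card H" by (simp add: card_inverse)
  ultimately show ?thesis using assms(1) by (simp add: card_Un_disjoint)
qed

lemma card_B2_half_arcs:
  assumes "l - 2 \<le> a"
  shows "card (B2_half_arcs a b l) = (l - 2) * b + 2 * (a - (l - 2))"
proof -
  have "card (B2_half_arcs a b l) = card ((Inl ` {..<l - 2} :: (nat + nat) set) \<times> (Inr ` {..<b} :: (nat + nat) set))
      + card ((Inl ` {l - 2..<a} :: (nat + nat) set) \<times> ({Inr 0, Inr 1} :: (nat + nat) set))"
    unfolding B2_half_arcs_def by (rule card_Un_disjoint) auto
  then show ?thesis by (simp add: card_cartesian_product card_image)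
qed

theorem theorem1:
  fixes l a b :: nat and G :: "'a pair_pre_digraph" and A B :: "'a set"
  assumes "l \<ge> 4"
    and "pair_graph G"
    and "two_connected G"
    and "bipartition G A B"
    and "card A = a" and "card B = b"
    and "b \<ge> a" and "a \<ge> l"
    and "\<not> has_cycle_of_length_ge G (2 * l)"
  shows "real (card (uedges G))
           \<le> real l / 2 * (real a + real b) + (real l / 2 - 2) * (real b - real a - 4) - 4
       \<and> (real (card (uedges G))
             = real l / 2 * (real a + real b) + (real l / 2 - 2) * (real b - real a - 4) - 4
           \<longleftrightarrow> digraph_iso (with_proj G) (with_proj (B2_graph a b l)))"
proof -
  define E where "E = (\<lambda>u v. (u, v) \<in> parcs G)"
  interpret G: pair_graph G by fact
  interpret no_long A B E l
    unfolding E_def by (rule no_long_of_graph[OF assms(1-4)]) (use assms in auto)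
  have bp: "A \<union> B = pverts G" using assms(4) by (simp add: bipartition_def)
  define N where "N = (l - 2) * b + 2 * (a - (l - 2))"
  have RHS: "real l / 2 * (real a + real b) + (real l / 2 - 2) * (real b - real a - 4) - 4 = real N"
  proof -
    have "real N = (real l - 2) * real b + 2 * (real a - (real l - 2))"
      using assms(1,8) unfolding N_def by (simp add: of_nat_diff)
    then show ?thesis by (simp add: field_simps)
  qed
  define H where "H = {(x, y). x \<in> A \<and> y \<in> B \<and> E x y}"
  have finH: "finite H" by (rule finite_subset[of _ "A \<times> B"]) (use finA finB in \<open>auto simp: H_def\<close>)
  have arcs: "parcs G = H \<union> H\<inverse>" using bip sym by (auto simp: H_def E_def)
  have HAB: "H \<subseteq> A \<times> B" by (auto simp: H_def)
  have edH: "ed A B = card H" by (simp add: ed_def H_def)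
  have "uedges G = (\<lambda>(u, v). {u, v}) ` H"
    unfolding uedges_def arcs image_Un by (auto simp: image_iff insert_commute)
  moreover have "inj_on (\<lambda>(u, v). {u, v}) H"
    using disj by (auto simp: inj_on_def doubleton_eq_iff H_def)
  ultimately have ue: "card (uedges G) = ed A B" using edH by (simp add: card_image)
  have le: "ed A B \<le> N"
  proof (rule ccontr)
    assume n: "\<not> ed A B \<le> N"
    then have "shaped A B" using assms by (intro shaped_of_many_edges) (auto simp: N_def)
    then have "ed A B \<le> N" unfolding N_def using shaped_ed_le[of A B] assms by auto
    then show False using n by simp
  qed
  have "digraph_iso (with_proj G) (with_proj (B2_graph a b l))" if eq: "ed A B = N"
  proof -
    have wf: "wf_digraph (with_proj G)" by (rule G.wf_digraph_axioms)
    have sh: "shaped A B" using assms eq by (intro shaped_of_many_edges) (auto simp: N_def)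
    have iso1: ?thesis if "shape (l - 2) A B C U" for C U
      using shape_iso[of A B G l C U] bip_graph_axioms wf bp that assms unfolding E_def by simp
    from sh consider C U where "shape (l - 2) A B C U" | C U where "shape (l - 2) B A C U"
      unfolding shaped_def by blast
    then show ?thesis
    proof cases
      case 1
      then show ?thesis by (rule iso1)
    next
      case 2
      \<comment> \<open>Equating the count for the reversed orientation with \<open>N\<close> gives
        \<open>(l - 4) * (b - a) = 0\<close>. So either \<open>l = 4\<close>, or the classes have
        equal size and exchanging them changes nothing.\<close>
      have e: "ed A B = (l - 2) * a + 2 * (b - (l - 2))" using shape_ed[OF 2 finB finA] ed_swap[of A B] assms by simp
      show ?thesis
      proof (cases "l = 4")
        case True
        then show ?thesis using shape_two_swap[of C U] 2 iso1 by simp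
      next
        case False
        obtain d where d: "b = a + d" using assms(7) le_Suc_ex by blast
        obtain q where q: "l = q + 5" using that[of "l - 5"] False assms(1) by simp
        have "b - (l - 2) = a - (l - 2) + d" using d assms(8) by simp
        then have "(q + 3) * d = 2 * d" using e eq q d unfolding N_def by (simp add: algebra_simps)
        then have "a = b" using d by simp
        then show ?thesis
          using shape_iso[of B A G l C U] swapped_bip wf bp 2 assms unfolding E_def by (simp add: Un_commute)
      qed
    qed
  qed
  \<comment> \<open>An isomorphism preserves the number of arcs, so it is enough to count those of
    \<open>B2_graph\<close>.\<close>
  moreover have "ed A B = N" if iso: "digraph_iso (with_proj G) (with_proj (B2_graph a b l))"
  proof -
    obtain hom where hom: "pre_digraph.digraph_isomorphism (with_proj G) hom" "with_proj (B2_graph a b l) = app_iso hom (with_proj G)"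
      using iso unfolding digraph_iso_def by blast
    have "parcs (B2_graph a b l) = iso_arcs hom ` parcs G"
      using arg_cong[OF hom(2), of arcs] by (simp add: arcs_app_iso)
    moreover have "inj_on (iso_arcs hom) (parcs G)" using hom(1) by (simp add: pre_digraph.digraph_isomorphism_def)
    ultimately have "card (parcs (B2_graph a b l)) = card (parcs G)" by (simp add: card_image)
    moreover have "card (parcs G) = 2 * ed A B" using card_half[OF finH HAB disj] arcs edH by simp
    moreover have "card (parcs (B2_graph a b l)) = 2 * N"
    proof -
      have "card (B2_half_arcs a b l \<union> (B2_half_arcs a b l)\<inverse>) = 2 * card (B2_half_arcs a b l)"
        by (rule card_half[of _ "range Inl" "range Inr"]) (auto simp: B2_half_arcs_def)
      then show ?thesis using card_B2_half_arcs[of l a b] assms by (simp add: B2_graph_def N_def)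
    qed
    ultimately show ?thesis by simp
  qed
  ultimately show ?thesis unfolding RHS ue using le by auto
qed

end
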